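(* Let $(M,g,J)$ be a connected Hermitian manifold of real dimension $\dim M = 2n > 4$ which is not a Kähler manifold (i.e. $\nabla J$ does not vanish identically on $M$, where $\nabla$ is the Levi-Civita connection of $g$). If $(M,g,J)$ is of pointwise constant antiholomorphic sectional curvature, then the Riemannian manifold $(M,g)$ is of constant sectional curvature.
   Context: An almost Hermitian manifold $(M,g,J)$ is a smooth manifold with a Riemannian metric $g$ and an almost complex structure $J$ satisfying $g(JX,JY)=g(X,Y)$. It is Hermitian if $J$ is integrable; equivalently, $(\nabla_{JX}J)Y=J(\nabla_XJ)Y$ for all vector fields $X,Y$, where $\nabla$ is the Levi-Civita connection of $g$. A Hermitian manifold is Kähler if $\nabla J=0$. A two-plane $E\subset T_pM$ is called antiholomorphic (totally real) if $E\perp JE$; equivalently, it has an orthonormal basis $\{X,Y\}$ with $g(X,JY)=0$. The manifold $(M,g,J)$ is said to be of pointwise constant antiholomorphic sectional curvature if there is a function $\nu$ on $M$ such that for every $p\in M$ and every antiholomorphic two-plane $E\subset T_pM$ the Riemannian sectional curvature satisfies $K(E;p)=\nu(p)$. *)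

theory Defs
  imports "HOL-Analysis.Analysis"
begin

section \<open>Smooth manifolds\<close>

text \<open>Only used for open \<open>S\<close>: \<open>Ck_on k S f\<close> says that \<open>f\<close> is of class \<open>C^k\<close> on \<open>S\<close>.\<close>

primrec Ck_on :: "nat \<Rightarrow> 'a::euclidean_space set \<Rightarrow> ('a \<Rightarrow> 'b::real_normed_vector) \<Rightarrow> bool" where
  "Ck_on 0 S f \<longleftrightarrow> continuous_on S f"
| "Ck_on (Suc k) S f \<longleftrightarrow>
     (\<forall>x\<in>S. f differentiable (at x)) \<and> (\<forall>v. Ck_on k S (\<lambda>x. frechet_derivative f (at x) v))"

definition smooth_on :: "'a::euclidean_space set \<Rightarrow> ('a \<Rightarrow> 'b::real_normed_vector) \<Rightarrow> bool" where
  "smooth_on S f \<longleftrightarrow> (\<forall>k. Ck_on k S f)"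

text \<open>A chart is a pair of its domain and its coordinate map; the map is relevant only on the domain.\<close>

type_synonym ('m, 'e) chart = "'m set \<times> ('m \<Rightarrow> 'e)"

definition chart_inv :: "('m, 'e) chart \<Rightarrow> 'e \<Rightarrow> 'm" where
  "chart_inv c = inv_into (fst c) (snd c)"

definition is_chart :: "'m topology \<Rightarrow> ('m, 'e::euclidean_space) chart \<Rightarrow> bool" where
  "is_chart M c \<longleftrightarrow> openin M (fst c) \<and> open (snd c ` fst c) \<and>
     homeomorphic_map (subtopology M (fst c)) (top_of_set (snd c ` fst c)) (snd c)"

definition transition :: "('m, 'e) chart \<Rightarrow> ('m, 'e) chart \<Rightarrow> 'e \<Rightarrow> 'e" where
  "transition c d = (\<lambda>x. snd d (chart_inv c x))"

text \<open>The smooth structure is given by a smooth atlas, which need not be maximal.\<close>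

definition smooth_manifold :: "'m topology \<Rightarrow> ('m, 'e::euclidean_space) chart set \<Rightarrow> bool" where
  "smooth_manifold M A \<longleftrightarrow>
     Hausdorff_space M \<and> second_countable M \<and>
     (\<forall>c\<in>A. is_chart M c) \<and> topspace M = (\<Union>c\<in>A. fst c) \<and>
     (\<forall>c\<in>A. \<forall>d\<in>A. smooth_on (snd c ` (fst c \<inter> fst d)) (transition c d))"

definition charts_at :: "('m, 'e) chart set \<Rightarrow> 'm \<Rightarrow> ('m, 'e) chart set" where
  "charts_at A p = {c \<in> A. p \<in> fst c}"


section \<open>Tangent vectors and vector fields\<close>

text \<open>
  A tangent vector at \<open>p\<close> assigns to every chart around \<open>p\<close> its component vector in that chart, in
  such a way that the component vectors are related by the derivatives of the transition maps.
  The value at all other charts is fixed to be \<open>0\<close>, so that equality of tangent vectors is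
  equality of functions.
\<close>

type_synonym ('m, 'e) tvec = "('m, 'e) chart \<Rightarrow> 'e"

type_synonym ('m, 'e) vfield = "'m \<Rightarrow> ('m, 'e) tvec"

definition tangent_space ::
  "('m, 'e::euclidean_space) chart set \<Rightarrow> 'm \<Rightarrow> ('m, 'e) tvec set" where
  "tangent_space A p = {X.
     (\<forall>c\<in>charts_at A p. \<forall>d\<in>charts_at A p.
        X d = frechet_derivative (transition c d) (at (snd c p)) (X c)) \<and>
     (\<forall>d. d \<notin> charts_at A p \<longrightarrow> X d = 0)}"

definition lincomb ::
  "real \<Rightarrow> ('m, 'e::euclidean_space) tvec \<Rightarrow> real \<Rightarrow> ('m, 'e) tvec \<Rightarrow> ('m, 'e) tvec" where
  "lincomb a X b Y = (\<lambda>c. a *\<^sub>R X c + b *\<^sub>R Y c)"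

text \<open>The tangent vector at \<open>p\<close> whose component vector in the chart \<open>c\<close> around \<open>p\<close> is \<open>u\<close>.\<close>

definition coord_vec ::
  "('m, 'e::euclidean_space) chart set \<Rightarrow> ('m, 'e) chart \<Rightarrow> 'e \<Rightarrow> 'm \<Rightarrow> ('m, 'e) tvec" where
  "coord_vec A c u p = (\<lambda>d. if d \<in> charts_at A p
     then frechet_derivative (transition c d) (at (snd c p)) u else 0)"

definition smooth_vfield_on ::
  "('m, 'e::euclidean_space) chart set \<Rightarrow> 'm set \<Rightarrow> ('m, 'e) vfield \<Rightarrow> bool" where
  "smooth_vfield_on A W X \<longleftrightarrow>
     (\<forall>p\<in>W. X p \<in> tangent_space A p) \<and>
     (\<forall>c\<in>A. smooth_on (snd c ` (fst c \<inter> W)) (\<lambda>x. X (chart_inv c x) c))"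

text \<open>The derivative at \<open>p\<close> of the component vector of \<open>Y\<close> in the chart \<open>c\<close>, in the direction \<open>u\<close>.\<close>

definition dcomp ::
  "('m, 'e::euclidean_space) chart \<Rightarrow> ('m, 'e) vfield \<Rightarrow> 'm \<Rightarrow> 'e \<Rightarrow> 'e" where
  "dcomp c Y p u = frechet_derivative (\<lambda>x. Y (chart_inv c x) c) (at (snd c p)) u"

definition lie_bracket ::
  "('m, 'e::euclidean_space) chart set \<Rightarrow> ('m, 'e) vfield \<Rightarrow> ('m, 'e) vfield \<Rightarrow> ('m, 'e) vfield" where
  "lie_bracket A X Y = (\<lambda>p c. if c \<in> charts_at A p
     then dcomp c Y p (X p c) - dcomp c X p (Y p c) else 0)"


section \<open>Riemannian metrics, Levi-Civita connection and curvature\<close>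

type_synonym ('m, 'e) metric = "'m \<Rightarrow> ('m, 'e) tvec \<Rightarrow> ('m, 'e) tvec \<Rightarrow> real"

definition metric_comp ::
  "('m, 'e::euclidean_space) chart set \<Rightarrow> ('m, 'e) metric \<Rightarrow> ('m, 'e) chart \<Rightarrow>
   'e \<Rightarrow> 'e \<Rightarrow> 'e \<Rightarrow> real" where
  "metric_comp A g c x u v =
     g (chart_inv c x) (coord_vec A c u (chart_inv c x)) (coord_vec A c v (chart_inv c x))"

definition riemannian_manifold ::
  "'m topology \<Rightarrow> ('m, 'e::euclidean_space) chart set \<Rightarrow> ('m, 'e) metric \<Rightarrow> bool" where
  "riemannian_manifold M A g \<longleftrightarrow> smooth_manifold M A \<and>
     (\<forall>p\<in>topspace M.
        (\<forall>X\<in>tangent_space A p. \<forall>Y\<in>tangent_space A p. g p X Y = g p Y X) \<and>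
        (\<forall>X\<in>tangent_space A p. \<forall>Y\<in>tangent_space A p. \<forall>Z\<in>tangent_space A p. \<forall>a b.
           g p (lincomb a X b Y) Z = a * g p X Z + b * g p Y Z) \<and>
        (\<forall>X\<in>tangent_space A p. X \<noteq> (\<lambda>c. 0) \<longrightarrow> g p X X > 0)) \<and>
     (\<forall>c\<in>A. \<forall>u v. smooth_on (snd c ` fst c) (\<lambda>x. metric_comp A g c x u v))"

text \<open>
  In a chart \<open>c\<close> the Levi-Civita connection has the form \<open>D Y(X) + \<Gamma>(X, Y)\<close>. At the point with
  coordinates \<open>x\<close>, the coefficients \<open>\<Gamma>\<close> are the unique bilinear map that is symmetric (the connection
  is torsion-free) and satisfies the product rule for \<open>g(v, w)\<close> with \<open>v\<close> and \<open>w\<close> of constant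
  components (the connection is metric).
\<close>

definition christoffel ::
  "('m, 'e::euclidean_space) chart set \<Rightarrow> ('m, 'e) metric \<Rightarrow> ('m, 'e) chart \<Rightarrow>
   'e \<Rightarrow> 'e \<Rightarrow> 'e \<Rightarrow> 'e" where
  "christoffel A g c x = (THE \<Gamma>. bilinear \<Gamma> \<and> (\<forall>u v. \<Gamma> u v = \<Gamma> v u) \<and>
     (\<forall>u v w. frechet_derivative (\<lambda>y. metric_comp A g c y v w) (at x) u =
        metric_comp A g c x (\<Gamma> u v) w + metric_comp A g c x v (\<Gamma> u w)))"

definition nabla ::
  "('m, 'e::euclidean_space) chart set \<Rightarrow> ('m, 'e) metric \<Rightarrow>
   ('m, 'e) vfield \<Rightarrow> ('m, 'e) vfield \<Rightarrow> ('m, 'e) vfield" where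
  "nabla A g X Y = (\<lambda>p c. if c \<in> charts_at A p
     then dcomp c Y p (X p c) + christoffel A g c (snd c p) (X p c) (Y p c) else 0)"

definition curvature ::
  "('m, 'e::euclidean_space) chart set \<Rightarrow> ('m, 'e) metric \<Rightarrow>
   ('m, 'e) vfield \<Rightarrow> ('m, 'e) vfield \<Rightarrow> ('m, 'e) vfield \<Rightarrow> ('m, 'e) vfield" where
  "curvature A g X Y Z = (\<lambda>p c.
     nabla A g X (nabla A g Y Z) p c - nabla A g Y (nabla A g X Z) p c
       - nabla A g (lie_bracket A X Y) Z p c)"

text \<open>
  The curvature on tangent vectors at \<open>p\<close>. As the curvature is tensorial, its values can be computed
  from any vector fields extending the given vectors; its component vector in a chart \<open>c\<close> is computed
  here from the extensions with constant components in \<open>c\<close>.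
\<close>

definition curvature_at ::
  "('m, 'e::euclidean_space) chart set \<Rightarrow> ('m, 'e) metric \<Rightarrow> 'm \<Rightarrow>
   ('m, 'e) tvec \<Rightarrow> ('m, 'e) tvec \<Rightarrow> ('m, 'e) tvec \<Rightarrow> ('m, 'e) tvec" where
  "curvature_at A g p X Y Z = (\<lambda>c. if c \<in> charts_at A p
     then curvature A g (coord_vec A c (X c)) (coord_vec A c (Y c)) (coord_vec A c (Z c)) p c
     else 0)"

definition plane_basis ::
  "('m, 'e::euclidean_space) chart set \<Rightarrow> 'm \<Rightarrow> ('m, 'e) tvec set \<Rightarrow>
   ('m, 'e) tvec \<Rightarrow> ('m, 'e) tvec \<Rightarrow> bool" where
  "plane_basis A p E X Y \<longleftrightarrow> X \<in> tangent_space A p \<and> Y \<in> tangent_space A p \<and>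
     (\<forall>a b. lincomb a X b Y = (\<lambda>c. 0) \<longrightarrow> a = 0 \<and> b = 0) \<and>
     E = {lincomb a X b Y | a b. True}"

definition two_plane ::
  "('m, 'e::euclidean_space) chart set \<Rightarrow> 'm \<Rightarrow> ('m, 'e) tvec set \<Rightarrow> bool" where
  "two_plane A p E \<longleftrightarrow> (\<exists>X Y. plane_basis A p E X Y)"

text \<open>The quotient below does not depend on the basis \<open>X, Y\<close> of the plane \<open>E\<close>.\<close>

definition sectional_curvature ::
  "('m, 'e::euclidean_space) chart set \<Rightarrow> ('m, 'e) metric \<Rightarrow> 'm \<Rightarrow> ('m, 'e) tvec set \<Rightarrow> real" where
  "sectional_curvature A g p E = (THE k. \<forall>X Y. plane_basis A p E X Y \<longrightarrow>
     k = g p (curvature_at A g p X Y Y) X / (g p X X * g p Y Y - (g p X Y)\<^sup>2))"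

definition constant_sectional_curvature ::
  "'m topology \<Rightarrow> ('m, 'e::euclidean_space) chart set \<Rightarrow> ('m, 'e) metric \<Rightarrow> bool" where
  "constant_sectional_curvature M A g \<longleftrightarrow>
     (\<exists>\<kappa>. \<forall>p\<in>topspace M. \<forall>E. two_plane A p E \<longrightarrow> sectional_curvature A g p E = \<kappa>)"


section \<open>Hermitian and Kaehler manifolds\<close>

type_synonym ('m, 'e) endo = "'m \<Rightarrow> ('m, 'e) tvec \<Rightarrow> ('m, 'e) tvec"

definition almost_complex_structure ::
  "'m topology \<Rightarrow> ('m, 'e::euclidean_space) chart set \<Rightarrow> ('m, 'e) endo \<Rightarrow> bool" where
  "almost_complex_structure M A J \<longleftrightarrow>
     (\<forall>p\<in>topspace M.
        (\<forall>X\<in>tangent_space A p. J p X \<in> tangent_space A p) \<and>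
        (\<forall>X\<in>tangent_space A p. \<forall>Y\<in>tangent_space A p. \<forall>a b.
           J p (lincomb a X b Y) = lincomb a (J p X) b (J p Y)) \<and>
        (\<forall>X\<in>tangent_space A p. J p (J p X) = (\<lambda>c. - X c))) \<and>
     (\<forall>c\<in>A. \<forall>u. smooth_on (snd c ` fst c)
        (\<lambda>x. J (chart_inv c x) (coord_vec A c u (chart_inv c x)) c))"

definition almost_hermitian_manifold ::
  "'m topology \<Rightarrow> ('m, 'e::euclidean_space) chart set \<Rightarrow> ('m, 'e) metric \<Rightarrow> ('m, 'e) endo \<Rightarrow> bool" where
  "almost_hermitian_manifold M A g J \<longleftrightarrow>
     riemannian_manifold M A g \<and> almost_complex_structure M A J \<and>
     (\<forall>p\<in>topspace M. \<forall>X\<in>tangent_space A p. \<forall>Y\<in>tangent_space A p.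
        g p (J p X) (J p Y) = g p X Y)"

definition apply_endo :: "('m, 'e) endo \<Rightarrow> ('m, 'e) vfield \<Rightarrow> ('m, 'e) vfield" where
  "apply_endo J X = (\<lambda>p. J p (X p))"

definition nijenhuis ::
  "('m, 'e::euclidean_space) chart set \<Rightarrow> ('m, 'e) endo \<Rightarrow>
   ('m, 'e) vfield \<Rightarrow> ('m, 'e) vfield \<Rightarrow> ('m, 'e) vfield" where
  "nijenhuis A J X Y = (\<lambda>p c.
     lie_bracket A (apply_endo J X) (apply_endo J Y) p c
       - apply_endo J (lie_bracket A (apply_endo J X) Y) p c
       - apply_endo J (lie_bracket A X (apply_endo J Y)) p c
       - lie_bracket A X Y p c)"

text \<open>
  Identities that are tensorial in vector fields are required for smooth vector fields on arbitrary
  open subsets; by tensoriality this is the same as requiring them for global ones.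
\<close>

definition integrable_structure ::
  "'m topology \<Rightarrow> ('m, 'e::euclidean_space) chart set \<Rightarrow> ('m, 'e) endo \<Rightarrow> bool" where
  "integrable_structure M A J \<longleftrightarrow>
     (\<forall>W X Y. openin M W \<and> smooth_vfield_on A W X \<and> smooth_vfield_on A W Y \<longrightarrow>
        (\<forall>p\<in>W. nijenhuis A J X Y p = (\<lambda>c. 0)))"

definition hermitian_manifold ::
  "'m topology \<Rightarrow> ('m, 'e::euclidean_space) chart set \<Rightarrow> ('m, 'e) metric \<Rightarrow> ('m, 'e) endo \<Rightarrow> bool" where
  "hermitian_manifold M A g J \<longleftrightarrow>
     almost_hermitian_manifold M A g J \<and> integrable_structure M A J"

text \<open>\<open>nabla_endo A g J X Y\<close> is \<open>(\<nabla>_X J) Y\<close>.\<close>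

definition nabla_endo ::
  "('m, 'e::euclidean_space) chart set \<Rightarrow> ('m, 'e) metric \<Rightarrow> ('m, 'e) endo \<Rightarrow>
   ('m, 'e) vfield \<Rightarrow> ('m, 'e) vfield \<Rightarrow> ('m, 'e) vfield" where
  "nabla_endo A g J X Y = (\<lambda>p c.
     nabla A g X (apply_endo J Y) p c - apply_endo J (nabla A g X Y) p c)"

definition kaehler_manifold ::
  "'m topology \<Rightarrow> ('m, 'e::euclidean_space) chart set \<Rightarrow> ('m, 'e) metric \<Rightarrow> ('m, 'e) endo \<Rightarrow> bool" where
  "kaehler_manifold M A g J \<longleftrightarrow> hermitian_manifold M A g J \<and>
     (\<forall>W X Y. openin M W \<and> smooth_vfield_on A W X \<and> smooth_vfield_on A W Y \<longrightarrow>
        (\<forall>p\<in>W. nabla_endo A g J X Y p = (\<lambda>c. 0)))"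

definition antiholomorphic_plane ::
  "('m, 'e::euclidean_space) chart set \<Rightarrow> ('m, 'e) metric \<Rightarrow> ('m, 'e) endo \<Rightarrow> 'm \<Rightarrow>
   ('m, 'e) tvec set \<Rightarrow> bool" where
  "antiholomorphic_plane A g J p E \<longleftrightarrow>
     two_plane A p E \<and> (\<forall>X\<in>E. \<forall>Y\<in>E. g p X (J p Y) = 0)"

definition pointwise_constant_antiholomorphic_curvature ::
  "'m topology \<Rightarrow> ('m, 'e::euclidean_space) chart set \<Rightarrow> ('m, 'e) metric \<Rightarrow> ('m, 'e) endo \<Rightarrow> bool" where
  "pointwise_constant_antiholomorphic_curvature M A g J \<longleftrightarrow>
     (\<exists>\<nu>. \<forall>p\<in>topspace M. \<forall>E. antiholomorphic_plane A g J p E \<longrightarrow>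
        sectional_curvature A g p E = \<nu> p)"

end

theory Submission
  imports Defs
begin

text \<open>
  Write \<open>om(x, y) = g(J x, y)\<close> and let \<open>\<nu>\<close> be the antiholomorphic sectional curvature. A plane
  with basis \<open>x, y\<close> is antiholomorphic iff \<open>om(x, y) = 0\<close>, so the form
  \<open>R(x, y, y, x) - \<nu> (|x|\<^sup>2 |y|\<^sup>2 - g(x, y)\<^sup>2)\<close>, which has degree two in \<open>x\<close> and in \<open>y\<close>, vanishes
  wherever the irreducible form \<open>om(x, y)\<close> does. Hence it is \<open>om(x, y) \<sigma>(x, y)\<close> for a two-form \<open>\<sigma>\<close>,
  and polarisation gives \<open>R = \<nu> \<pi> - \<Phi>(om, \<sigma>) / 6\<close>, where \<open>\<pi>\<close> is the curvature form of the unit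
  sphere and \<open>\<Phi>\<close> a bilinear expression (\<open>curv_like_decomposition\<close>). The forms \<open>\<nu>\<close> and \<open>\<sigma>\<close> are smooth,
  being locally quotients of smooth functions.

  The second Bianchi identity then becomes an algebraic relation, at each point, between \<open>om\<close>, \<open>\<sigma>\<close> and
  the derivatives of \<open>\<nu>\<close>, \<open>om\<close> and \<open>\<sigma>\<close>. It is evaluated on complex vectors of type \<open>(1, 0)\<close> and
  \<open>(0, 1)\<close>. Integrability of \<open>J\<close> means that \<open>\<nabla>om\<close> in a direction of type \<open>(1, 0)\<close> is a form of type
  \<open>(0, 2)\<close>, so most terms vanish by type. Three groups of components remain:
  with one vector of type \<open>(0, 1)\<close> in the last slot, they say that the purely holomorphic part of
  \<open>\<nabla>\<sigma>\<close> is zero (\<open>shol_zero\<close>); with one in the differentiated slots, that the \<open>(2, 0)\<close> parts of \<open>\<nabla>om\<close>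
  and \<open>\<sigma>\<close> have product zero, so that \<open>\<nabla>J = 0\<close> or \<open>\<sigma>\<close> is \<open>J\<close>-invariant
  (\<open>nabla_om_zero_or_sg_J_invariant\<close>); with one in each group, and when \<open>\<sigma>\<close> is \<open>J\<close>-invariant near the
  point, they give in a unitary frame of eigenvectors of \<open>\<sigma>\<close> that \<open>d\<nu> = 0\<close> and that \<open>\<nabla>J = 0\<close> or all
  eigenvalues of \<open>\<sigma>\<close> agree, \<open>\<sigma> = t om\<close> (\<open>bianchi_frame\<close>). Components with three different indices are
  needed, which is where \<open>dim M > 4\<close> enters.

  On the open set \<open>U\<close> where \<open>\<nabla>J \<noteq> 0\<close> this makes \<open>\<sigma> = t om\<close> with a smooth function \<open>t\<close>; inserting
  the derivative of this equation gives \<open>t \<nabla>om = 0\<close>, so \<open>\<sigma> = 0\<close> on \<open>U\<close>. On the interior of the complement of \<open>U\<close>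
  the curvature operators commute with \<open>J\<close>, which forces \<open>\<sigma> = 3 \<nu> om\<close>. Both sets together are dense.
  Therefore \<open>d\<nu> = 0\<close> everywhere, \<open>\<nu>\<close> is a constant \<open>\<kappa>\<close>, and at each point \<open>\<sigma> = 0\<close> or
  \<open>\<sigma> = 3 \<kappa> om\<close>. If \<open>\<kappa> \<noteq> 0\<close> these are two disjoint closed conditions that cover the connected space \<open>M\<close>,
  and the first holds on \<open>U \<noteq> {}\<close>; if \<open>\<kappa> = 0\<close> they agree. So \<open>\<sigma> = 0\<close> and \<open>R = \<kappa> \<pi>\<close>.

  Up to the connectedness argument, all of this takes place in the range of one chart. The passage from the manifold to a chart needs
  that Lie brackets, covariant derivatives and curvature transform as tangent vectors
  (\<open>lie_bracket_tangent\<close>, \<open>nabla_tangent\<close>, \<open>curvature_at_tangent\<close>), because \<open>g\<close> and \<open>J\<close> are only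
  known on tangent vectors.
\<close>

section \<open>Calculus of smooth functions\<close>

abbreviation dd :: "('a::real_normed_vector \<Rightarrow> 'b::real_normed_vector) \<Rightarrow> 'a \<Rightarrow> 'a \<Rightarrow> 'b" where
  "dd f x \<equiv> frechet_derivative f (at x)"

lemma dd_works: "f differentiable at x \<Longrightarrow> (f has_derivative dd f x) (at x)"
  by (simp add: frechet_derivative_works)

lemma dd_eqI: "(f has_derivative f') (at x) \<Longrightarrow> dd f x = f'"
  using frechet_derivative_at by metis

lemma linear_dd: "f differentiable at x \<Longrightarrow> linear (dd f x)"
  by (rule linear_frechet_derivative)

lemma differentiable_cong_open:
  assumes "open S" "x \<in> S" "\<And>y. y \<in> S \<Longrightarrow> f y = h y" "f differentiable at x"
  shows "h differentiable at x"
  using assms by (meson differentiable_def has_derivative_transform_within_open)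

lemma dd_cong_open:
  assumes "open S" "x \<in> S" "\<And>y. y \<in> S \<Longrightarrow> f y = h y"
  shows "dd f x = dd h x"
proof (cases "f differentiable at x")
  case True
  show ?thesis
    by (rule frechet_derivative_transform_within_open[OF True assms(1,2)]) (use assms in auto)
next
  case False
  have nh: "\<not> h differentiable at x"
    using False assms differentiable_cong_open[of S x h f] by metis
  have "(f has_derivative D) (at x) = (h has_derivative D) (at x)" for D
    using False nh by (auto simp: differentiable_def)
  then show ?thesis unfolding frechet_derivative_def by simp
qed

lemma Ck_on_cong:
  assumes "open S" "\<And>x. x \<in> S \<Longrightarrow> f x = h x"
  shows "Ck_on k S f = Ck_on k S h"
  using assms(2)
proof (induction k arbitrary: f h)
  case 0
  then show ?case using continuous_on_cong[of S S f h] by simp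
next
  case (Suc k)
  have 1: "dd f x v = dd h x v" if "x \<in> S" for x v
    using dd_cong_open[OF assms(1) that, of f h] Suc.prems by metis
  have 2: "f differentiable at x \<longleftrightarrow> h differentiable at x" if "x \<in> S" for x
    using differentiable_cong_open[OF assms(1) that] Suc.prems by metis
  have 3: "Ck_on k S (\<lambda>x. dd f x v) = Ck_on k S (\<lambda>x. dd h x v)" for v
    by (rule Suc.IH) (use 1 in auto)
  show ?case using 2 3 by simp
qed

lemma Ck_on_subset: "Ck_on k S f \<Longrightarrow> T \<subseteq> S \<Longrightarrow> Ck_on k T f"
  by (induction k arbitrary: f) (auto intro: continuous_on_subset)

lemma Ck_on_SucD: "Ck_on (Suc k) S f \<Longrightarrow> Ck_on k S f"
proof (induction k arbitrary: f)
  case 0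
  then show ?case
    by (auto intro!: continuous_at_imp_continuous_on differentiable_imp_continuous_within)
qed auto

lemma Ck_on_const: "Ck_on k S (\<lambda>x. c)"
  by (induction k arbitrary: c) auto

lemma Ck_on_linear_compose:
  assumes "open S" "bounded_linear L" "Ck_on k S f"
  shows "Ck_on k S (\<lambda>x. L (f x))"
  using assms(3)
proof (induction k arbitrary: f)
  case 0
  then show ?case using assms by (simp add: bounded_linear.continuous_on)
next
  case (Suc k)
  have d: "((\<lambda>x. L (f x)) has_derivative (\<lambda>v. L (dd f x v))) (at x)" if "x \<in> S" for x
    using bounded_linear.has_derivative[OF assms(2) dd_works] Suc.prems that by auto
  have "Ck_on k S (\<lambda>x. dd (\<lambda>x. L (f x)) x v)" for v
    using Suc.IH[of "\<lambda>x. dd f x v"] Suc.prems Ck_on_cong[OF assms(1)] dd_eqI[OF d]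
    by (metis (mono_tags, lifting) Ck_on.simps(2))
  then show ?case using d by (auto simp: differentiable_def)
qed

lemma Ck_on_add:
  assumes "open S" "Ck_on k S f" "Ck_on k S h"
  shows "Ck_on k S (\<lambda>x. f x + h x)"
  using assms(2,3)
proof (induction k arbitrary: f h)
  case 0
  then show ?case by (auto intro: continuous_intros)
next
  case (Suc k)
  have d: "((\<lambda>x. f x + h x) has_derivative (\<lambda>v. dd f x v + dd h x v)) (at x)" if "x \<in> S" for x
    using Suc.prems that by (auto intro!: has_derivative_add dd_works)
  have "Ck_on k S (\<lambda>x. dd (\<lambda>x. f x + h x) x v)" for v
    using Suc.IH[of "\<lambda>x. dd f x v" "\<lambda>x. dd h x v"] Suc.prems Ck_on_cong[OF assms(1)] dd_eqI[OF d]
    by (metis (mono_tags, lifting) Ck_on.simps(2))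
  then show ?case using d by (auto simp: differentiable_def)
qed

lemma Ck_on_bilinear:
  assumes "open S" "bounded_bilinear B" "Ck_on k S f" "Ck_on k S h"
  shows "Ck_on k S (\<lambda>x. B (f x) (h x))"
  using assms(3,4)
proof (induction k arbitrary: f h)
  case 0
  then show ?case using assms by (simp add: bounded_bilinear.continuous_on)
next
  case (Suc k)
  have d: "((\<lambda>x. B (f x) (h x)) has_derivative (\<lambda>v. B (f x) (dd h x v) + B (dd f x v) (h x))) (at x)"
    if "x \<in> S" for x
    using Suc.prems that by (auto intro!: bounded_bilinear.FDERIV[OF assms(2)] dd_works)
  have "Ck_on k S (\<lambda>x. B (f x) (dd h x v) + B (dd f x v) (h x))" for v
    using Suc.prems Ck_on_SucD[OF Suc.prems(1)] Ck_on_SucD[OF Suc.prems(2)]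
    by (intro Ck_on_add[OF assms(1)] Suc.IH) auto
  then have "Ck_on k S (\<lambda>x. dd (\<lambda>x. B (f x) (h x)) x v)" for v
    using Ck_on_cong[OF assms(1)] dd_eqI[OF d] by (metis (mono_tags, lifting))
  then show ?case using d by (auto simp: differentiable_def)
qed

lemma Ck_on_inverse:
  fixes f :: "'a::euclidean_space \<Rightarrow> real"
  assumes "open S" "Ck_on k S f" "\<And>x. x \<in> S \<Longrightarrow> f x \<noteq> 0"
  shows "Ck_on k S (\<lambda>x. inverse (f x))"
  using assms(2)
proof (induction k)
  case 0
  then show ?case using assms(3) by (auto intro!: continuous_on_inverse)
next
  case (Suc k)
  have d: "((\<lambda>x. inverse (f x)) has_derivative (\<lambda>v. - (inverse (f x) * dd f x v * inverse (f x)))) (at x)"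
    if "x \<in> S" for x
    using Suc.prems that assms(3) by (intro Deriv.has_derivative_inverse dd_works) auto
  note mult = Ck_on_bilinear[OF assms(1) bounded_bilinear_mult]
  have "Ck_on k S (\<lambda>x. - (inverse (f x) * dd f x v * inverse (f x)))" for v
    using Suc.prems Suc.IH[OF Ck_on_SucD[OF Suc.prems]]
    by (intro Ck_on_linear_compose[OF assms(1) bounded_linear_minus[OF bounded_linear_ident]] mult) auto
  then have "Ck_on k S (\<lambda>x. dd (\<lambda>x. inverse (f x)) x v)" for v
    using Ck_on_cong[OF assms(1)] dd_eqI[OF d] by (metis (mono_tags, lifting))
  then show ?case using d by (auto simp: differentiable_def)
qed

lemma Ck_on_sum:
  assumes "open S" "\<And>i. i \<in> I \<Longrightarrow> Ck_on k S (f i)"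
  shows "Ck_on k S (\<lambda>x. \<Sum>i\<in>I. f i x)"
  using assms(2)
proof (induction I rule: infinite_finite_induct)
  case (insert i I)
  then show ?case using Ck_on_add[OF assms(1), of k "f i" "\<lambda>x. \<Sum>i\<in>I. f i x"] by auto
qed (auto simp: Ck_on_const)

lemma linear_Basis_expand:
  fixes L :: "'a::euclidean_space \<Rightarrow> 'b::real_vector"
  assumes "linear L"
  shows "L u = (\<Sum>b\<in>Basis. (u \<bullet> b) *\<^sub>R L b)"
proof -
  have "L u = L (\<Sum>b\<in>Basis. (u \<bullet> b) *\<^sub>R b)" by (simp add: euclidean_representation)
  then show ?thesis using assms by (simp add: linear_sum linear_cmul)
qed

lemma Ck_on_compose:
  fixes f :: "'b::euclidean_space \<Rightarrow> 'c::real_normed_vector" and h :: "'a::euclidean_space \<Rightarrow> 'b"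
  assumes "open S" "Ck_on k T f" "Ck_on k S h" "h ` S \<subseteq> T"
  shows "Ck_on k S (\<lambda>x. f (h x))"
  using assms(2,3)
proof (induction k arbitrary: f)
  case 0
  then show ?case using assms continuous_on_compose2[of T f S h] by auto
next
  case (Suc k)
  have d: "((\<lambda>x. f (h x)) has_derivative (\<lambda>v. dd f (h x) (dd h x v))) (at x)" if "x \<in> S" for x
  proof -
    have "(h has_derivative dd h x) (at x)" "(f has_derivative dd f (h x)) (at (h x))"
      using Suc.prems that assms(4) by (auto intro!: dd_works)
    from diff_chain_at[OF this] show ?thesis by (simp add: o_def)
  qed
  have e: "dd f (h x) (dd h x v) = (\<Sum>b\<in>Basis. (dd h x v \<bullet> b) *\<^sub>R dd f (h x) b)" if "x \<in> S" for x v
    by (rule linear_Basis_expand[OF linear_dd]) (use Suc.prems that assms(4) in auto)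
  have "Ck_on k S (\<lambda>x. \<Sum>b\<in>Basis. (dd h x v \<bullet> b) *\<^sub>R dd f (h x) b)" for v
    using Suc.prems Suc.IH[OF _ Ck_on_SucD[OF Suc.prems(2)]]
    by (intro Ck_on_sum Ck_on_bilinear[OF assms(1) bounded_bilinear_scaleR]
        Ck_on_linear_compose[OF assms(1) bounded_linear_inner_left] assms(1)) auto
  then have "Ck_on k S (\<lambda>x. dd (\<lambda>x. f (h x)) x v)" for v
    using Ck_on_cong[OF assms(1)] dd_eqI[OF d] e by (metis (mono_tags, lifting))
  then show ?case using d by (auto simp: differentiable_def)
qed

lemma smooth_on_differentiable: "smooth_on S f \<Longrightarrow> x \<in> S \<Longrightarrow> f differentiable at x"
  unfolding smooth_on_def by (metis Ck_on.simps(2))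

lemma smooth_on_dd: "smooth_on S f \<Longrightarrow> smooth_on S (\<lambda>x. dd f x v)"
  unfolding smooth_on_def by (metis Ck_on.simps(2))

lemma smooth_on_continuous: "smooth_on S f \<Longrightarrow> continuous_on S f"
  unfolding smooth_on_def by (metis Ck_on.simps(1))

lemma smooth_on_cong: "open S \<Longrightarrow> (\<And>x. x \<in> S \<Longrightarrow> f x = h x) \<Longrightarrow> smooth_on S f = smooth_on S h"
  unfolding smooth_on_def using Ck_on_cong by metis

lemma smooth_on_subset: "smooth_on S f \<Longrightarrow> T \<subseteq> S \<Longrightarrow> smooth_on T f"
  unfolding smooth_on_def using Ck_on_subset by metis

lemma smooth_on_const: "smooth_on S (\<lambda>x. c)"
  by (simp add: smooth_on_def Ck_on_const)

lemma smooth_on_add: "open S \<Longrightarrow> smooth_on S f \<Longrightarrow> smooth_on S h \<Longrightarrow> smooth_on S (\<lambda>x. f x + h x)"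
  by (simp add: smooth_on_def Ck_on_add)

lemma smooth_on_linear: "open S \<Longrightarrow> bounded_linear L \<Longrightarrow> smooth_on S f \<Longrightarrow> smooth_on S (\<lambda>x. L (f x))"
  by (simp add: smooth_on_def Ck_on_linear_compose)

lemma smooth_on_minus: "open S \<Longrightarrow> smooth_on S f \<Longrightarrow> smooth_on S (\<lambda>x. - f x)"
  by (rule smooth_on_linear[OF _ bounded_linear_minus[OF bounded_linear_ident]])

lemma smooth_on_diff: "open S \<Longrightarrow> smooth_on S f \<Longrightarrow> smooth_on S h \<Longrightarrow> smooth_on S (\<lambda>x. f x - h x)"
  using smooth_on_add[of S f "\<lambda>x. - h x"] smooth_on_minus[of S h] by simp

lemma smooth_on_mult:
  fixes f :: "'a::euclidean_space \<Rightarrow> real"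
  shows "open S \<Longrightarrow> smooth_on S f \<Longrightarrow> smooth_on S h \<Longrightarrow> smooth_on S (\<lambda>x. f x * h x)"
  by (simp add: smooth_on_def Ck_on_bilinear[OF _ bounded_bilinear_mult])

lemma smooth_on_scaleR: "open S \<Longrightarrow> smooth_on S f \<Longrightarrow> smooth_on S h \<Longrightarrow> smooth_on S (\<lambda>x. f x *\<^sub>R h x)"
  by (simp add: smooth_on_def Ck_on_bilinear[OF _ bounded_bilinear_scaleR])

lemma smooth_on_divide:
  fixes f :: "'a::euclidean_space \<Rightarrow> real"
  shows "open S \<Longrightarrow> smooth_on S f \<Longrightarrow> smooth_on S h \<Longrightarrow> (\<And>x. x \<in> S \<Longrightarrow> h x \<noteq> 0) \<Longrightarrow>
    smooth_on S (\<lambda>x. f x / h x)"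
  unfolding divide_inverse by (rule smooth_on_mult) (auto simp: smooth_on_def Ck_on_inverse)

lemma smooth_on_inner_left: "open S \<Longrightarrow> smooth_on S f \<Longrightarrow> smooth_on S (\<lambda>x. f x \<bullet> c)"
  by (rule smooth_on_linear[OF _ bounded_linear_inner_left])

lemma smooth_on_sum:
  "open S \<Longrightarrow> (\<And>i. i \<in> I \<Longrightarrow> smooth_on S (f i)) \<Longrightarrow> smooth_on S (\<lambda>x. \<Sum>i\<in>I. f i x)"
  by (simp add: smooth_on_def Ck_on_sum)

lemma smooth_on_compose:
  fixes f :: "'b::euclidean_space \<Rightarrow> 'c::real_normed_vector" and h :: "'a::euclidean_space \<Rightarrow> 'b"
  shows "open S \<Longrightarrow> smooth_on T f \<Longrightarrow> smooth_on S h \<Longrightarrow> h ` S \<subseteq> T \<Longrightarrow> smooth_on S (\<lambda>x. f (h x))"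
  unfolding smooth_on_def by (blast intro: Ck_on_compose)

lemma smooth_on_apply_linear:
  assumes "open S" "\<And>y. y \<in> S \<Longrightarrow> linear (L y)" "\<And>u. smooth_on S (\<lambda>y. L y u)" "smooth_on S X"
  shows "smooth_on S (\<lambda>y. L y (X y :: 'b::euclidean_space))"
proof -
  have "smooth_on S (\<lambda>y. \<Sum>b\<in>Basis. (X y \<bullet> b) *\<^sub>R L y b)"
    by (intro smooth_on_sum smooth_on_scaleR smooth_on_inner_left assms)
  then show ?thesis
    by (subst smooth_on_cong[OF assms(1)]) (auto simp: linear_Basis_expand[OF assms(2), symmetric])
qed

text \<open>
  Leibniz rule. A field of linear maps is differentiated through its values on constant vectors, so
  the vector field is expanded in the standard basis.
\<close>

lemma has_derivative_apply_linear:
  fixes X :: "'a::real_normed_vector \<Rightarrow> 'b::euclidean_space" and L :: "'a \<Rightarrow> 'b \<Rightarrow> 'c::real_normed_vector"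
  assumes S: "open S" "x \<in> S" and lin: "\<And>y. y \<in> S \<Longrightarrow> linear (L y)"
    and dL: "\<And>u. (\<lambda>y. L y u) differentiable at x" and dX: "X differentiable at x"
  shows "((\<lambda>y. L y (X y)) has_derivative (\<lambda>w. dd (\<lambda>y. L y (X x)) x w + L x (dd X x w))) (at x)"
proof -
  have e: "L y u = (\<Sum>b\<in>Basis. (u \<bullet> b) *\<^sub>R L y b)" if "y \<in> S" for y u
    by (rule linear_Basis_expand[OF lin[OF that]])
  have 1: "((\<lambda>y. \<Sum>b\<in>Basis. (X y \<bullet> b) *\<^sub>R L y b) has_derivative
     (\<lambda>w. \<Sum>b\<in>Basis. (X x \<bullet> b) *\<^sub>R dd (\<lambda>y. L y b) x w + (dd X x w \<bullet> b) *\<^sub>R L x b)) (at x)"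
    by (intro has_derivative_sum has_derivative_scaleR dd_works dL
        bounded_linear.has_derivative[OF bounded_linear_inner_left] dX)
  have 2: "((\<lambda>y. \<Sum>b\<in>Basis. (X x \<bullet> b) *\<^sub>R L y b) has_derivative
     (\<lambda>w. \<Sum>b\<in>Basis. (X x \<bullet> b) *\<^sub>R dd (\<lambda>y. L y b) x w)) (at x)"
    by (intro has_derivative_sum has_derivative_scaleR_right dd_works dL)
  have 3: "dd (\<lambda>y. L y (X x)) x = (\<lambda>w. \<Sum>b\<in>Basis. (X x \<bullet> b) *\<^sub>R dd (\<lambda>y. L y b) x w)"
    by (rule dd_eqI, rule has_derivative_transform_within_open[OF 2 S]) (use e in metis)
  have 4: "(\<lambda>w. \<Sum>b\<in>Basis. (X x \<bullet> b) *\<^sub>R dd (\<lambda>y. L y b) x w + (dd X x w \<bullet> b) *\<^sub>R L x b)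
     = (\<lambda>w. dd (\<lambda>y. L y (X x)) x w + L x (dd X x w))"
    unfolding 3 e[OF S(2), of "dd X x w" for w] by (simp add: sum.distrib)
  show ?thesis
    by (rule has_derivative_transform_within_open[OF 1[unfolded 4] S]) (use e in metis)
qed

lemma linear_dd_apply:
  assumes S: "open S" "x \<in> S" and lin: "\<And>y. y \<in> S \<Longrightarrow> linear (L y)"
    and dL: "\<And>u. (\<lambda>y. L y u) differentiable at x"
  shows "linear (\<lambda>u. dd (\<lambda>y. L y u) x w)"
proof (rule linearI)
  fix u v c
  have "((\<lambda>y. L y u + L y v) has_derivative (\<lambda>w. dd (\<lambda>y. L y u) x w + dd (\<lambda>y. L y v) x w)) (at x)"
    by (intro has_derivative_add dd_works dL)
  then have "((\<lambda>y. L y (u + v)) has_derivative (\<lambda>w. dd (\<lambda>y. L y u) x w + dd (\<lambda>y. L y v) x w)) (at x)"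
    by (rule has_derivative_transform_within_open[OF _ S]) (use lin in \<open>simp add: linear_add\<close>)
  then show "dd (\<lambda>y. L y (u + v)) x w = dd (\<lambda>y. L y u) x w + dd (\<lambda>y. L y v) x w"
    by (simp add: dd_eqI)
  have "((\<lambda>y. c *\<^sub>R L y u) has_derivative (\<lambda>w. c *\<^sub>R dd (\<lambda>y. L y u) x w)) (at x)"
    by (intro has_derivative_scaleR_right dd_works dL)
  then have "((\<lambda>y. L y (c *\<^sub>R u)) has_derivative (\<lambda>w. c *\<^sub>R dd (\<lambda>y. L y u) x w)) (at x)"
    by (rule has_derivative_transform_within_open[OF _ S]) (use lin in \<open>simp add: linear_cmul\<close>)
  then show "dd (\<lambda>y. L y (c *\<^sub>R u)) x w = c *\<^sub>R dd (\<lambda>y. L y u) x w"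
    by (simp add: dd_eqI)
qed

lemma has_derivative_apply_bilinear:
  fixes X :: "'a::real_normed_vector \<Rightarrow> 'b::euclidean_space" and Y :: "'a \<Rightarrow> 'd::euclidean_space"
    and B :: "'a \<Rightarrow> 'b \<Rightarrow> 'd \<Rightarrow> 'c::real_normed_vector"
  assumes S: "open S" "x \<in> S" and lin: "\<And>y. y \<in> S \<Longrightarrow> bilinear (B y)"
    and dB: "\<And>u v. (\<lambda>y. B y u v) differentiable at x"
    and dX: "X differentiable at x" and dY: "Y differentiable at x"
  shows "((\<lambda>y. B y (X y) (Y y)) has_derivative
    (\<lambda>w. dd (\<lambda>y. B y (X x) (Y x)) x w + B x (dd X x w) (Y x) + B x (X x) (dd Y x w))) (at x)"
proof -
  have l1: "linear (\<lambda>u. B y u v)" and l2: "linear (\<lambda>v. B y u v)" if "y \<in> S" for y u v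
    using lin[OF that] by (auto simp: bilinear_def)
  have 1: "((\<lambda>y. B y u (Y y)) has_derivative (\<lambda>w. dd (\<lambda>y. B y u (Y x)) x w + B x u (dd Y x w))) (at x)" for u
    using has_derivative_apply_linear[OF S, of "\<lambda>y. B y u" Y] l2 dB dY by auto
  have 2: "((\<lambda>y. B y (X y) (Y y)) has_derivative
     (\<lambda>w. dd (\<lambda>y. B y (X x) (Y y)) x w + B x (dd X x w) (Y x))) (at x)"
    using has_derivative_apply_linear[OF S, of "\<lambda>y u. B y u (Y y)" X] l1 1 dX
    by (auto simp: differentiable_def)
  have "(\<lambda>w. dd (\<lambda>y. B y (X x) (Y y)) x w + B x (dd X x w) (Y x)) =
    (\<lambda>w. dd (\<lambda>y. B y (X x) (Y x)) x w + B x (dd X x w) (Y x) + B x (X x) (dd Y x w))"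
    by (simp add: dd_eqI[OF 1] fun_eq_iff algebra_simps)
  then show ?thesis using 2 by simp
qed

lemma Ck_on_local:
  assumes "\<And>p. p \<in> S \<Longrightarrow> \<exists>N. open N \<and> p \<in> N \<and> Ck_on k N f"
  shows "Ck_on k S f"
  using assms
proof (induction k arbitrary: f)
  case 0
  show ?case
    unfolding Ck_on.simps
  proof (rule continuous_at_imp_continuous_on, rule ballI)
    fix p assume "p \<in> S"
    then obtain N where "open N" "p \<in> N" "continuous_on N f" using 0 by auto
    then show "isCont f p" by (simp add: continuous_on_eq_continuous_at)
  qed
next
  case (Suc k)
  have "f differentiable at p" if "p \<in> S" for p using Suc.prems[OF that] by auto
  moreover have "Ck_on k S (\<lambda>x. dd f x v)" for v
    by (rule Suc.IH) (use Suc.prems in fastforce)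
  ultimately show ?case by simp
qed

lemma smooth_on_local:
  assumes "\<And>p. p \<in> S \<Longrightarrow> \<exists>N. open N \<and> p \<in> N \<and> smooth_on N f"
  shows "smooth_on S f"
  unfolding smooth_on_def
proof
  fix k show "Ck_on k S f"
    by (rule Ck_on_local) (use assms in \<open>fastforce simp: smooth_on_def\<close>)
qed

lemma open_nonzero_set:
  fixes f :: "'a::euclidean_space \<Rightarrow> real"
  assumes "open S" "smooth_on S f"
  shows "open {x \<in> S. f x \<noteq> 0}"
proof -
  have "{x \<in> S. f x \<noteq> 0} = S \<inter> f -` (- {0})" by auto
  then show ?thesis
    using continuous_open_preimage[OF smooth_on_continuous[OF assms(2)] assms(1), of "- {0}"]
    by (simp add: open_Compl)
qed

section \<open>Symmetry of second derivatives\<close>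

lemma has_real_derivative_along_line:
  fixes f :: "'a::real_normed_vector \<Rightarrow> real"
  assumes "f differentiable at (x + a *\<^sub>R u)"
  shows "((\<lambda>a. f (x + a *\<^sub>R u)) has_real_derivative dd f (x + a *\<^sub>R u) u) (at a)"
proof -
  have 1: "((\<lambda>a. x + a *\<^sub>R u) has_derivative (\<lambda>h. h *\<^sub>R u)) (at a)"
    by (auto intro!: derivative_eq_intros)
  have "((f \<circ> (\<lambda>a. x + a *\<^sub>R u)) has_derivative (dd f (x + a *\<^sub>R u) \<circ> (\<lambda>h. h *\<^sub>R u))) (at a)"
    by (rule diff_chain_at[OF 1]) (use dd_works[OF assms] in simp)
  moreover have "(dd f (x + a *\<^sub>R u) \<circ> (\<lambda>h. h *\<^sub>R u)) = (*) (dd f (x + a *\<^sub>R u) u)"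
    using linear_cmul[OF linear_dd[OF assms]] by (auto simp: fun_eq_iff mult.commute)
  ultimately show ?thesis by (simp add: has_field_derivative_def o_def)
qed

text \<open>
  The mean value theorem is applied in the direction \<open>u\<close> and then in the direction \<open>v\<close>. As the second
  difference is symmetric in \<open>u\<close> and \<open>v\<close>, this is the source of the symmetry of second derivatives.
\<close>

lemma second_difference_mean_value:
  fixes f :: "'a::euclidean_space \<Rightarrow> real"
  assumes C2: "Ck_on 2 S f" and t: "t > 0"
    and inS: "\<And>a b. 0 \<le> a \<Longrightarrow> a \<le> t \<Longrightarrow> 0 \<le> b \<Longrightarrow> b \<le> t \<Longrightarrow> x + a *\<^sub>R u + b *\<^sub>R v \<in> S"
  obtains a b where "0 \<le> a" "a \<le> t" "0 \<le> b" "b \<le> t"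
    "f (x + t *\<^sub>R u + t *\<^sub>R v) - f (x + t *\<^sub>R u) - f (x + t *\<^sub>R v) + f x
       = t * t * dd (\<lambda>y. dd f y u) (x + a *\<^sub>R u + b *\<^sub>R v) v"
proof -
  have d1: "f differentiable at y" if "y \<in> S" for y using C2 that by (simp add: numeral_2_eq_2)
  have d2: "(\<lambda>y. dd f y u) differentiable at y" if "y \<in> S" for y using C2 that by (simp add: numeral_2_eq_2)
  have shift: "x + a *\<^sub>R u + b *\<^sub>R v = (x + b *\<^sub>R v) + a *\<^sub>R u" for a b by (simp add: algebra_simps)
  define \<phi> where "\<phi> a = f ((x + t *\<^sub>R v) + a *\<^sub>R u) - f (x + a *\<^sub>R u)" for a
  have "\<exists>z. 0 < z \<and> z < t \<and> \<phi> t - \<phi> 0 = (t - 0) * (dd f ((x + t *\<^sub>R v) + z *\<^sub>R u) u - dd f (x + z *\<^sub>R u) u)"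
  proof (rule MVT2[OF t])
    fix a assume a: "0 \<le> a" "a \<le> t"
    show "(\<phi> has_real_derivative (dd f ((x + t *\<^sub>R v) + a *\<^sub>R u) u - dd f (x + a *\<^sub>R u) u)) (at a)"
      unfolding \<phi>_def
      by (intro DERIV_diff has_real_derivative_along_line d1)
        (use inS[OF a, of t] inS[OF a, of 0] t shift in auto)
  qed
  then obtain a where a: "0 < a" "a < t"
    "\<phi> t - \<phi> 0 = t * (dd f ((x + t *\<^sub>R v) + a *\<^sub>R u) u - dd f (x + a *\<^sub>R u) u)" by auto
  have "\<exists>z. 0 < z \<and> z < t \<and> dd f ((x + a *\<^sub>R u) + t *\<^sub>R v) u - dd f ((x + a *\<^sub>R u) + 0 *\<^sub>R v) u
    = (t - 0) * dd (\<lambda>y. dd f y u) ((x + a *\<^sub>R u) + z *\<^sub>R v) v"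
    by (rule MVT2[OF t], rule has_real_derivative_along_line, rule d2, rule inS) (use a in auto)
  then obtain b where b: "0 < b" "b < t" "dd f ((x + a *\<^sub>R u) + t *\<^sub>R v) u - dd f (x + a *\<^sub>R u) u
    = t * dd (\<lambda>y. dd f y u) ((x + a *\<^sub>R u) + b *\<^sub>R v) v" by auto
  have "f (x + t *\<^sub>R u + t *\<^sub>R v) - f (x + t *\<^sub>R u) - f (x + t *\<^sub>R v) + f x = \<phi> t - \<phi> 0"
    unfolding \<phi>_def shift by simp
  also have "\<dots> = t * (t * dd (\<lambda>y. dd f y u) (x + a *\<^sub>R u + b *\<^sub>R v) v)"
    using a(3) b(3) unfolding shift[symmetric] by simp
  finally show ?thesis using a b that[of a b] by simp
qed

lemma dd_symmetric_real:
  fixes f :: "'a::euclidean_space \<Rightarrow> real"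
  assumes S: "open S" "x \<in> S" and C2: "Ck_on 2 S f"
  shows "dd (\<lambda>y. dd f y u) x v = dd (\<lambda>y. dd f y v) x u"
proof (rule ccontr)
  assume ne: "\<not> ?thesis"
  define P where "P p = dd (\<lambda>y. dd f y u) p v" for p
  define Q where "Q p = dd (\<lambda>y. dd f y v) p u" for p
  have cont: "isCont P x" "isCont Q x"
    using C2 S by (auto simp: numeral_2_eq_2 P_def[abs_def] Q_def[abs_def] continuous_on_eq_continuous_at)
  define e where "e = \<bar>P x - Q x\<bar> / 2"
  have e: "e > 0" using ne by (simp add: e_def P_def Q_def)
  obtain d1 where d1: "d1 > 0" "\<And>p. dist p x < d1 \<Longrightarrow> dist (P p) (P x) < e"
    using cont(1) e unfolding continuous_at_eps_delta by blast
  obtain d2 where d2: "d2 > 0" "\<And>p. dist p x < d2 \<Longrightarrow> dist (Q p) (Q x) < e"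
    using cont(2) e unfolding continuous_at_eps_delta by blast
  obtain d3 where d3: "d3 > 0" "ball x d3 \<subseteq> S" using S open_contains_ball by blast
  define d where "d = min d1 (min d2 d3)"
  define t where "t = d / (1 + norm u + norm v)"
  have d: "d > 0" using d1 d2 d3 by (simp add: d_def)
  have t: "t > 0" using d by (auto simp: t_def intro!: divide_pos_pos add_pos_nonneg)
  have near: "dist (x + a *\<^sub>R u + b *\<^sub>R v) x < d" if "0 \<le> a" "a \<le> t" "0 \<le> b" "b \<le> t" for a b
  proof -
    have "dist (x + a *\<^sub>R u + b *\<^sub>R v) x \<le> a * norm u + b * norm v"
      using norm_triangle_ineq[of "a *\<^sub>R u" "b *\<^sub>R v"] that by (simp add: dist_norm algebra_simps)
    also have "\<dots> \<le> t * norm u + t * norm v" using that by (intro add_mono mult_right_mono) auto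
    also have "\<dots> < t * (1 + norm u + norm v)" using t by (simp add: algebra_simps)
    also have "\<dots> = d"
    proof -
      have "1 + norm u + norm v \<noteq> 0" using norm_ge_zero[of u] norm_ge_zero[of v] by linarith
      then show ?thesis by (simp add: t_def)
    qed
    finally show ?thesis .
  qed
  have inS: "x + a *\<^sub>R u + b *\<^sub>R v \<in> S" if "0 \<le> a" "a \<le> t" "0 \<le> b" "b \<le> t" for a b
    using near[OF that] d3 by (auto simp: d_def dist_commute)
  obtain a b where ab: "0 \<le> a" "a \<le> t" "0 \<le> b" "b \<le> t"
    "f (x + t *\<^sub>R u + t *\<^sub>R v) - f (x + t *\<^sub>R u) - f (x + t *\<^sub>R v) + f x = t * t * P (x + a *\<^sub>R u + b *\<^sub>R v)"
    using second_difference_mean_value[OF C2 t, of x u v] inS unfolding P_def by blast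
  have swap: "x + a *\<^sub>R v + b *\<^sub>R u = x + b *\<^sub>R u + a *\<^sub>R v" for a b by (simp add: algebra_simps)
  have inS': "x + a *\<^sub>R v + b *\<^sub>R u \<in> S" if "0 \<le> a" "a \<le> t" "0 \<le> b" "b \<le> t" for a b
    unfolding swap[of a b] by (rule inS) (use that in auto)
  obtain a' b' where ab': "0 \<le> a'" "a' \<le> t" "0 \<le> b'" "b' \<le> t"
    "f (x + t *\<^sub>R v + t *\<^sub>R u) - f (x + t *\<^sub>R v) - f (x + t *\<^sub>R u) + f x = t * t * Q (x + a' *\<^sub>R v + b' *\<^sub>R u)"
    using second_difference_mean_value[OF C2 t, of x v u] inS' unfolding Q_def by blast
  have eq: "P (x + a *\<^sub>R u + b *\<^sub>R v) = Q (x + b' *\<^sub>R u + a' *\<^sub>R v)"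
  proof -
    have "t * t * P (x + a *\<^sub>R u + b *\<^sub>R v) = t * t * Q (x + b' *\<^sub>R u + a' *\<^sub>R v)"
      unfolding swap[of a' b', symmetric] ab(5)[symmetric] ab'(5)[symmetric]
      by (simp add: swap[of t t])
    then show ?thesis using t by simp
  qed
  have "dist (P (x + a *\<^sub>R u + b *\<^sub>R v)) (P x) < e"
    using near[OF ab(1-4)] by (intro d1(2)) (simp add: d_def)
  moreover have "dist (Q (x + b' *\<^sub>R u + a' *\<^sub>R v)) (Q x) < e"
    using near[OF ab'(3,4) ab'(1,2)] by (intro d2(2)) (simp add: d_def)
  moreover have "dist (P x) (Q x) \<le> dist (P (x + a *\<^sub>R u + b *\<^sub>R v)) (P x) + dist (P (x + a *\<^sub>R u + b *\<^sub>R v)) (Q x)"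
    by (rule dist_triangle3)
  ultimately have "dist (P x) (Q x) < 2 * e" unfolding eq by simp
  then show False by (simp add: e_def dist_real_def)
qed

lemma dd_symmetric:
  fixes f :: "'a::euclidean_space \<Rightarrow> 'b::euclidean_space"
  assumes S: "open S" "x \<in> S" and f: "smooth_on S f"
  shows "dd (\<lambda>y. dd f y u) x v = dd (\<lambda>y. dd f y v) x u"
proof (rule euclidean_eqI)
  fix b :: 'b
  have inner: "dd (\<lambda>y. h y \<bullet> b) y w = dd h y w \<bullet> b" if "h differentiable at y" for h :: "'a \<Rightarrow> 'b" and y w
    using dd_eqI[OF bounded_linear.has_derivative[OF bounded_linear_inner_left dd_works[OF that]]] by simp
  have 1: "dd (\<lambda>y. dd f y u) x v \<bullet> b = dd (\<lambda>y. dd (\<lambda>y. f y \<bullet> b) y u) x v" for u v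
  proof -
    have "dd (\<lambda>y. dd f y u) x v \<bullet> b = dd (\<lambda>y. dd f y u \<bullet> b) x v"
      using inner smooth_on_differentiable[OF smooth_on_dd[OF f] S(2)] by metis
    also have "dd (\<lambda>y. dd f y u \<bullet> b) x = dd (\<lambda>y. dd (\<lambda>y. f y \<bullet> b) y u) x"
      by (rule dd_cong_open[OF S]) (use inner smooth_on_differentiable[OF f] in metis)
    finally show ?thesis .
  qed
  have "Ck_on 2 S (\<lambda>y. f y \<bullet> b)"
    using smooth_on_inner_left[OF S(1) f] by (simp add: smooth_on_def)
  from dd_symmetric_real[OF S this, of u v]
  show "dd (\<lambda>y. dd f y u) x v \<bullet> b = dd (\<lambda>y. dd f y v) x u \<bullet> b" unfolding 1 .
qed

section \<open>Curvature-like forms on a Hermitian vector space\<close>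

lemma positive_definite_coercive:
  fixes g :: "'e::euclidean_space \<Rightarrow> 'e \<Rightarrow> real"
  assumes g: "bilinear g" and pos: "\<And>x. x \<noteq> 0 \<Longrightarrow> g x x > 0"
  obtains c where "c > 0" "\<And>x. c * (norm x)\<^sup>2 \<le> g x x"
proof -
  have cont: "continuous_on (sphere 0 1) (\<lambda>x. g x x)"
    using bilinear_continuous_on_compose[OF continuous_on_id continuous_on_id g] by simp
  have ne: "sphere (0::'e) 1 \<noteq> {}" by simp
  obtain m where m: "m \<in> sphere 0 1" "\<And>y. y \<in> sphere 0 1 \<Longrightarrow> g m m \<le> g y y"
    using continuous_attains_inf[OF compact_sphere ne cont] by blast
  have "g m m > 0" using m(1) by (intro pos) auto
  moreover have "g m m * (norm x)\<^sup>2 \<le> g x x" for x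
  proof (cases "x = 0")
    case False
    have "g m m \<le> g ((1 / norm x) *\<^sub>R x) ((1 / norm x) *\<^sub>R x)" by (rule m(2)) (use False in auto)
    then have "g m m \<le> g x x / (norm x)\<^sup>2"
      by (simp add: bilinear_lmul[OF g] bilinear_rmul[OF g] power2_eq_square)
    then show ?thesis using False by (simp add: field_simps)
  qed (simp add: bilinear_lzero[OF g])
  ultimately show ?thesis by (rule that)
qed

definition curv_like :: "('e::real_vector \<Rightarrow> 'e \<Rightarrow> 'e \<Rightarrow> 'e \<Rightarrow> real) \<Rightarrow> bool" where
  "curv_like T \<longleftrightarrow> (\<forall>x y z. linear (T x y z)) \<and> (\<forall>x y z u. T x y z u = - T y x z u) \<and>
     (\<forall>x y z u. T x y z u = - T x y u z) \<and> (\<forall>x y z u. T x y z u + T y z x u + T z x y u = 0)"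

lemma curv_like_skew:
  assumes "curv_like T"
  shows "T x y z u = - T y x z u" "T x y z u = - T x y u z"
  using assms unfolding curv_like_def by blast+

lemma curv_like_cyclic: "curv_like T \<Longrightarrow> T x y z u + T y z x u + T z x y u = 0"
  unfolding curv_like_def by blast

lemma curv_like_pair: "curv_like T \<Longrightarrow> T x y z u = T z u x y"
  unfolding curv_like_def by (smt (verit))

lemma curv_like_linear:
  assumes "curv_like T"
  shows "linear (\<lambda>u. T x y z u)" "linear (\<lambda>z. T x y z u)" "linear (\<lambda>y. T x y z u)" "linear (\<lambda>x. T x y z u)"
proof -
  have l: "linear (T x y z)" for x y z using assms unfolding curv_like_def by blast
  show "linear (\<lambda>u. T x y z u)" by (rule l)
  have "(\<lambda>z. T x y z u) = (\<lambda>z. - T x y u z)" using curv_like_skew(2)[OF assms] by blast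
  then show "linear (\<lambda>z. T x y z u)" using linear_compose_neg[OF l[of x y u]] by simp
  have "(\<lambda>y. T x y z u) = (\<lambda>y. T z u x y)" using curv_like_pair[OF assms] by auto
  then show "linear (\<lambda>y. T x y z u)" using l[of z u x] by simp
  have "T x y z u = - T z u y x" for x
    using curv_like_pair[OF assms, of x y z u] curv_like_skew(2)[OF assms, of z u x y] by simp
  then have "(\<lambda>x. T x y z u) = (\<lambda>x. - T z u y x)" by blast
  then show "linear (\<lambda>x. T x y z u)" using linear_compose_neg[OF l[of z u y]] by simp
qed

lemmas curv_like_simps =
  linear_add[OF curv_like_linear(1)] linear_add[OF curv_like_linear(2)]
  linear_add[OF curv_like_linear(3)] linear_add[OF curv_like_linear(4)]
  linear_cmul[OF curv_like_linear(1)] linear_cmul[OF curv_like_linear(2)]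
  linear_cmul[OF curv_like_linear(3)] linear_cmul[OF curv_like_linear(4)]
  linear_diff[OF curv_like_linear(1)] linear_diff[OF curv_like_linear(2)]
  linear_diff[OF curv_like_linear(3)] linear_diff[OF curv_like_linear(4)]

lemma curv_like_combine:
  "curv_like T \<Longrightarrow> curv_like S \<Longrightarrow> curv_like (\<lambda>x y z u. T x y z u + c * S x y z u)"
proof -
  assume T: "curv_like T" and S: "curv_like S"
  have b: "T x y z u + c * S x y z u + (T y z x u + c * S y z x u) + (T z x y u + c * S z x y u) = 0"
    for x y z u
  proof -
    have "T x y z u + T y z x u + T z x y u = 0" "S x y z u + S y z x u + S z x y u = 0"
      by (rule curv_like_cyclic[OF T] curv_like_cyclic[OF S])+
    then have "(T x y z u + T y z x u + T z x y u) + c * (S x y z u + S y z x u + S z x y u) = 0"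
      by simp
    then show ?thesis by (simp add: algebra_simps)
  qed
  have l: "linear (\<lambda>u. T x y z u + c * S x y z u)" for x y z
    using curv_like_linear(1)[OF T] curv_like_linear(1)[OF S] by (simp add: linear_iff algebra_simps)
  have s1: "T x y z u = - T y x z u" "S x y z u = - S y x z u"
    and s2: "T x y z u = - T x y u z" "S x y z u = - S x y u z" for x y z u
    by (rule curv_like_skew[OF T] curv_like_skew[OF S])+
  show ?thesis
    unfolding curv_like_def
  proof (intro conjI allI)
    fix x y z u
    show "linear (\<lambda>u. T x y z u + c * S x y z u)" by (rule l)
    show "T x y z u + c * S x y z u = - (T y x z u + c * S y x z u)"
      using s1[of x y z u] by simp
    show "T x y z u + c * S x y z u = - (T x y u z + c * S x y u z)"
      using s2[of x y z u] by simp
    show "T x y z u + c * S x y z u + (T y z x u + c * S y z x u) + (T z x y u + c * S z x y u) = 0"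
      by (rule b)
  qed
qed

text \<open>
  Polarisation: replacing \<open>x\<close> and \<open>y\<close> by sums makes \<open>T x y z u\<close> skew in \<open>x\<close> and \<open>u\<close>; with the other
  symmetries it becomes invariant under cyclic permutations of \<open>x, y, z\<close>, so the first Bianchi identity
  says that three times its value is zero.
\<close>

lemma curv_like_eq_0:
  assumes "curv_like T" "\<And>x y. T x y y x = 0"
  shows "T x y z u = 0"
proof -
  note lin = curv_like_simps[OF assms(1)]
  have 1: "T x y z x = 0" for x y z
  proof -
    have "T x (y + z) (y + z) x = 0" by (rule assms(2))
    then have "T x y z x + T x z y x = 0" using assms(2)[of x y] assms(2)[of x z] by (simp add: lin)
    moreover have "T x z y x = T x y z x"
      using curv_like_pair[OF assms(1), of x z y x] curv_like_skew[OF assms(1), of y x x z]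
        curv_like_skew(2)[OF assms(1), of x y x z] by simp
    ultimately show ?thesis by simp
  qed
  have 2: "T x y z u = - T u y z x" for x y z u
  proof -
    have "T (x + u) y z (x + u) = 0" by (rule 1)
    then show ?thesis using 1[of x y z] 1[of u y z] by (simp add: lin)
  qed
  have "T x y z u + T y z x u + T z x y u = 0" using assms(1) unfolding curv_like_def by blast
  moreover have cyc: "T z x y u = T x y z u" for x y z u
    using 2[of x y z u] curv_like_skew(1)[OF assms(1), of u y z x] curv_like_pair[OF assms(1), of y u z x]
    by linarith
  moreover have "T y z x u = T x y z u"
    by (rule cyc[of x y z u, symmetric])
  ultimately show ?thesis by simp
qed

text \<open>The curvature form of a space of constant sectional curvature \<open>1\<close>.\<close>

definition Pi4 :: "('v \<Rightarrow> 'v \<Rightarrow> 'k::comm_ring_1) \<Rightarrow> 'v \<Rightarrow> 'v \<Rightarrow> 'v \<Rightarrow> 'v \<Rightarrow> 'k" where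
  "Pi4 g x y z u = g y z * g x u - g x z * g y u"

text \<open>
  A multiple of the projection of the symmetric product of two two-forms to the curvature-like forms; its sectional
  value is \<open>- 6 f(x, y) h(x, y)\<close>. The curvature form of complex
  projective space is \<open>Pi4 g - Phi4 om om / 2\<close>.
\<close>

definition Phi4 ::
  "('v \<Rightarrow> 'v \<Rightarrow> 'k::comm_ring_1) \<Rightarrow> ('v \<Rightarrow> 'v \<Rightarrow> 'k) \<Rightarrow> 'v \<Rightarrow> 'v \<Rightarrow> 'v \<Rightarrow> 'v \<Rightarrow> 'k" where
  "Phi4 f h x y z u = 2 * f x y * h z u + 2 * h x y * f z u + f x z * h y u + h x z * f y u
     - f x u * h y z - h x u * f y z"

lemma bilinear_simps:
  assumes "bilinear f"
  shows "f (x + y) z = f x z + f y z" "f x (y + z) = f x y + f x z"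
    "f (c *\<^sub>R x) z = c *\<^sub>R f x z" "f x (c *\<^sub>R z) = c *\<^sub>R f x z"
    "f (x - y) z = f x z - f y z" "f x (y - z) = f x y - f x z"
    "f (- x) z = - f x z" "f x (- z) = - f x z" "f 0 z = 0" "f x 0 = 0"
  using assms by (auto simp: bilinear_ladd bilinear_radd bilinear_lmul bilinear_rmul
      bilinear_lsub bilinear_rsub bilinear_lneg bilinear_rneg bilinear_lzero bilinear_rzero)

lemma curv_like_Pi4:
  assumes "bilinear g" "\<And>x y. g x y = g y x"
  shows "curv_like (Pi4 g)"
  unfolding curv_like_def Pi4_def
  by (auto simp: linear_iff bilinear_simps[OF assms(1)] algebra_simps assms(2))

lemma curv_like_Phi4:
  assumes "bilinear f" "bilinear h" and s: "\<And>x y. f x y = - f y x" "\<And>x y. h x y = - h y x"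
  shows "curv_like (Phi4 f h)"
  unfolding curv_like_def Phi4_def
proof (intro conjI allI)
  fix x y z u
  show "linear (\<lambda>u. 2 * f x y * h z u + 2 * h x y * f z u + f x z * h y u + h x z * f y u
     - f x u * h y z - h x u * f y z)"
    by (auto simp: linear_iff bilinear_simps[OF assms(1)] bilinear_simps[OF assms(2)] algebra_simps)
  note sk = s(1)[of y x] s(1)[of z x] s(1)[of u x] s(1)[of z y] s(1)[of u y] s(1)[of u z]
    s(2)[of y x] s(2)[of z x] s(2)[of u x] s(2)[of z y] s(2)[of u y] s(2)[of u z]
  show "2 * f x y * h z u + 2 * h x y * f z u + f x z * h y u + h x z * f y u - f x u * h y z - h x u * f y z
    = - (2 * f y x * h z u + 2 * h y x * f z u + f y z * h x u + h y z * f x u - f y u * h x z - h y u * f x z)"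
    unfolding sk by (simp add: algebra_simps)
  show "2 * f x y * h z u + 2 * h x y * f z u + f x z * h y u + h x z * f y u - f x u * h y z - h x u * f y z
    = - (2 * f x y * h u z + 2 * h x y * f u z + f x u * h y z + h x u * f y z - f x z * h y u - h x z * f y u)"
    unfolding sk by (simp add: algebra_simps)
  show "2 * f x y * h z u + 2 * h x y * f z u + f x z * h y u + h x z * f y u - f x u * h y z - h x u * f y z
    + (2 * f y z * h x u + 2 * h y z * f x u + f y x * h z u + h y x * f z u - f y u * h z x - h y u * f z x)
    + (2 * f z x * h y u + 2 * h z x * f y u + f z y * h x u + h z y * f x u - f z u * h x y - h z u * f x y) = 0"
    unfolding sk by (simp add: algebra_simps)
qed

locale hermitian_form =
  fixes g :: "'e::euclidean_space \<Rightarrow> 'e \<Rightarrow> real" and J :: "'e \<Rightarrow> 'e"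
  assumes bil_g: "bilinear g" and sym_g: "g x y = g y x" and pos_g: "x \<noteq> 0 \<Longrightarrow> g x x > 0"
    and lin_J: "linear J" and JJ: "J (J x) = - x" and g_JJ: "g (J x) (J y) = g x y"
begin

definition om :: "'e \<Rightarrow> 'e \<Rightarrow> real" where "om x y = g (J x) y"

lemma J_simps: "J (x + y) = J x + J y" "J (c *\<^sub>R x) = c *\<^sub>R J x" "J (x - y) = J x - J y" "J (- x) = - J x" "J 0 = 0"
  using lin_J by (auto simp: linear_add linear_cmul linear_diff linear_neg linear_0)

lemmas g_simps = bilinear_simps[OF bil_g]

lemma g_J_right: "g x (J y) = - g (J x) y"
  using g_JJ[of x "J y"] by (simp add: JJ g_simps)

lemma om_skew: "om x y = - om y x"
  unfolding om_def using g_J_right[of y x] sym_g by simp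

lemma om_self [simp]: "om x x = 0"
  using om_skew[of x x] by simp

lemma bil_om: "bilinear om"
  unfolding bilinear_def om_def by (auto simp: linear_iff J_simps g_simps)

lemmas om_simps = bilinear_simps[OF bil_om]

lemma om_JJ: "om (J x) (J y) = om x y"
  unfolding om_def by (simp add: g_JJ)

lemma g_self_eq_0: "g x x = 0 \<longleftrightarrow> x = 0"
  using pos_g[of x] by (cases "x = 0") (auto simp: g_simps)

lemma om_J_self: "om x (J x) = g x x"
  unfolding om_def by (simp add: g_JJ)

text \<open>
  The sectional value of \<open>T\<close> is a form of bidegree \<open>(2, 2)\<close> that vanishes on the zero set of the
  irreducible form \<open>om\<close>, hence it is divisible by \<open>om\<close>. The quotient is found by dividing in the
  second variable, with the help of a vector \<open>d x\<close> such that \<open>om x (d x) = 1\<close>.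
\<close>

lemma divisible_by_om:
  assumes T: "curv_like T" and van: "\<And>x y. om x y = 0 \<Longrightarrow> T x y y x = 0"
  obtains \<sigma> where "bilinear \<sigma>" "\<And>x y. \<sigma> x y = - \<sigma> y x" "\<And>x y. T x y y x = om x y * \<sigma> x y"
proof -
  note lin = curv_like_simps[OF T]
  define d where "d x = (1 / g x x) *\<^sub>R J x" for x
  have od: "om x (d x) = 1" if "x \<noteq> 0" for x
    using that by (simp add: d_def om_simps om_J_self g_self_eq_0)
  define \<sigma> where "\<sigma> x y = 2 * T x (d x) y x - om x y * T x (d x) (d x) x" for x y
  have psym: "T x y z x = T x z y x" for x y z
    using curv_like_pair[OF T, of x z y x] curv_like_skew[OF T, of y x x z]
      curv_like_skew(2)[OF T, of x y x z] by simp
  have z: "\<sigma> 0 y = 0" "\<sigma> y 0 = 0" for y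
    by (simp_all add: \<sigma>_def d_def J_simps om_simps linear_0[OF curv_like_linear(2)[OF T]]
        linear_0[OF curv_like_linear(3)[OF T]] linear_0[OF curv_like_linear(4)[OF T]])
  have fac: "T x y y x = om x y * \<sigma> x y" for x y
  proof (cases "x = 0")
    case True
    then show ?thesis using curv_like_linear[OF T] by (simp add: linear_0 om_simps)
  next
    case False
    have "om x (y - om x y *\<^sub>R d x) = 0" by (simp add: om_simps od[OF False])
    from van[OF this] have "T x y y x = om x y * (T x y (d x) x + T x (d x) y x - om x y * T x (d x) (d x) x)"
      by (simp add: lin algebra_simps)
    then show ?thesis unfolding \<sigma>_def using psym[of x y "d x"] by simp
  qed
  have linr: "linear (\<sigma> x)" for x
    unfolding \<sigma>_def by (auto simp: linear_iff lin om_simps algebra_simps)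
  have Qsym: "T x y y x = T y x x y" for x y
    using curv_like_pair[OF T] by metis
  have skew: "\<sigma> x y = - \<sigma> y x" for x y
  proof (cases "om x y = 0")
    case False
    have "om x y * \<sigma> x y = om y x * \<sigma> y x" using fac Qsym by metis
    then have "om x y * (\<sigma> x y + \<sigma> y x) = 0" using om_skew[of y x] by (simp add: algebra_simps)
    then show ?thesis using False by simp
  next
    case om0: True
    show ?thesis
    proof (cases "x = 0 \<or> y = 0")
      case True
      then show ?thesis using z by auto
    next
      case False
      then have nz: "x \<noteq> 0" "y \<noteq> 0" by auto
      have oyx: "om y x = 0" using om0 om_skew[of y x] by simp
      have odd: "om (d y) (d x) = 0" by (simp add: d_def om_simps om_JJ oyx)
      have ody: "om (d y) y = - 1" using od[OF nz(2)] om_skew[of "d y" y] by simp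
      \<comment> \<open>both vectors move so that \<open>om\<close> stays zero; the coefficient of \<open>s\<close> below must vanish\<close>
      have f: "T (x + s *\<^sub>R d y) (y + s *\<^sub>R d x) (y + s *\<^sub>R d x) (x + s *\<^sub>R d y) = 0" for s
        by (rule van) (simp add: om_simps om0 odd ody od[OF nz(1)])
      define c1 where "c1 = T (d y) y y x + T x (d x) y x + T x y (d x) x + T x y y (d y)"
      define c2 where "c2 = T (d y) (d x) y x + T (d y) y (d x) x + T (d y) y y (d y) + T x (d x) (d x) x
        + T x (d x) y (d y) + T x y (d x) (d y)"
      define c3 where "c3 = T (d y) (d x) (d x) x + T (d y) (d x) y (d y) + T (d y) y (d x) (d y) + T x (d x) (d x) (d y)"
      define c4 where "c4 = T (d y) (d x) (d x) (d y)"
      have poly: "T x y y x + s * c1 + s^2 * c2 + s^3 * c3 + s^4 * c4 = 0" for s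
        using f[of s] unfolding c1_def c2_def c3_def c4_def
        by (simp add: lin algebra_simps power2_eq_square power3_eq_cube power4_eq_xxxx)
      have "c1 = 0"
        using poly[of 1] poly[of "-1"] poly[of 2] poly[of "-2"] by simp
      moreover have "T x y y (d y) = T y (d y) x y" by (rule curv_like_pair[OF T])
      moreover have "T (d y) y y x = T y (d y) x y"
        using curv_like_skew(1)[OF T, of "d y" y y x] curv_like_skew(2)[OF T, of y "d y" y x] by simp
      moreover have "T x y (d x) x = T x (d x) y x" by (rule psym)
      ultimately have "T x (d x) y x + T y (d y) x y = 0" unfolding c1_def by simp
      then show ?thesis unfolding \<sigma>_def by (simp add: om0 oyx)
    qed
  qed
  have linl: "linear (\<lambda>x. \<sigma> x y)" for y
  proof -
    have "(\<lambda>x. \<sigma> x y) = (\<lambda>x. - \<sigma> y x)" by (rule ext) (rule skew)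
    then show ?thesis using linear_compose_neg[OF linr[of y]] by simp
  qed
  have "bilinear \<sigma>" using linl linr by (simp add: bilinear_def)
  then show ?thesis using skew fac by (rule that)
qed

lemma curv_like_decomposition:
  assumes R: "curv_like R" and K: "\<And>x y. om x y = 0 \<Longrightarrow> R x y y x = \<nu> * Pi4 g x y y x"
  obtains \<sigma> where "bilinear \<sigma>" "\<And>x y. \<sigma> x y = - \<sigma> y x"
    "\<And>x y z u. R x y z u = \<nu> * Pi4 g x y z u - Phi4 om \<sigma> x y z u / 6"
proof -
  have PiC: "curv_like (Pi4 g)" by (rule curv_like_Pi4[OF bil_g sym_g])
  define T where "T x y z u = R x y z u + (-\<nu>) * Pi4 g x y z u" for x y z u
  have T: "curv_like T" unfolding T_def by (rule curv_like_combine[OF R PiC])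
  have van: "T x y y x = 0" if "om x y = 0" for x y
    unfolding T_def using K[OF that] by simp
  obtain \<sigma> where s: "bilinear \<sigma>" "\<And>x y. \<sigma> x y = - \<sigma> y x" "\<And>x y. T x y y x = om x y * \<sigma> x y"
    using divisible_by_om[OF T van] by metis
  have F: "curv_like (Phi4 om \<sigma>)" by (rule curv_like_Phi4[OF bil_om s(1) om_skew s(2)])
  have eq: "T x y z u + (1/6) * Phi4 om \<sigma> x y z u = 0" for x y z u
  proof (rule curv_like_eq_0[OF curv_like_combine[OF T F]])
    fix x y
    have "\<sigma> x x = 0" "\<sigma> y y = 0" using s(2)[of x x] s(2)[of y y] by auto
    then show "T x y y x + 1 / 6 * Phi4 om \<sigma> x y y x = 0"
      unfolding s(3) Phi4_def using s(2)[of y x] om_skew[of y x] by (simp add: algebra_simps)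
  qed
  then have "R x y z u = \<nu> * Pi4 g x y z u - Phi4 om \<sigma> x y z u / 6" for x y z u
    using eq[of x y z u] unfolding T_def by linarith
  then show ?thesis using that s by blast
qed

end

section \<open>Complexification of the second Bianchi identity\<close>

text \<open>
  If \<open>n\<close>, \<open>\<alpha>\<close> and \<open>s\<close> are the derivatives of \<open>\<nu>\<close>, \<open>om\<close> and \<open>\<sigma>\<close>, then this is \<open>- 6\<close> times the cyclic
  sum over \<open>w, x, y\<close> of the derivative of \<open>\<nu> Pi4 g - Phi4 om \<sigma> / 6\<close>. It is defined over any commutative ring so that
  it can be used for real and for complex forms.
\<close>

definition bianchi where
  "bianchi n g om \<alpha> \<sigma> s w x y z u =
     - 6 * (n w * Pi4 g x y z u + n x * Pi4 g y w z u + n y * Pi4 g w x z u)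
     + (Phi4 (\<alpha> w) \<sigma> x y z u + Phi4 (\<alpha> x) \<sigma> y w z u + Phi4 (\<alpha> y) \<sigma> w x z u)
     + (Phi4 om (s w) x y z u + Phi4 om (s x) y w z u + Phi4 om (s y) w x z (u :: 'v)) "
  for n :: "'v \<Rightarrow> 'k::comm_ring_1"

text \<open>
  Complex multilinear extensions of real forms. A vector of the complexification is a pair of a real
  and an imaginary part.
\<close>

definition cext1 :: "('e \<Rightarrow> real) \<Rightarrow> 'e \<times> 'e \<Rightarrow> complex" where
  "cext1 n U = of_real (n (fst U)) + \<i> * of_real (n (snd U))"

definition cext2 :: "('e \<Rightarrow> 'e \<Rightarrow> real) \<Rightarrow> 'e \<times> 'e \<Rightarrow> 'e \<times> 'e \<Rightarrow> complex" where
  "cext2 f U V = cext1 (f (fst U)) V + \<i> * cext1 (f (snd U)) V"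

definition cext3 :: "('e \<Rightarrow> 'e \<Rightarrow> 'e \<Rightarrow> real) \<Rightarrow> 'e \<times> 'e \<Rightarrow> 'e \<times> 'e \<Rightarrow> 'e \<times> 'e \<Rightarrow> complex" where
  "cext3 f U V W = cext2 (f (fst U)) V W + \<i> * cext2 (f (snd U)) V W"

text \<open>
  The one consequence of complex linearity that matters here: values on real vectors determine all values.
\<close>

definition clin :: "('e::real_vector \<times> 'e \<Rightarrow> complex) \<Rightarrow> bool" where
  "clin Q \<longleftrightarrow> (\<forall>a b. Q (a, b) = Q (a, 0) + \<i> * Q (b, 0))"

lemma clinD: "clin Q \<Longrightarrow> Q (a, b) = Q (a, 0) + \<i> * Q (b, 0)"
  unfolding clin_def by blast

lemma clinI: "(\<And>a b. Q (a, b) = Q (a, 0) + \<i> * Q (b, 0)) \<Longrightarrow> clin Q"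
  unfolding clin_def by blast

lemma clin_zero: "clin Q \<Longrightarrow> (\<And>a. Q (a, 0) = 0) \<Longrightarrow> Q U = 0"
  using clinD[of Q "fst U" "snd U"] by simp

lemma clin_add: "clin P \<Longrightarrow> clin Q \<Longrightarrow> clin (\<lambda>U. P U + Q U)"
  by (rule clinI, drule_tac a=a and b=b in clinD, drule_tac a=a and b=b in clinD)
    (simp add: algebra_simps)

lemma clin_left: "clin P \<Longrightarrow> clin (\<lambda>U. P U * c)"
  by (rule clinI, drule_tac a=a and b=b in clinD) (simp add: algebra_simps)

lemma clin_right: "clin P \<Longrightarrow> clin (\<lambda>U. c * P U)"
  by (rule clinI, drule_tac a=a and b=b in clinD) (simp add: algebra_simps)

lemma clin_diff: "clin P \<Longrightarrow> clin Q \<Longrightarrow> clin (\<lambda>U. P U - Q U)"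
  by (rule clinI, drule_tac a=a and b=b in clinD, drule_tac a=a and b=b in clinD)
    (simp add: algebra_simps)

lemma clin_cext1: "linear n \<Longrightarrow> clin (cext1 n)"
  by (simp add: clin_def cext1_def linear_0)

lemma clin_cext2:
  assumes "bilinear f"
  shows "clin (\<lambda>U. cext2 f U V)" "clin (\<lambda>V. cext2 f U V)"
  by (simp_all add: clin_def cext1_def cext2_def bilinear_simps[OF assms] algebra_simps)

lemma clin_cext3:
  assumes b: "\<And>w. bilinear (f w)" and l: "\<And>x y. linear (\<lambda>w. f w x y)"
  shows "clin (\<lambda>U. cext3 f U V W)" "clin (\<lambda>V. cext3 f U V W)" "clin (\<lambda>W. cext3 f U V W)"
  using linear_0[OF l]
  by (simp_all add: clin_def cext1_def cext2_def cext3_def bilinear_simps[OF b] algebra_simps)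

text \<open>
  Every monomial of the identity contains each of the five vectors exactly once, so the identity can
  be extended to complex vectors one slot at a time.
\<close>

lemma bianchi_complexify:
  assumes n: "linear n" and g: "bilinear g" and om: "bilinear om" and \<sigma>: "bilinear \<sigma>"
    and \<alpha>: "\<And>w. bilinear (\<alpha> w)" "\<And>x y. linear (\<lambda>w. \<alpha> w x y)"
    and s: "\<And>w. bilinear (s w)" "\<And>x y. linear (\<lambda>w. s w x y)"
    and B: "\<And>w x y z u. bianchi n g om \<alpha> \<sigma> s w x y z u = 0"
  shows "bianchi (cext1 n) (cext2 g) (cext2 om) (cext3 \<alpha>) (cext2 \<sigma>) (cext3 s) W X Y Z U = 0"
    (is "?b W X Y Z U = 0")
proof -
  note cl = clin_cext1[OF n] clin_cext2[OF g] clin_cext2[OF om] clin_cext2[OF \<sigma>]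
    clin_cext3[of \<alpha>, OF \<alpha>] clin_cext3[of s, OF s]
  note cl' = clin_add clin_diff clin_left clin_right cl
  have e: "cext1 n (a, 0) = of_real (n a)" "cext2 g (a, 0) (b, 0) = of_real (g a b)"
    "cext2 om (a, 0) (b, 0) = of_real (om a b)" "cext2 \<sigma> (a, 0) (b, 0) = of_real (\<sigma> a b)"
    "cext3 \<alpha> (a, 0) (b, 0) (c, 0) = of_real (\<alpha> a b c)" "cext3 s (a, 0) (b, 0) (c, 0) = of_real (s a b c)"
    for a b c
    using linear_0[OF \<alpha>(2)] linear_0[OF s(2)]
    by (simp_all add: cext1_def cext2_def cext3_def linear_0[OF n] bilinear_simps[OF g]
        bilinear_simps[OF om] bilinear_simps[OF \<sigma>] bilinear_simps[OF \<alpha>(1)] bilinear_simps[OF s(1)])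
  have 0: "?b (a, 0) (b, 0) (c, 0) (d, 0) (f, 0) = of_real (bianchi n g om \<alpha> \<sigma> s a b c d f)" for a b c d f
    unfolding bianchi_def Pi4_def Phi4_def e by simp
  note unf = bianchi_def Pi4_def Phi4_def
  have 1: "?b (a, 0) (b, 0) (c, 0) (d, 0) V = 0" for a b c d V
    by (rule clin_zero[of "?b (a, 0) (b, 0) (c, 0) (d, 0)"])
      (unfold 0 B, unfold unf, intro cl', simp)
  have 2: "?b (a, 0) (b, 0) (c, 0) V U = 0" for a b c V
    by (rule clin_zero[of "\<lambda>V. ?b (a, 0) (b, 0) (c, 0) V U"])
      (unfold 1, unfold unf, intro cl', simp)
  have 3: "?b (a, 0) (b, 0) V Z U = 0" for a b V
    by (rule clin_zero[of "\<lambda>V. ?b (a, 0) (b, 0) V Z U"]) (unfold 2, unfold unf, intro cl', simp)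
  have 4: "?b (a, 0) V Y Z U = 0" for a V
    by (rule clin_zero[of "\<lambda>V. ?b (a, 0) V Y Z U"]) (unfold 3, unfold unf, intro cl', simp)
  show ?thesis
    by (rule clin_zero[of "\<lambda>V. ?b V X Y Z U"]) (unfold 4, unfold unf, intro cl', simp)
qed

section \<open>The Bianchi identity at a point of a Hermitian manifold\<close>

text \<open>
  Twice the projections of a real vector onto the eigenspaces of \<open>J\<close> for \<open>\<i>\<close> and \<open>-\<i>\<close>.
\<close>

definition (in hermitian_form) hol :: "'e \<Rightarrow> 'e \<times> 'e" where "hol x = (x, - J x)"

definition (in hermitian_form) ahol :: "'e \<Rightarrow> 'e \<times> 'e" where "ahol x = (x, J x)"

text \<open>
  The data at one point: \<open>A\<close>, \<open>s\<close> and \<open>n\<close> are the covariant derivatives of \<open>J\<close>, of \<open>\<sigma>\<close> and of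
  \<open>\<nu>\<close>. Integrability of \<open>J\<close> is the condition on \<open>A (J w)\<close>.
\<close>

locale bianchi_point = hermitian_form +
  fixes \<sigma> :: "'a \<Rightarrow> 'a \<Rightarrow> real" and A :: "'a \<Rightarrow> 'a \<Rightarrow> 'a" and s :: "'a \<Rightarrow> 'a \<Rightarrow> 'a \<Rightarrow> real"
    and n :: "'a \<Rightarrow> real"
  assumes bil_sg: "bilinear \<sigma>" and sg_skew: "\<sigma> x y = - \<sigma> y x"
    and bil_A: "bilinear A" and A_skew: "g (A w x) y = - g x (A w y)"
    and A_J: "A w (J x) = - J (A w x)" and A_J_left: "A (J w) x = J (A w x)"
    and bil_s: "bilinear (s w)" and lin_s: "linear (\<lambda>w. s w x y)" and s_skew: "s w x y = - s w y x"
    and lin_n: "linear n"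
    and bianchi_real: "bianchi n g om (\<lambda>w x y. g (A w x) y) \<sigma> s w x y z u = 0"
    and dim: "DIM('a) \<ge> 6"
begin

definition nabla_om :: "'a \<Rightarrow> 'a \<Rightarrow> 'a \<Rightarrow> real" where "nabla_om w x y = g (A w x) y"

lemmas A_simps = bilinear_simps[OF bil_A]
lemmas sg_simps = bilinear_simps[OF bil_sg]
lemmas s_simps = bilinear_simps[OF bil_s]

lemma bil_nabla_om: "bilinear (nabla_om w)"
  unfolding bilinear_def nabla_om_def by (auto simp: linear_iff A_simps g_simps)

lemma lin_nabla_om: "linear (\<lambda>w. nabla_om w x y)"
  unfolding nabla_om_def by (auto simp: linear_iff A_simps g_simps)

lemmas nabla_om_simps = bilinear_simps[OF bil_nabla_om]

lemma nabla_om_skew: "nabla_om w x y = - nabla_om w y x"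
  unfolding nabla_om_def using A_skew[of w x y] sym_g by simp

lemma nabla_om_J: "nabla_om w x (J y) = nabla_om w (J x) y" "nabla_om (J w) x y = - nabla_om w (J x) y"
  unfolding nabla_om_def by (simp_all add: A_J A_J_left g_J_right g_simps)

lemma bianchi_cx:
  "bianchi (cext1 n) (cext2 g) (cext2 om) (cext3 nabla_om) (cext2 \<sigma>) (cext3 s) W X Y Z U = 0"
  by (rule bianchi_complexify[OF lin_n bil_g bil_om bil_sg bil_nabla_om lin_nabla_om bil_s lin_s])
    (use bianchi_real in \<open>simp add: nabla_om_def[abs_def]\<close>)

lemmas cext_defs = cext1_def cext2_def cext3_def hol_def ahol_def

lemma cext2_skew:
  assumes "\<And>x y. f x y = - f y x"
  shows "cext2 f U V = - cext2 f V U"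
  unfolding cext2_def cext1_def
    assms[of "fst U" "fst V"] assms[of "fst U" "snd V"] assms[of "snd U" "fst V"] assms[of "snd U" "snd V"]
  by (simp add: algebra_simps)

definition G :: "'a \<Rightarrow> 'a \<Rightarrow> complex" where "G x y = cext2 g (hol x) (ahol y)"

lemma g_types: "cext2 g (hol x) (hol y) = 0" "cext2 g (ahol x) (ahol y) = 0"
    "cext2 g (ahol y) (hol x) = G x y" "cext2 g (hol x) (ahol y) = G x y"
    "G x y = 2 * of_real (g x y) + 2 * \<i> * of_real (g x (J y))"
  using sym_g[of x y] g_J_right[of x y] sym_g[of "J x" y]
  by (simp_all add: G_def cext_defs g_simps g_JJ g_J_right algebra_simps complex_eq_iff J_simps JJ)

lemma om_types: "cext2 om (hol x) (hol y) = 0" "cext2 om (ahol x) (ahol y) = 0"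
    "cext2 om (hol x) (ahol y) = \<i> * G x y" "cext2 om (ahol y) (hol x) = - \<i> * G x y"
  using sym_g[of x y] g_J_right[of x y] sym_g[of "J x" y]
  by (simp_all add: g_types cext_defs om_def JJ g_simps g_JJ g_J_right algebra_simps complex_eq_iff J_simps JJ)

text \<open>
  By integrability the derivative of \<open>om\<close> in a direction of type \<open>(1, 0)\<close> has type \<open>(0, 2)\<close>.
\<close>

lemma nabla_om_types:
  "cext3 nabla_om (hol w) (hol x) V = 0" "cext3 nabla_om (hol w) V (hol x) = 0"
  "cext3 nabla_om (ahol w) (ahol x) V = 0" "cext3 nabla_om (ahol w) V (ahol x) = 0"
  "cext3 nabla_om (ahol w) (hol x) (hol y) = 4 * (of_real (nabla_om w x y) - \<i> * of_real (nabla_om w (J x) y))"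
  using linear_neg[OF lin_nabla_om]
  by (simp_all add: cext_defs nabla_om_J nabla_om_simps JJ algebra_simps complex_eq_iff J_simps JJ)

end

text \<open>
  Unitary frames are normalised by \<open>g a a = 1/2\<close> because then \<open>hol a\<close> and \<open>ahol a\<close> pair to \<open>1\<close>.
\<close>

definition (in hermitian_form) frame :: "'e set \<Rightarrow> bool" where
  "frame F \<longleftrightarrow> finite F \<and> (\<forall>a\<in>F. g a a = 1/2) \<and>
     (\<forall>a\<in>F. \<forall>b\<in>F. a \<noteq> b \<longrightarrow> g a b = 0 \<and> g a (J b) = 0) \<and> span (F \<union> J ` F) = UNIV"

lemma (in hermitian_form) frame_zero:
  fixes f :: "'e \<Rightarrow> 'c::real_vector"
  assumes "frame F" "linear f" "\<And>a. a \<in> F \<Longrightarrow> f a = 0" "\<And>a. a \<in> F \<Longrightarrow> f (J a) = 0"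
  shows "f x = 0"
  using linear_eq_0_on_span[OF assms(2), of "F \<union> J ` F" x] assms by (auto simp: frame_def)

context bianchi_point
begin

lemma frame_G: "frame F \<Longrightarrow> a \<in> F \<Longrightarrow> b \<in> F \<Longrightarrow> G a b = (if a = b then 1 else 0)"
  using g_J_right[of b b] sym_g[of b "J b"] by (auto simp: frame_def g_types complex_eq_iff)

lemma frame_third:
  assumes "frame F" "a \<in> F" "b \<in> F"
  obtains c where "c \<in> F" "c \<noteq> a" "c \<noteq> b"
proof -
  have fin: "finite F" using assms by (simp add: frame_def)
  have "DIM('a) = dim (span (F \<union> J ` F))" using assms by (simp add: frame_def)
  also have "\<dots> \<le> card (F \<union> J ` F)" using fin by (simp add: dim_le_card')
  also have "\<dots> \<le> card F + card F"
    using card_Un_le[of F "J ` F"] card_image_le[OF fin, of J] by linarith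
  finally have "\<not> F \<subseteq> {a, b}" using dim card_mono[of "{a, b}" F] card_insert_le_m1[of 2 "{b}" a]
    by (auto simp: card_insert_if split: if_splits)
  then show ?thesis using that by blast
qed

definition shol :: "'a \<Rightarrow> 'a \<Rightarrow> 'a \<Rightarrow> complex" where
  "shol w x y = cext3 s (hol w) (hol x) (hol y)"

lemma shol_skew: "shol w x y = - shol w y x"
  unfolding shol_def cext3_def
  using cext2_skew[of "s (fst (hol w))", OF s_skew, of "hol x" "hol y"]
    cext2_skew[of "s (snd (hol w))", OF s_skew, of "hol x" "hol y"] by simp

lemma s_lin_simps: "s (x + y) u v = s x u v + s y u v" "s (c *\<^sub>R x) u v = c * s x u v" "s (- x) u v = - s x u v" "s 0 u v = 0"
  using lin_s linear_add[OF lin_s] linear_cmul[OF lin_s] linear_neg[OF lin_s] linear_0[OF lin_s] by auto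

lemma shol_linear: "linear (\<lambda>w. shol w x y)" "linear (\<lambda>x. shol w x y)" "linear (\<lambda>y. shol w x y)"
  unfolding shol_def
  by (auto simp: linear_iff cext_defs s_simps s_lin_simps J_simps algebra_simps complex_eq_iff)

lemma shol_J: "shol (J w) x y = \<i> * shol w x y" "shol w (J x) y = \<i> * shol w x y" "shol w x (J y) = \<i> * shol w x y"
  unfolding shol_def
  by (auto simp: cext_defs s_simps s_lin_simps JJ algebra_simps complex_eq_iff)

lemma shol_bianchi:
  "2 * (shol w x y + shol x y w + shol y w x) * G z u + (shol w x z - shol x w z) * G y u
     + (shol y w z - shol w y z) * G x u + (shol x y z - shol y x z) * G w u = 0"
  using bianchi_cx[of "hol w" "hol x" "hol y" "hol z" "ahol u"]
  unfolding bianchi_def Pi4_def Phi4_def g_types om_types nabla_om_types shol_def[symmetric]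
  by (simp add: complex_eq_iff algebra_simps)

text \<open>
  The Bianchi identity on four holomorphic vectors and an antiholomorphic one involves \<open>s\<close> only through
  its purely holomorphic part. Evaluated on a frame, it first kills the components with a repeated index
  and then relates the three cyclic permutations of a component with distinct indices.
\<close>

lemma shol_zero:
  assumes F: "frame F"
  shows "shol w x y = 0"
proof -
  note G = frame_G[OF F]
  have 1: "shol c a c = 0" if abc: "a \<in> F" "c \<in> F" "a \<noteq> c" for a c
  proof -
    obtain b where b: "b \<in> F" "b \<noteq> a" "b \<noteq> c" using frame_third[OF F abc(1,2)] .
    have "shol a c c = 0" using shol_skew[of a c c] by simp
    then show ?thesis
      using shol_bianchi[of a b c c b] b abc by (simp add: G)
  qed
  have 2: "2 * (shol a b c + shol b c a + shol c a b) + shol a b c + shol b c a = 0"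
    if "a \<in> F" "b \<in> F" "c \<in> F" "a \<noteq> b" "a \<noteq> c" "b \<noteq> c" for a b c
    using shol_bianchi[of a b c c c] that shol_skew[of b a c] by (simp add: G algebra_simps)
  have 3: "shol a b c = 0"
    if "a \<in> F" "b \<in> F" "c \<in> F" "a \<noteq> b" "a \<noteq> c" "b \<noteq> c" for a b c
  proof -
    have "2 * (shol a b c + shol b c a + shol c a b) + shol a b c + shol b c a = 0"
      "2 * (shol b c a + shol c a b + shol a b c) + shol b c a + shol c a b = 0"
      "2 * (shol c a b + shol a b c + shol b c a) + shol c a b + shol a b c = 0"
      using 2[of a b c] 2[of b c a] 2[of c a b] that by auto
    then show ?thesis by algebra
  qed
  have 4: "shol a b c = 0" if "a \<in> F" "b \<in> F" "c \<in> F" for a b c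
    using 1[of a b] 1[of b a] 1[of c a] 1[of a c] 1[of b c] 1[of c b] 3[of a b c] that shol_skew[of a b c]
    by (cases "a = b"; cases "a = c"; cases "b = c") auto
  have 5: "shol a b y = 0" if "a \<in> F" "b \<in> F" for a b y
    by (rule frame_zero[OF F shol_linear(3)]) (auto simp: 4 that shol_J)
  have 6: "shol a x y = 0" if "a \<in> F" for a x y
    by (rule frame_zero[OF F shol_linear(2)]) (auto simp: 5 that shol_J)
  show ?thesis
    by (rule frame_zero[OF F shol_linear(1)]) (auto simp: 6 shol_J)
qed

end

text \<open>A vector space is not the union of two proper subspaces; this is used once in each variable.\<close>

lemma bilinear_prod_zero:
  fixes f h :: "'e::real_vector \<Rightarrow> 'e \<Rightarrow> complex"
  assumes f: "bilinear f" and h: "bilinear h" and fh: "\<And>x y. f x y * h x y = 0"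
  shows "(\<forall>x y. f x y = 0) \<or> (\<forall>x y. h x y = 0)"
proof -
  have lin: "(\<forall>y. p y = 0) \<or> (\<forall>y. q y = 0)"
    if "linear p" "linear q" "\<And>y. p y = 0 \<or> q y = 0" for p q :: "'e \<Rightarrow> complex"
  proof (rule ccontr)
    assume "\<not> ?thesis"
    then obtain y z where "p y \<noteq> 0" "q z \<noteq> 0" by auto
    then show False
      using that(3)[of y] that(3)[of z] that(3)[of "y + z"] that(1,2) by (auto simp: linear_add)
  qed
  have x: "(\<forall>y. f x y = 0) \<or> (\<forall>y. h x y = 0)" for x
    using lin[of "f x" "h x"] f h fh by (auto simp: bilinear_def)
  show ?thesis
  proof (rule ccontr)
    assume "\<not> ?thesis"
    then obtain x x' y y' where "f x y \<noteq> 0" "h x' y' \<noteq> 0" by auto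
    then have "f x' y = 0" "h x y' = 0" using x by metis+
    then have "f (x + x') y \<noteq> 0" "h (x + x') y' \<noteq> 0"
      using \<open>f x y \<noteq> 0\<close> \<open>h x' y' \<noteq> 0\<close> by (auto simp: bilinear_ladd[OF f] bilinear_ladd[OF h])
    then show False using x by metis
  qed
qed

context bianchi_point
begin

text \<open>
  With an antiholomorphic vector in the differentiated slot and four holomorphic ones, everything vanishes by
  type except the product of the \<open>(2, 0)\<close> part of the derivative of \<open>om\<close> with that of \<open>\<sigma>\<close>.
\<close>

lemma nabla_om_zero_or_sg_J_invariant:
  assumes F: "frame F"
  shows "(\<forall>w x y. nabla_om w x y = 0) \<or> (\<forall>x y. \<sigma> (J x) (J y) = \<sigma> x y)"
proof (rule disjCI)
  assume "\<not> (\<forall>x y. \<sigma> (J x) (J y) = \<sigma> x y)"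
  then obtain x0 y0 where ne: "\<sigma> (J x0) (J y0) \<noteq> \<sigma> x0 y0" by auto
  define ss where "ss x y = cext2 \<sigma> (hol x) (hol y)" for x y
  have ss: "ss x y = of_real (\<sigma> x y - \<sigma> (J x) (J y)) - \<i> * of_real (\<sigma> x (J y) + \<sigma> (J x) y)" for x y
    by (simp add: ss_def cext_defs sg_simps algebra_simps complex_eq_iff)
  have "bilinear ss"
    unfolding bilinear_def ss by (auto simp: linear_iff sg_simps J_simps algebra_simps complex_eq_iff)
  show "\<forall>w x y. nabla_om w x y = 0"
  proof (intro allI)
    fix w x y
    define aa where "aa x y = cext3 nabla_om (ahol w) (hol x) (hol y)" for x y
    have aa: "aa x y = 4 * (of_real (nabla_om w x y) - \<i> * of_real (nabla_om w (J x) y))" for x y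
      unfolding aa_def nabla_om_types ..
    have "bilinear aa"
      unfolding bilinear_def aa by (auto simp: linear_iff nabla_om_simps J_simps algebra_simps complex_eq_iff)
    have sk: "ss b a = - ss a b" "aa b a = - aa a b" for a b
      unfolding ss aa using nabla_om_skew[of w b a] nabla_om_skew[of w "J b" a] nabla_om_J(1)[of w a b]
        sg_skew[of b a] sg_skew[of "J b" "J a"] sg_skew[of "J b" a] sg_skew[of b "J a"]
      by (simp_all add: algebra_simps)
    have self: "ss a a = 0" "aa a a = 0" for a using sk[of a a] by auto
    have "aa a b * ss a b = 0" for a b
    proof -
      have "cext3 s (hol x) (hol y) (hol z) = 0" for x y z
        using shol_zero[OF F] by (simp add: shol_def)
      then have "6 * (aa a b * ss a b) = 0"
        using bianchi_cx[of "ahol w" "hol a" "hol b" "hol b" "hol a"]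
        unfolding bianchi_def Pi4_def Phi4_def g_types om_types nabla_om_types(1,2) ss_def[symmetric] aa_def[symmetric]
        by (simp add: self sk[of b a])
      then show ?thesis by simp
    qed
    from bilinear_prod_zero[OF \<open>bilinear aa\<close> \<open>bilinear ss\<close> this]
    have "(\<forall>x y. aa x y = 0) \<or> (\<forall>x y. ss x y = 0)" .
    moreover have "ss x0 y0 \<noteq> 0" unfolding ss using ne by (auto simp: complex_eq_iff)
    ultimately have "aa x y = 0" by blast
    then show "nabla_om w x y = 0" unfolding aa by (simp add: complex_eq_iff)
  qed
qed

end

text \<open>
  A point near which \<open>\<sigma>\<close> is \<open>J\<close>-invariant, with a unitary frame of eigenvectors of \<open>\<sigma>\<close>. The last
  assumption is the derivative of the \<open>J\<close>-invariance.
\<close>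

locale bianchi_frame = bianchi_point +
  fixes F :: "'a set" and \<tau> :: "'a \<Rightarrow> real"
  assumes frame: "frame F" and sg_diag: "a \<in> F \<Longrightarrow> \<sigma> a v = \<tau> a * om a v"
    and sg_JJ: "\<sigma> (J x) (J y) = \<sigma> x y"
    and s_JJ: "s w (J x) (J y) + \<sigma> (A w x) (J y) + \<sigma> (J x) (A w y) = s w x y"
begin

text \<open>
  \<open>X\<close>, \<open>r\<close> and \<open>N\<close> are the components that survive in the Bianchi identity: of \<open>\<nabla>om\<close>, of \<open>\<nabla>\<sigma>\<close> and of \<open>d\<nu>\<close>.
  The factors \<open>\<i>\<close> make all coefficients real.
\<close>

definition X :: "'a \<Rightarrow> 'a \<Rightarrow> 'a \<Rightarrow> complex" where "X w x y = \<i> * cext3 nabla_om (ahol w) (hol x) (hol y)"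
definition r :: "'a \<Rightarrow> 'a \<Rightarrow> 'a \<Rightarrow> complex" where "r w x y = - \<i> * cext3 s (hol w) (hol x) (ahol y)"
definition h :: "'a \<Rightarrow> 'a \<Rightarrow> complex" where "h x y = (of_real (\<tau> x) + of_real (\<tau> y)) / 2"
definition N :: "'a \<Rightarrow> complex" where "N x = cext1 n (hol x)"

lemma nabla_om_X: "cext3 nabla_om (ahol w) (hol x) (hol y) = - \<i> * X w x y"
  by (simp add: X_def)

lemma X_skew: "X w y x = - X w x y"
  unfolding X_def nabla_om_types using nabla_om_skew[of w y x] nabla_om_skew[of w "J y" x] nabla_om_J(1)[of w x y] by (simp add: algebra_simps)

lemma sg_J_diag:
  assumes "a \<in> F"
  shows "\<sigma> (J a) v = \<tau> a * om (J a) v"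
proof -
  have "\<sigma> (J a) v = - \<sigma> a (J v)" using sg_JJ[of "J a" v] by (simp add: JJ sg_simps)
  moreover have "om (J a) v = - om a (J v)" using om_JJ[of "J a" v] by (simp add: JJ om_simps)
  ultimately show ?thesis by (simp add: sg_diag[OF assms])
qed

lemma sg_types: "cext2 \<sigma> (hol x) (hol y) = 0" "cext2 \<sigma> (ahol x) (ahol y) = 0"
  "a \<in> F \<Longrightarrow> cext2 \<sigma> (hol a) (ahol y) = \<i> * of_real (\<tau> a) * G a y"
  "a \<in> F \<Longrightarrow> cext2 \<sigma> (ahol y) (hol a) = - \<i> * of_real (\<tau> a) * G a y"
proof -
  have 1: "\<sigma> x (J y) = - \<sigma> (J x) y" for x y using sg_JJ[of x "J y"] by (simp add: JJ sg_simps)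
  show "cext2 \<sigma> (hol x) (hol y) = 0" "cext2 \<sigma> (ahol x) (ahol y) = 0"
    by (simp_all add: cext_defs sg_simps sg_JJ 1 JJ J_simps complex_eq_iff)
  show a: "cext2 \<sigma> (hol a) (ahol y) = \<i> * of_real (\<tau> a) * G a y" if "a \<in> F"
  proof -
    have "cext2 \<sigma> (hol a) (ahol y) = of_real (\<tau> a) * cext2 om (hol a) (ahol y)"
      by (simp add: cext_defs sg_simps om_simps sg_diag[OF that] sg_J_diag[OF that] algebra_simps)
    then show ?thesis by (simp add: om_types)
  qed
  show "cext2 \<sigma> (ahol y) (hol a) = - \<i> * of_real (\<tau> a) * G a y" if "a \<in> F"
    using a[OF that] cext2_skew[of \<sigma>, OF sg_skew, of "ahol y" "hol a"] by simp
qed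

text \<open>
  Differentiating the \<open>J\<close>-invariance of \<open>\<sigma>\<close> expresses this part of the derivative of \<open>\<sigma>\<close> by that of \<open>om\<close>.
\<close>

lemma s_ahol:
  assumes a: "a \<in> F" and b: "b \<in> F"
  shows "cext3 s (ahol w) (hol a) (hol b) = - \<i> * h a b * X w a b"
proof -
  have e: "\<sigma> (A w x) (J b) = - (\<tau> b * g (J (J b)) (A w x))" for x w
    using sg_skew[of "A w x" "J b"] sg_J_diag[OF b] by (simp add: om_def)
  have s1: "s w a b - s w (J a) (J b) = (\<tau> a + \<tau> b) * nabla_om w a b" for w
    using s_JJ[of w a b] e[of w a] sg_J_diag[OF a, of "A w b"] sym_g[of b "A w a"] sym_g[of a "A w b"] nabla_om_skew[of w a b]
    by (simp add: om_def JJ g_simps nabla_om_def algebra_simps)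
  have e2: "\<sigma> a (A w b) = \<tau> a * g (J a) (A w b)" for w using sg_diag[OF a] by (simp add: om_def)
  have s2: "s w (J a) b + s w a (J b) = (\<tau> a + \<tau> b) * nabla_om w (J a) b" for w
    using s_JJ[of w "J a" b] e[of w "J a"] e2[of w] sym_g[of b "A w (J a)"] sym_g[of "J a" "A w b"] nabla_om_skew[of w "J a" b]
    by (simp add: JJ g_simps nabla_om_def s_simps sg_simps algebra_simps)
  have "cext3 s (ahol w) (hol a) (hol b) =
     of_real (s w a b - s w (J a) (J b)) - \<i> * of_real (s w (J a) b + s w a (J b))
     + \<i> * (of_real (s (J w) a b - s (J w) (J a) (J b)) - \<i> * of_real (s (J w) (J a) b + s (J w) a (J b)))"
    by (simp add: cext_defs s_simps algebra_simps)
  also have "\<dots> = of_real (\<tau> a + \<tau> b) * (2 * (of_real (nabla_om w a b) - \<i> * of_real (nabla_om w (J a) b)))"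
    unfolding s1 s2 by (simp add: nabla_om_J nabla_om_simps JJ algebra_simps)
  also have "\<dots> = - \<i> * h a b * X w a b"
    unfolding X_def nabla_om_types h_def by (simp add: field_simps)
  finally show ?thesis .
qed

lemma s_cx_skew: "cext3 s U V W = - cext3 s U W V"
  unfolding cext3_def cext2_skew[of "s (fst U)" V W, OF s_skew] cext2_skew[of "s (snd U)" V W, OF s_skew]
  by simp

lemma s_types: "cext3 s (hol w) (hol x) (ahol y) = \<i> * r w x y"
  "cext3 s (hol w) (ahol y) (hol x) = - \<i> * r w x y" "cext3 s (hol w) (hol x) (hol y) = 0"
  using shol_zero[OF frame] s_cx_skew[of "hol w" "ahol y" "hol x"] by (simp_all add: r_def shol_def)

text \<open>
  The Bianchi identity with one antiholomorphic vector among the three differentiated slots and one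
  among the last two.
\<close>

lemma frame_bianchi:
  assumes "w \<in> F" "x \<in> F" "y \<in> F" "z \<in> F" "u \<in> F"
  shows "- 6 * G z w * (N x * G y u - N y * G x u)
    + (2 * of_real (\<tau> z) + 2 * h x y) * X w x y * G z u
    + (of_real (\<tau> y) + h x z) * X w x z * G y u - (of_real (\<tau> x) + h y z) * X w y z * G x u
    - 2 * G y w * r x z u - 2 * r x y w * G z u - G y u * r x z w - r x y u * G z w
    + 2 * G x w * r y z u + 2 * r y x w * G z u + G x u * r y z w + r y x u * G z w = 0"
proof -
  have ii: "\<i> * \<i> = -1" by simp
  have "bianchi (cext1 n) (cext2 g) (cext2 om) (cext3 nabla_om) (cext2 \<sigma>) (cext3 s) (ahol w) (hol x) (hol y) (hol z) (ahol u) = 0"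
    by (rule bianchi_cx)
  then show ?thesis
    unfolding bianchi_def Pi4_def Phi4_def g_types om_types nabla_om_types(1-4) nabla_om_X N_def[symmetric]
      sg_types(1,2) sg_types(3,4)[OF assms(2)] sg_types(3,4)[OF assms(3)] sg_types(3,4)[OF assms(4)]
      s_ahol[OF assms(2,3)] s_ahol[OF assms(2,4)] s_ahol[OF assms(3,4)] s_types
    using ii by algebra
qed

lemma two_h: "2 * h a b = of_real (\<tau> a) + of_real (\<tau> b)"
  by (simp add: h_def)

lemma X_self: "X w x x = 0"
  using X_skew[of w x x] by simp

lemma r_off_diagonal:
  assumes abc: "a \<in> F" "b \<in> F" "c \<in> F" "a \<noteq> b" "a \<noteq> c" "b \<noteq> c"
  shows "r a a b = 0" "r a b c = 0"
proof -
  note G = frame_G[OF frame]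
  show "r a a b = 0"
    using frame_bianchi[of c a c a b] abc by (simp add: G)
  have "r b a c = 3 * r a b c" "r a b c = 3 * r b a c"
    using frame_bianchi[of b a b b c] frame_bianchi[of a a b a c] abc by (auto simp: G algebra_simps X_self)
  then show "r a b c = 0" by simp
qed

text \<open>
  With \<open>p = r b a b\<close>, which turns out not to depend on \<open>b\<close>, the components with indices from \<open>a, b, c\<close>
  are linear equations whose unknowns are \<open>N a\<close>, the \<open>r\<close> with a repeated index and the products of \<open>X\<close>
  with eigenvalues. Eliminating the \<open>r\<close> gives \<open>N a = 0\<close> and three expressions for \<open>2 p\<close>.
\<close>

lemma frame_identities:
  assumes abc: "a \<in> F" "b \<in> F" "c \<in> F" "a \<noteq> b" "a \<noteq> c" "b \<noteq> c"
  shows "N a = 0"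
    and "X b a b * (3 * of_real (\<tau> b) + of_real (\<tau> a)) = 2 * r b a b"
    and "X b a b * (3 * of_real (\<tau> a) + of_real (\<tau> b)) = 2 * r b a b"
    and "X b a b * (2 * of_real (\<tau> c) + of_real (\<tau> a) + of_real (\<tau> b)) = 2 * r b a b"
proof -
  note G = frame_G[OF frame]
  have 1: "N a = 0 \<and> r b a b = r c a c"
    if abc: "a \<in> F" "b \<in> F" "c \<in> F" "a \<noteq> b" "a \<noteq> c" "b \<noteq> c" for a b c
  proof -
    have e: "- 6 * N a + r b a b - r c a c = 0"
      if abc: "a \<in> F" "b \<in> F" "c \<in> F" "a \<noteq> b" "a \<noteq> c" "b \<noteq> c" for a b c
    proof -
      have "- 6 * N a + (of_real (\<tau> b) + h a c) * X c a c - r a c c - r a b b + r b a b = 0"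
        using frame_bianchi[of c a b c b] abc by (simp add: G)
      moreover have "(2 * of_real (\<tau> b) + 2 * h a c) * X c a c - 2 * r a b b - 2 * r a c c + 2 * r c a c = 0"
        using frame_bianchi[of c a c b b] abc by (simp add: G)
      ultimately show ?thesis by algebra
    qed
    have "- 6 * N a + r b a b - r c a c = 0" "- 6 * N a + r c a c - r b a b = 0"
      using e[of a b c] e[of a c b] abc by auto
    then show ?thesis by algebra
  qed
  have N: "N a = 0" using 1[of a b c] abc by auto
  show "N a = 0" by (rule N)
  have 2: "X b a b * (2 * of_real (\<tau> c) + of_real (\<tau> a) + of_real (\<tau> b)) = 2 * r b a b"
    if abc: "a \<in> F" "b \<in> F" "c \<in> F" "a \<noteq> b" "a \<noteq> c" "b \<noteq> c" for a b c
  proof -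
    have "(of_real (\<tau> c) + h b a) * X b b a - r b a b + 2 * r c a c = 0"
      using frame_bianchi[of b b c a c] abc by (simp add: G)
    then show ?thesis using 1[of a b c] abc X_skew[of b b a] by (simp add: h_def field_simps)
  qed
  show "X b a b * (2 * of_real (\<tau> c) + of_real (\<tau> a) + of_real (\<tau> b)) = 2 * r b a b"
    using 2 abc by blast
  have q: "r a b b = r b a b \<and> r a a a = 2 * r b a b"
    if abc: "a \<in> F" "b \<in> F" "c \<in> F" "a \<noteq> b" "a \<noteq> c" "b \<noteq> c" for a b c
  proof -
    have p: "N a = 0" "r c a c = r b a b" using 1[of a b c] abc by auto
    have "(2 * of_real (\<tau> c) + 2 * h a b) * X b a b - 2 * r a c c - 2 * r a b b + 2 * r b a b = 0"
      using frame_bianchi[of b a b c c] abc by (simp add: G)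
    moreover have "- r a a a - r a b b + 3 * r b a b = 0"
      using frame_bianchi[of a a b a b] abc by (simp add: G X_self p algebra_simps)
    moreover have "- r a a a - r a c c + 3 * r c a c = 0"
      using frame_bianchi[of a a c a c] abc by (simp add: G X_self p algebra_simps)
    moreover have "(2 * of_real (\<tau> c) + 2 * h a b) * X b a b = 2 * r b a b"
      using 2[OF abc] two_h[of a b] by algebra
    ultimately show ?thesis using p(2) by algebra
  qed
  have q': "r a b b = r b a b" "r a a a = 2 * r b a b" using q[of a b c] abc by auto
  have "6 * ((3 * of_real (\<tau> b) + of_real (\<tau> a)) * X b a b) = 12 * r b a b"
    using frame_bianchi[of b a b b b] abc by (simp add: G h_def q' N field_simps)
  then show "X b a b * (3 * of_real (\<tau> b) + of_real (\<tau> a)) = 2 * r b a b"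
    by algebra
  have "12 * r b a b + 6 * ((3 * of_real (\<tau> a) + of_real (\<tau> b)) * X b b a) = 0"
    using frame_bianchi[of b b a a a] abc by (simp add: G h_def q' field_simps)
  then show "X b a b * (3 * of_real (\<tau> a) + of_real (\<tau> b)) = 2 * r b a b"
    using X_skew[of b a b] by algebra
qed

text \<open>
  For three distinct indices the \<open>r\<close> drop out by \<open>r_off_diagonal\<close>, so the same combinations of
  eigenvalues annihilate \<open>X\<close>.
\<close>

lemma frame_identities_distinct:
  assumes abc: "a \<in> F" "b \<in> F" "d \<in> F" "c \<in> F" "a \<noteq> b" "a \<noteq> d" "b \<noteq> d" "c \<noteq> a" "c \<noteq> b"
  shows "X d a b * (3 * of_real (\<tau> b) + of_real (\<tau> a)) = 0"
    and "X d a b * (3 * of_real (\<tau> a) + of_real (\<tau> b)) = 0"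
    and "X d a b * (2 * of_real (\<tau> c) + of_real (\<tau> a) + of_real (\<tau> b)) = 0"
proof -
  note G = frame_G[OF frame]
  have r0: "r a b d = 0" "r b a d = 0" "r a b c = 0" "r b a c = 0"
    using r_off_diagonal(2)[of a b d] r_off_diagonal(2)[of b a d] r_off_diagonal(2)[of a b c]
      r_off_diagonal(2)[of b a c] abc by auto
  have e: "X d a b * (3 * of_real (\<tau> b) + of_real (\<tau> a)) = 0"
    if "a \<in> F" "b \<in> F" "a \<noteq> b" "a \<noteq> d" "b \<noteq> d" "r a b d = 0" "r b a d = 0" for a b
  proof -
    have "6 * (X d a b * (3 * of_real (\<tau> b) + of_real (\<tau> a))) = 0"
      using frame_bianchi[of d a b b b] that abc(3) by (simp add: G h_def field_simps)
    then show ?thesis by simp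
  qed
  show "X d a b * (3 * of_real (\<tau> b) + of_real (\<tau> a)) = 0"
    using e[of a b] abc r0 by blast
  have "X d b a * (3 * of_real (\<tau> a) + of_real (\<tau> b)) = 0"
    using e[of b a] abc r0 by blast
  then show "X d a b * (3 * of_real (\<tau> a) + of_real (\<tau> b)) = 0"
    using X_skew[of d a b] by simp
  have "(2 * of_real (\<tau> c) + 2 * h a b) * X d a b = 0"
    using frame_bianchi[of d a b c c] abc r0 by (simp add: G)
  then show "X d a b * (2 * of_real (\<tau> c) + of_real (\<tau> a) + of_real (\<tau> b)) = 0"
    using two_h[of a b] by algebra
qed

lemma nabla_om_zero_frame:
  assumes "\<And>w a b. w \<in> F \<Longrightarrow> a \<in> F \<Longrightarrow> b \<in> F \<Longrightarrow> X w a b = 0"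
  shows "nabla_om w x y = 0"
proof -
  have 1: "nabla_om w a b = 0" "nabla_om w (J a) b = 0" if "w \<in> F" "a \<in> F" "b \<in> F" for w a b
    using assms[OF that] by (auto simp: X_def nabla_om_types complex_eq_iff)
  have 2: "nabla_om w a y = 0" "nabla_om w (J a) y = 0" if "w \<in> F" "a \<in> F" for w a y
    using frame_zero[OF frame, of "nabla_om w a"] frame_zero[OF frame, of "nabla_om w (J a)"] bil_nabla_om 1 that
    by (auto simp: bilinear_def nabla_om_J JJ nabla_om_simps)
  have 3: "nabla_om w x y = 0" if "w \<in> F" for w x y
    using frame_zero[OF frame, of "\<lambda>x. nabla_om w x y"] bil_nabla_om 2 that by (auto simp: bilinear_def)
  show ?thesis
    by (rule frame_zero[OF frame lin_nabla_om]) (auto simp: nabla_om_J 3)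
qed

theorem n_zero: "n x = 0"
proof -
  have "N a = 0" if a: "a \<in> F" for a
  proof -
    obtain b where b: "b \<in> F" "b \<noteq> a" using frame_third[OF frame a a] .
    obtain c where "c \<in> F" "c \<noteq> a" "c \<noteq> b" using frame_third[OF frame a b(1)] .
    then show ?thesis using frame_identities(1)[of a b c] a b by auto
  qed
  then have "n a = 0 \<and> n (J a) = 0" if "a \<in> F" for a
    using that by (force simp: N_def cext1_def hol_def linear_neg[OF lin_n] complex_eq_iff)
  then show ?thesis using frame_zero[OF frame lin_n] by auto
qed

text \<open>
  If \<open>X w a b\<close> is nonzero it can be cancelled in the three identities above; the resulting linear equations
  leave no room for different eigenvalues.
\<close>

lemma tau_equal:
  assumes "X w a b \<noteq> 0" "w \<in> F" "a \<in> F" "b \<in> F" "c \<in> F"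
  shows "\<tau> c = \<tau> a"
proof -
  have *: "\<tau> c = \<tau> a" if X: "X w a b \<noteq> 0" and w: "w \<in> F" "a \<in> F" "b \<in> F" "w \<noteq> a" and c: "c \<in> F" for w a b c
  proof -
    have ab: "a \<noteq> b" using X X_self by auto
    obtain d where d: "d \<in> F" "d \<noteq> a" "d \<noteq> b" and dc: "c \<noteq> a \<Longrightarrow> c \<noteq> b \<Longrightarrow> d = c"
      using frame_third[OF frame w(2,3)] c by metis
    have *: "complex_of_real (3 * \<tau> b + \<tau> a) = of_real (3 * \<tau> a + \<tau> b) \<and>
      complex_of_real (2 * \<tau> d + \<tau> a + \<tau> b) = of_real (3 * \<tau> a + \<tau> b)"
    proof (cases "w = b")
      case True
      note fi = frame_identities(2-4)[OF w(2,3) d(1) ab d(2)[symmetric] d(3)[symmetric]]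
      have "X b a b \<noteq> 0" using X True by simp
      then have "3 * of_real (\<tau> b) + of_real (\<tau> a) = (3 * of_real (\<tau> a) + of_real (\<tau> b) :: complex)"
        "2 * of_real (\<tau> d) + of_real (\<tau> a) + of_real (\<tau> b) = (3 * of_real (\<tau> a) + of_real (\<tau> b) :: complex)"
        using fi by (metis mult_left_cancel)+
      then show ?thesis by simp
    next
      case False
      then show ?thesis using frame_identities_distinct[of a b w d] w ab d X by simp
    qed
    then have "\<tau> a = \<tau> b" "\<tau> d = \<tau> a" by (simp_all only: of_real_eq_iff) auto
    then show ?thesis using dc by auto
  qed
  show ?thesis
  proof (cases "w = a")
    case False
    then show ?thesis using * assms by blast
  next
    case True
    have ab: "w \<noteq> b" "X w b a \<noteq> 0" using assms(1) True X_self X_skew[of w a b] by auto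
    then show ?thesis using *[of w b a] assms by metis
  qed
qed

theorem nabla_om_zero_or_sg_multiple_om: "(\<forall>w x y. nabla_om w x y = 0) \<or> (\<exists>t. \<forall>x y. \<sigma> x y = t * om x y)"
proof (cases "\<exists>w\<in>F. \<exists>a\<in>F. \<exists>b\<in>F. X w a b \<noteq> 0")
  case False
  then show ?thesis using nabla_om_zero_frame by blast
next
  case True
  then obtain w a b where X: "X w a b \<noteq> 0" "w \<in> F" "a \<in> F" "b \<in> F" by blast
  have t: "\<tau> c = \<tau> a" if "c \<in> F" for c by (rule tau_equal[OF X that])
  have l: "linear (\<lambda>x. \<sigma> x y - \<tau> a * om x y)" for y
    by (auto simp: linear_iff sg_simps om_simps algebra_simps)
  have "\<sigma> x y - \<tau> a * om x y = 0" for x y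
    by (rule frame_zero[OF frame l]) (auto simp: sg_diag sg_J_diag t)
  then show ?thesis by auto
qed

text \<open>
  If \<open>\<sigma> = t om\<close> on a neighbourhood, with \<open>f\<close> the derivative of \<open>t\<close>, then \<open>s\<close> is as assumed here. Then
  \<open>r b a b = 0\<close> for \<open>a \<noteq> b\<close>, and all combinations of eigenvalues in the frame identities are \<open>4 t\<close>.
\<close>

theorem nabla_om_zero_or_multiple_zero:
  assumes sg: "\<And>x y. \<sigma> x y = t * om x y" and s: "\<And>w x y. s w x y = f w * om x y + t * nabla_om w x y"
  shows "t * nabla_om w x y = 0"
proof (cases "t = 0")
  case False
  have \<tau>: "\<tau> a = t" if "a \<in> F" for a
  proof -
    have "g a a = 1/2" using frame that by (simp add: frame_def)
    then show ?thesis using sg_diag[OF that, of "J a"] sg[of a "J a"] by (simp add: om_J_self)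
  qed
  have "cext3 s U V W = cext1 f U * cext2 om V W + of_real t * cext3 nabla_om U V W" for U V W
    by (simp add: cext_defs s algebra_simps)
  then have r: "r w x y = cext1 f (hol w) * G x y" for w x y
    by (simp add: r_def om_types nabla_om_types algebra_simps)
  have "X w a b = 0" if F: "w \<in> F" "a \<in> F" "b \<in> F" for w a b
  proof -
    have 4: "X b a b = 0" if ab: "a \<in> F" "b \<in> F" "a \<noteq> b" for a b
    proof -
      obtain c where c: "c \<in> F" "c \<noteq> a" "c \<noteq> b" using frame_third[OF frame ab(1,2)] .
      have "X b a b * (4 * of_real t) = 0"
        using frame_identities(2)[of a b c] ab c \<tau> by (auto simp: r frame_G[OF frame])
      then show ?thesis using False by simp
    qed
    consider "a = b" | "a \<noteq> b" "w = b" | "a \<noteq> b" "w = a" | "a \<noteq> b" "w \<noteq> a" "w \<noteq> b" by blast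
    then show ?thesis
    proof cases
      case 1
      then show ?thesis using X_self by simp
    next
      case 2
      then show ?thesis using 4 F by simp
    next
      case 3
      then show ?thesis using 4[of b a] F X_skew[of w a b] by simp
    next
      case 4
      then have "X w a b * (4 * of_real t) = 0"
        using frame_identities_distinct(1)[of a b w w] F \<tau> by auto
      then show ?thesis using False by simp
    qed
  qed
  then show ?thesis using nabla_om_zero_frame by simp
qed simp

end

section \<open>Diagonalisation of Hermitian forms\<close>

context hermitian_form
begin

definition eigenframe :: "('e \<Rightarrow> 'e \<Rightarrow> real) \<Rightarrow> 'e set \<Rightarrow> ('e \<Rightarrow> real) \<Rightarrow> bool" where
  "eigenframe h F l \<longleftrightarrow> finite F \<and> (\<forall>a\<in>F. g a a = 1/2) \<and>
     (\<forall>a\<in>F. \<forall>b\<in>F. a \<noteq> b \<longrightarrow> g a b = 0 \<and> g a (J b) = 0) \<and> (\<forall>a\<in>F. \<forall>v. h a v = l a * g a v)"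

lemma g_J_self [simp]: "g x (J x) = 0" "g (J x) x = 0"
  using g_J_right[of x x] sym_g[of x "J x"] by auto

text \<open>
  The map \<open>R\<close> below turns orthogonality with respect to \<open>g\<close> into orthogonality for the standard inner product.
\<close>

lemma orthogonal_complement_nonzero:
  assumes "finite B" "span B \<noteq> UNIV"
  obtains v where "v \<noteq> 0" "\<And>b. b \<in> B \<Longrightarrow> g b v = 0"
proof -
  define R where "R b = (\<Sum>i\<in>Basis. g b i *\<^sub>R i)" for b
  have lin: "linear R"
    by (auto simp: R_def linear_iff g_simps algebra_simps sum.distrib scaleR_sum_right)
  have R: "R b \<bullet> v = g b v" for b v
  proof -
    have l: "linear (g b)" using bil_g by (simp add: bilinear_def)
    have "g b v = (\<Sum>i\<in>Basis. (v \<bullet> i) *\<^sub>R g b i)"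
      using linear_sum[OF l, of "\<lambda>i. (v \<bullet> i) *\<^sub>R i" Basis] linear_cmul[OF l] by (simp add: euclidean_representation)
    then show ?thesis unfolding R_def by (simp add: inner_sum_right inner_commute mult.commute)
  qed
  have "dim B < DIM('e)"
    using assms(2) dim_eq_full[of B] dim_subset_UNIV[of B] by linarith
  then have "dim (R ` B) < DIM('e)" using dim_image_le[OF lin, of B] by linarith
  then obtain x where x: "x \<noteq> 0" "\<And>y. y \<in> span (R ` B) \<Longrightarrow> orthogonal x y"
    using orthogonal_to_subspace_exists by blast
  show ?thesis
  proof (rule that[OF x(1)])
    fix b assume "b \<in> B"
    then have "orthogonal x (R b)" using x(2) span_base by blast
    then show "g b x = 0" using R[of b x] by (simp add: orthogonal_def inner_commute)
  qed
qed

lemma orthogonal_independent: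
  assumes "finite B" "\<And>a. a \<in> B \<Longrightarrow> a \<noteq> 0" "\<And>a b. a \<in> B \<Longrightarrow> b \<in> B \<Longrightarrow> a \<noteq> b \<Longrightarrow> g a b = 0"
  shows "independent B"
proof -
  have "u a = 0" if s: "(\<Sum>v\<in>B. u v *\<^sub>R v) = 0" and a: "a \<in> B" for u a
  proof -
    have l: "linear (g a)" using bil_g by (simp add: bilinear_def)
    have "0 = g a (\<Sum>v\<in>B. u v *\<^sub>R v)" by (simp add: s g_simps)
    also have "\<dots> = (\<Sum>v\<in>B. u v * g a v)" by (simp add: linear_sum[OF l] g_simps)
    also have "\<dots> = (\<Sum>v\<in>B. if v = a then u a * g a a else 0)"
      by (rule sum.cong) (use assms(3) a in auto)
    also have "\<dots> = u a * g a a" using assms(1) a by simp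
    finally show "u a = 0" using assms(2)[OF a] g_self_eq_0 by simp
  qed
  then show ?thesis using dependent_finite[OF assms(1)] by blast
qed

text \<open>An eigenvector of \<open>h\<close> in \<open>W\<close> is found by maximising \<open>h\<close> on the unit sphere of \<open>W\<close>.\<close>

lemma eigenvector_in_subspace:
  assumes h: "bilinear h" "\<And>x y. h x y = h y x" and W: "subspace W" "w \<in> W" "w \<noteq> 0"
  obtains x l where "x \<in> W" "g x x = 1/2" "\<And>v. v \<in> W \<Longrightarrow> h x v = l * g x v"
proof -
  note h_simps = bilinear_simps[OF h(1)]
  define S where "S = {x \<in> W. g x x = 1/2}"
  have contg: "continuous_on UNIV (\<lambda>x. g x x)" and conth: "continuous_on UNIV (\<lambda>x. h x x)"
    using bilinear_continuous_on_compose[OF continuous_on_id continuous_on_id] bil_g h(1) by auto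
  obtain c where c: "c > 0" "\<And>x. c * (norm x)\<^sup>2 \<le> g x x" using positive_definite_coercive[OF bil_g pos_g] by blast
  have "bounded S"
  proof (rule boundedI)
    fix x assume "x \<in> S"
    then have "c * (norm x)\<^sup>2 \<le> 1/2" using c(2)[of x] by (simp add: S_def)
    then have "(norm x)\<^sup>2 \<le> 1 / (2 * c)" using c(1) by (simp add: field_simps)
    then show "norm x \<le> sqrt (1 / (2 * c))" by (rule real_le_rsqrt)
  qed
  moreover have "closed S"
  proof -
    have "closed {x. g x x = 1/2}" by (intro closed_Collect_eq contg continuous_on_const)
    then show ?thesis unfolding S_def Collect_conj_eq using closed_subspace[OF W(1)] by (simp add: closed_Int)
  qed
  ultimately have comp: "compact S" by (simp add: compact_eq_bounded_closed)
  have normalize: "(1 / sqrt (2 * g v v)) *\<^sub>R v \<in> S" if "v \<in> W" "v \<noteq> 0" for v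
    using that pos_g[of v] subspace_scale[OF W(1)] by (auto simp: S_def g_simps divide_simps)
  then have ne: "S \<noteq> {}" using W by blast
  obtain x where x: "x \<in> S" "\<And>y. y \<in> S \<Longrightarrow> h y y \<le> h x x"
    using continuous_attains_sup[OF comp ne continuous_on_subset[OF conth]] by auto
  define l where "l = 2 * h x x"
  have xW: "x \<in> W" and gx: "g x x = 1/2" using x(1) by (auto simp: S_def)
  have ineq: "h v v \<le> l * g v v" if "v \<in> W" for v
  proof (cases "v = 0")
    case False
    have "h v v / (2 * g v v) \<le> h x x"
      using x(2)[OF normalize[OF that False]] pos_g[OF False] by (simp add: h_simps)
    then show ?thesis using pos_g[OF False] by (simp add: l_def field_simps)
  qed (simp add: g_simps h_simps)
  have "h x v = l * g x v" if v: "v \<in> W" for v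
  proof -
    define p where "p = h x v - l * g x v"
    define q where "q = h v v - l * g v v"
    have quad: "2 * t * p + t\<^sup>2 * q \<le> 0" for t
    proof -
      have "x + t *\<^sub>R v \<in> W" using xW v W(1) by (simp add: subspace_add subspace_scale)
      from ineq[OF this] show ?thesis
        using h(2)[of v x] sym_g[of v x] gx
        by (simp add: h_simps g_simps p_def q_def l_def power2_eq_square algebra_simps)
    qed
    have "p = 0"
    proof (rule ccontr)
      assume p: "p \<noteq> 0"
      define t where "t = p / (\<bar>q\<bar> + 1)"
      have "2 * t * p + t\<^sup>2 * q = t\<^sup>2 * (2 * (\<bar>q\<bar> + 1) + q)"
      proof -
        have "p = t * (\<bar>q\<bar> + 1)" by (simp add: t_def)
        then show ?thesis by (simp add: power2_eq_square algebra_simps)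
      qed
      moreover have "t \<noteq> 0" using p by (simp add: t_def)
      then have "t\<^sup>2 * (2 * (\<bar>q\<bar> + 1) + q) > 0" by (intro mult_pos_pos) auto
      ultimately show False using quad[of t] by simp
    qed
    then show ?thesis by (simp add: p_def)
  qed
  then show ?thesis using that xW gx by blast
qed

text \<open>
  An eigenframe of maximal cardinality spans: otherwise its complement, which is invariant under \<open>J\<close>
  and under the operator of \<open>h\<close>, contains a further eigenvector.
\<close>

lemma unitary_eigenframe_exists:
  assumes h: "bilinear h" "\<And>x y. h x y = h y x" and hJ: "\<And>x y. h (J x) (J y) = h x y"
  obtains F l where "frame F" "\<And>a v. a \<in> F \<Longrightarrow> h a v = l a * g a v"
proof -
  have bound: "card F \<le> DIM('e)" if "eigenframe h F l" for F l
  proof -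
    have "finite F" "\<forall>a\<in>F. a \<noteq> 0" "\<forall>a\<in>F. \<forall>b\<in>F. a \<noteq> b \<longrightarrow> g a b = 0"
      using that g_simps(9)[of 0] unfolding eigenframe_def by auto
    then have "independent F" using orthogonal_independent[of F] by blast
    then show ?thesis using independent_bound by blast
  qed
  have "\<exists>F. \<exists>l. eigenframe h F l" by (rule exI[of _ "{}"]) (simp add: eigenframe_def)
  then obtain F where F: "\<exists>l. eigenframe h F l" "\<And>F'. \<exists>l. eigenframe h F' l \<Longrightarrow> card F' \<le> card F"
    using ex_has_greatest_nat[of "\<lambda>F. \<exists>l. eigenframe h F l" _ card "Suc (DIM('e))"] bound
    by (metis le_imp_less_Suc)
  then obtain l where l: "eigenframe h F l" by blast
  have fin: "finite F" using l by (simp add: eigenframe_def)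
  have "span (F \<union> J ` F) = UNIV"
  proof (rule ccontr)
    assume "span (F \<union> J ` F) \<noteq> UNIV"
    then obtain w where w: "w \<noteq> 0" "\<And>b. b \<in> F \<union> J ` F \<Longrightarrow> g b w = 0"
      using orthogonal_complement_nonzero[of "F \<union> J ` F"] fin by blast
    define W where "W = {v. \<forall>b\<in>F. g b v = 0 \<and> g (J b) v = 0}"
    have W: "subspace W" by (auto simp: W_def subspace_def g_simps)
    have "w \<in> W" using w by (auto simp: W_def)
    then obtain x k where x: "x \<in> W" "g x x = 1/2" "\<And>v. v \<in> W \<Longrightarrow> h x v = k * g x v"
      using eigenvector_in_subspace[OF h W _ w(1)] by metis
    have hF: "h x b = 0" "h x (J b) = 0" if "b \<in> F" for b
    proof -
      have "h b v = l b * g b v" for v using l that by (simp add: eigenframe_def)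
      note hb = this
      show "h x b = 0" using hb[of x] h(2)[of x b] x(1) that by (simp add: W_def)
      have "h x (J b) = h (J x) (J (J b))" by (rule hJ[symmetric])
      also have "\<dots> = - h b (J x)" using h(2)[of "J x" b] by (simp add: JJ bilinear_simps[OF h(1)])
      also have "\<dots> = 0" using hb[of "J x"] x(1) that g_J_right[of b x] by (simp add: W_def)
      finally show "h x (J b) = 0" .
    qed
    have gF: "g x b = 0" "g x (J b) = 0" "g b x = 0" "g b (J x) = 0" if "b \<in> F" for b
      using x(1) that sym_g[of x b] sym_g[of x "J b"] g_J_right[of b x] by (auto simp: W_def)
    have eig: "h x v = k * g x v" for v
    proof -
      \<comment> \<open>the orthogonal projection to the span of the frame\<close>
      define P where "P v = (\<Sum>b\<in>F. (2 * g b v) *\<^sub>R b + (2 * g (J b) v) *\<^sub>R J b)" for v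
      have "v - P v \<in> W"
      proof -
        have la: "linear (g a)" for a using bil_g by (simp add: bilinear_def)
        have ga: "g a (P v) = g a v" "g (J a) (P v) = g (J a) v" if a: "a \<in> F" for a
        proof -
          have gg: "g a a = 1/2" "\<And>b. b \<in> F \<Longrightarrow> b \<noteq> a \<Longrightarrow> g a b = 0 \<and> g a (J b) = 0"
            using l a unfolding eigenframe_def by auto
          have "g a (P v) = (\<Sum>b\<in>F. 2 * g b v * g a b + 2 * g (J b) v * g a (J b))"
            by (simp add: P_def linear_sum[OF la] g_simps)
          also have "\<dots> = (\<Sum>b\<in>F. if b = a then g a v else 0)"
            by (rule sum.cong) (use gg in auto)
          finally show "g a (P v) = g a v" using fin a by simp
          have "g (J a) (P v) = (\<Sum>b\<in>F. 2 * g b v * g (J a) b + 2 * g (J b) v * g (J a) (J b))"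
            by (simp add: P_def linear_sum[OF la] g_simps)
          also have "\<dots> = (\<Sum>b\<in>F. if b = a then g (J a) v else 0)"
            by (rule sum.cong) (use gg g_J_right[of a] in \<open>auto simp: g_JJ\<close>)
          finally show "g (J a) (P v) = g (J a) v" using fin a by simp
        qed
        show ?thesis unfolding W_def using ga by (auto simp: g_simps)
      qed
      then have "h x (v - P v) = k * g x (v - P v)" by (rule x(3))
      moreover have "h x (P v) = 0" "g x (P v) = 0"
      proof -
        have "linear (h x)" "linear (g x)" using h(1) bil_g by (auto simp: bilinear_def)
        then show "h x (P v) = 0" "g x (P v) = 0"
          unfolding P_def by (auto simp: linear_sum bilinear_simps[OF h(1)] g_simps hF gF intro!: sum.neutral)
      qed
      ultimately show ?thesis by (simp add: bilinear_simps[OF h(1)] g_simps)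
    qed
    have xF: "x \<notin> F" using gF(1)[of x] x(2) by auto
    have "eigenframe h (insert x F) (l(x := k))"
      using l eig xF gF x(2) fin unfolding eigenframe_def by (auto simp: fun_upd_apply)
    then have "card (insert x F) \<le> card F" using F(2) by blast
    then show False using xF fin by simp
  qed
  then have "frame F" using l by (simp add: frame_def eigenframe_def)
  then show ?thesis proof (rule that)
    fix a v assume "a \<in> F"
    then show "h a v = l a * g a v" using l by (simp add: eigenframe_def)
  qed
qed

end

lemma card_four_le: "card {a, b, c, d} \<le> 4"
  by (simp add: card_insert_if)

lemma card_two_le: "card {a, b} \<le> 2"
  by (simp add: card_insert_if)

context hermitian_form
begin

lemma common_orthogonal_vector:
  assumes "finite B" "card B < DIM('e)"
  obtains v where "v \<noteq> 0" "\<And>b. b \<in> B \<Longrightarrow> g b v = 0"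
proof -
  have "span B \<noteq> UNIV" using dim_eq_full[of B] dim_le_card'[OF assms(1)] assms(2) by linarith
  then show ?thesis using orthogonal_complement_nonzero[OF assms(1)] that by blast
qed

text \<open>
  Comparing \<open>R x (J x) z u\<close> with \<open>R x (J x) (J z) (J u)\<close> for \<open>x\<close> orthogonal to \<open>z\<close>, \<open>u\<close> and their images
  under \<open>J\<close> shows that \<open>\<sigma>\<close> is \<open>J\<close>-invariant. Comparing \<open>R x y (J y) (J x)\<close> with \<open>R x y y x\<close> determines the sum
  of the values of \<open>\<sigma>\<close> on two orthogonal complex lines; three such lines determine the single values.
\<close>

lemma J_invariant_curvature:
  assumes dim: "DIM('e) \<ge> 6" and \<sigma>: "bilinear \<sigma>" "\<And>x y. \<sigma> x y = - \<sigma> y x"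
    and R: "\<And>x y z u. R x y z u = \<nu> * Pi4 g x y z u - Phi4 om \<sigma> x y z u / 6"
    and RJ: "\<And>x y z u. R x y (J z) (J u) = R x y z u"
  shows "\<sigma> x y = 3 * \<nu> * om x y"
proof -
  note sg_simps = bilinear_simps[OF \<sigma>(1)]
  have J_inv: "\<sigma> (J z) (J u) = \<sigma> z u" for z u
  proof -
    have "card {z, u, J z, J u} < DIM('e)"
      using dim card_four_le[of z u "J z" "J u"] by linarith
    then obtain x where x: "x \<noteq> 0" "\<And>b. b \<in> {z, u, J z, J u} \<Longrightarrow> g b x = 0"
      using common_orthogonal_vector[of "{z, u, J z, J u}"] by auto
    have o: "g z x = 0" "g u x = 0" "g x z = 0" "g x u = 0" "g (J z) x = 0" "g (J u) x = 0" "g x (J z) = 0" "g x (J u) = 0"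
      using x(2) sym_g[of x] by auto
    have o': "g (J x) z = 0" "g (J x) u = 0" using o g_J_right[of x z] g_J_right[of x u] by auto
    have "R x (J x) (J z) (J u) = R x (J x) z u" by (rule RJ)
    then show ?thesis
      using o o' x(1) g_J_right[of z u] unfolding R Pi4_def Phi4_def om_def
      by (simp add: g_JJ JJ g_simps g_self_eq_0)
  qed
  have sum: "g x x * \<sigma> y (J y) + g y y * \<sigma> x (J x) = 6 * \<nu> * (g x x * g y y)"
    if "g x y = 0" "g (J x) y = 0" for x y
  proof -
    have o: "g y x = 0" "g x (J y) = 0" "g y (J x) = 0" "g (J y) x = 0"
      using that sym_g[of x y] g_J_right[of x y] sym_g[of y "J x"] g_J_right[of y x] by auto
    have "R x y (J y) (J x) = R x y y x" by (rule RJ)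
    then show ?thesis
      using o that unfolding R Pi4_def Phi4_def om_def
      by (simp add: g_JJ JJ g_simps field_simps)
  qed
  have diag: "\<sigma> x (J x) = 3 * \<nu> * g x x" for x
  proof (cases "x = 0")
    case False
    have "card {x, J x} < DIM('e)" using dim card_two_le[of x "J x"] by linarith
    then obtain y where y: "y \<noteq> 0" "\<And>b. b \<in> {x, J x} \<Longrightarrow> g b y = 0"
      using common_orthogonal_vector[of "{x, J x}"] by auto
    have "card {x, J x, y, J y} < DIM('e)"
      using dim card_four_le[of x "J x" y "J y"] by linarith
    then obtain z where z: "z \<noteq> 0" "\<And>b. b \<in> {x, J x, y, J y} \<Longrightarrow> g b z = 0"
      using common_orthogonal_vector[of "{x, J x, y, J y}"] by auto
    define k where "k v = \<sigma> v (J v) / g v v" for v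
    have s: "k v + k w = 6 * \<nu>" if "g v w = 0" "g (J v) w = 0" "v \<noteq> 0" "w \<noteq> 0" for v w
      using sum[OF that(1,2)] that(3,4) g_self_eq_0 by (simp add: k_def field_simps)
    have "k x + k y = 6 * \<nu>" "k x + k z = 6 * \<nu>" "k y + k z = 6 * \<nu>"
      using s[of x y] s[of x z] s[of y z] y z False by auto
    then have "k x = 3 * \<nu>" by linarith
    then show ?thesis using False g_self_eq_0 by (simp add: k_def field_simps)
  qed (simp add: sg_simps g_simps J_simps)
  have sym: "\<sigma> x (J y) = \<sigma> y (J x)" for x y
    using J_inv[of y "J x"] \<sigma>(2)[of "J y" x] by (simp add: JJ sg_simps)
  have "\<sigma> x (J y) = 3 * \<nu> * g x y" for x y
    using diag[of "x + y"] diag[of x] diag[of y] sym[of x y] sym_g[of x y]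
    by (simp add: J_simps sg_simps g_simps algebra_simps)
  from this[of x "J y"] show ?thesis by (simp add: JJ sg_simps g_J_right om_def)
qed

end

section \<open>Riemannian geometry in a chart\<close>

text \<open>The coefficients of the Levi-Civita connection, for a metric given in coordinates.\<close>

definition chris :: "('e::euclidean_space \<Rightarrow> 'e \<Rightarrow> 'e \<Rightarrow> real) \<Rightarrow> 'e \<Rightarrow> 'e \<Rightarrow> 'e \<Rightarrow> 'e" where
  "chris g x = (THE \<Gamma>. bilinear \<Gamma> \<and> (\<forall>u v. \<Gamma> u v = \<Gamma> v u) \<and>
     (\<forall>u v w. dd (\<lambda>y. g y v w) x u = g x (\<Gamma> u v) w + g x v (\<Gamma> u w)))"

locale riemannian_chart =
  fixes S :: "'e::euclidean_space set" and g :: "'e \<Rightarrow> 'e \<Rightarrow> 'e \<Rightarrow> real"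
  assumes open_S: "open S" and bil: "x \<in> S \<Longrightarrow> bilinear (g x)" and sym: "x \<in> S \<Longrightarrow> g x u v = g x v u"
    and pos: "x \<in> S \<Longrightarrow> u \<noteq> 0 \<Longrightarrow> g x u u > 0" and smooth: "smooth_on S (\<lambda>x. g x u v)"
begin

lemma g_lin: "x \<in> S \<Longrightarrow> linear (g x u)" "x \<in> S \<Longrightarrow> linear (\<lambda>u. g x u v)"
  using bil by (auto simp: bilinear_def)

lemma gx_simps:
  assumes "x \<in> S"
  shows "g x (u + v) w = g x u w + g x v w" "g x u (v + w) = g x u v + g x u w"
    "g x (c *\<^sub>R u) w = c * g x u w" "g x u (c *\<^sub>R w) = c * g x u w"
    "g x (u - v) w = g x u w - g x v w" "g x u (v - w) = g x u v - g x u w"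
    "g x (- u) w = - g x u w" "g x u (- w) = - g x u w" "g x 0 w = 0" "g x u 0 = 0"
  using bil[OF assms] by (auto simp: bilinear_ladd bilinear_radd bilinear_lmul bilinear_rmul
      bilinear_lsub bilinear_rsub bilinear_lneg bilinear_rneg bilinear_lzero bilinear_rzero)

lemma g_diff: "x \<in> S \<Longrightarrow> (\<lambda>y. g y u v) differentiable at x"
  using smooth smooth_on_differentiable by blast

lemma g_nondegenerate: "x \<in> S \<Longrightarrow> (\<And>w. g x u w = g x v w) \<Longrightarrow> u = v"
  using pos[of x "u - v"] gx_simps(5)[of x u v "u - v"] by fastforce

definition flat :: "'e \<Rightarrow> 'e \<Rightarrow> 'e" where "flat x u = (\<Sum>i\<in>Basis. g x u i *\<^sub>R i)"

lemma flat_inner: "x \<in> S \<Longrightarrow> flat x u \<bullet> w = g x u w"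
  using linear_Basis_expand[OF g_lin(1), of x u w]
  by (simp add: flat_def inner_sum_right inner_commute mult.commute)

lemma linear_flat: "x \<in> S \<Longrightarrow> linear (flat x)"
  by (auto simp: flat_def linear_iff gx_simps algebra_simps sum.distrib scaleR_sum_right)

definition sharp :: "'e \<Rightarrow> 'e \<Rightarrow> 'e" where "sharp x a = inv (flat x) a"

lemma bij_flat: "x \<in> S \<Longrightarrow> bij (flat x)"
proof -
  assume x: "x \<in> S"
  have "inj (flat x)"
    by (rule injI) (metis flat_inner g_nondegenerate x)
  then show ?thesis
    using linear_injective_imp_surjective[OF linear_flat[OF x]] by (simp add: bij_def)
qed

lemma flat_sharp: "x \<in> S \<Longrightarrow> flat x (sharp x a) = a"
  unfolding sharp_def using bij_flat by (simp add: bij_is_surj surj_f_inv_f)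

lemma g_sharp: "x \<in> S \<Longrightarrow> g x (sharp x a) w = a \<bullet> w"
  using flat_inner flat_sharp by metis

lemma sharp_flat: "x \<in> S \<Longrightarrow> sharp x (flat x u) = u"
  unfolding sharp_def using bij_flat by (simp add: bij_is_inj)

lemma linear_sharp: "x \<in> S \<Longrightarrow> linear (sharp x)"
  by (rule linearI; rule g_nondegenerate) (auto simp: g_sharp gx_simps inner_add_left)

text \<open>
  The metric at \<open>x\<close> is coercive, and the metrics near \<open>x\<close> differ from it by little on the unit sphere.
\<close>

lemma sharp_bounded_near:
  assumes x: "x \<in> S"
  obtains c where "c > 0" "\<forall>\<^sub>F y in at x. y \<in> S \<and> (\<forall>a. norm (sharp y a) \<le> c * norm a)"
proof -
  obtain k' where k': "k' > 0" "\<And>u. k' * (norm u)\<^sup>2 \<le> g x u u"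
    using positive_definite_coercive[OF bil[OF x] pos[OF x]] by blast
  define k where "k = k' / 2"
  have k: "k > 0" and coer: "2 * k * (norm u)\<^sup>2 \<le> g x u u" for u using k' by (simp_all add: k_def)
  define K where "K y = (\<Sum>i\<in>Basis. \<Sum>j\<in>Basis. \<bar>g y i j - g x i j\<bar>)" for y
  have "((\<lambda>y. \<Sum>i\<in>Basis. \<Sum>j\<in>Basis. \<bar>g y i j - g x i j\<bar>) \<longlongrightarrow> (\<Sum>i\<in>Basis. \<Sum>j\<in>Basis. \<bar>g x i j - g x i j\<bar>)) (at x)"
    using differentiable_imp_continuous_within[OF g_diff[OF x]]
    by (intro tendsto_intros) (auto simp: continuous_within)
  then have K0: "(K \<longlongrightarrow> 0) (at x)" by (simp add: K_def[abs_def])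
  have evS: "\<forall>\<^sub>F y in at x. y \<in> S" using eventually_at_in_open'[OF open_S x] .
  have "\<forall>\<^sub>F y in at x. K y < k" using order_tendstoD(2)[OF K0 k] .
  then have "\<forall>\<^sub>F y in at x. y \<in> S \<and> (\<forall>a. norm (sharp y a) \<le> (1 / k) * norm a)"
    using evS
  proof eventually_elim
    case (elim y)
    have expand: "g z u u = (\<Sum>i\<in>Basis. \<Sum>j\<in>Basis. (u \<bullet> i) * (u \<bullet> j) * g z i j)" if "z \<in> S" for z u
    proof -
      have "g z u u = (\<Sum>i\<in>Basis. (u \<bullet> i) * g z i u)"
        using linear_Basis_expand[OF g_lin(2)[OF that], of u u] by simp
      also have "\<dots> = (\<Sum>i\<in>Basis. (u \<bullet> i) * (\<Sum>j\<in>Basis. (u \<bullet> j) * g z i j))"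
      proof (rule sum.cong[OF refl])
        fix i :: 'e assume "i \<in> Basis"
        have "g z i u = (\<Sum>j\<in>Basis. (u \<bullet> j) * g z i j)"
          using linear_Basis_expand[OF g_lin(1)[OF that], of i u] by simp
        then show "u \<bullet> i * g z i u = u \<bullet> i * (\<Sum>j\<in>Basis. (u \<bullet> j) * g z i j)" by simp
      qed
      finally show ?thesis by (simp add: sum_distrib_left mult.assoc)
    qed
    have "k * (norm u)\<^sup>2 \<le> g y u u" for u
    proof -
      have "g x u u - g y u u = (\<Sum>i\<in>Basis. \<Sum>j\<in>Basis. (u \<bullet> i) * (u \<bullet> j) * (g x i j - g y i j))"
        using expand[OF x, of u] expand[of y u] elim by (simp add: sum_subtractf algebra_simps)
      also have "\<dots> \<le> (\<Sum>i\<in>Basis. \<Sum>j\<in>Basis. (norm u)\<^sup>2 * \<bar>g y i j - g x i j\<bar>)"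
      proof (intro sum_mono)
        fix i j :: 'e assume ij: "i \<in> Basis" "j \<in> Basis"
        have "\<bar>u \<bullet> i\<bar> * \<bar>u \<bullet> j\<bar> \<le> norm u * norm u"
          using Basis_le_norm[OF ij(1), of u] Basis_le_norm[OF ij(2), of u] by (intro mult_mono) auto
        then have "\<bar>u \<bullet> i\<bar> * \<bar>u \<bullet> j\<bar> * \<bar>g x i j - g y i j\<bar> \<le> (norm u)\<^sup>2 * \<bar>g y i j - g x i j\<bar>"
          unfolding power2_eq_square by (subst abs_minus_commute) (rule mult_right_mono, auto)
        moreover have "(u \<bullet> i) * (u \<bullet> j) * (g x i j - g y i j) \<le> \<bar>u \<bullet> i\<bar> * \<bar>u \<bullet> j\<bar> * \<bar>g x i j - g y i j\<bar>"
          by (metis abs_ge_self abs_mult)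
        ultimately show "(u \<bullet> i) * (u \<bullet> j) * (g x i j - g y i j) \<le> (norm u)\<^sup>2 * \<bar>g y i j - g x i j\<bar>"
          by linarith
      qed
      also have "\<dots> = (norm u)\<^sup>2 * K y" by (simp add: K_def sum_distrib_left)
      also have "\<dots> \<le> (norm u)\<^sup>2 * k" using elim by (intro mult_left_mono) auto
      finally show ?thesis using coer[of u] by (simp add: algebra_simps)
    qed
    note co = this
    have "norm (sharp y a) \<le> (1 / k) * norm a" for a
    proof (cases "sharp y a = 0")
      case False
      have "k * (norm (sharp y a))\<^sup>2 \<le> a \<bullet> sharp y a" using co[of "sharp y a"] g_sharp elim by simp
      also have "\<dots> \<le> norm a * norm (sharp y a)" by (rule norm_cauchy_schwarz)
      finally have "k * norm (sharp y a) \<le> norm a" using False by (simp add: power2_eq_square)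
      then show ?thesis using k by (simp add: field_simps)
    qed (use k in simp)
    then show ?case using elim by simp
  qed
  then show ?thesis using that[of "1 / k"] k by auto
qed

lemma flat_diff: "x \<in> S \<Longrightarrow> (\<lambda>y. flat y u) differentiable at x"
  unfolding flat_def by (intro differentiable_sum) (auto intro!: differentiable_scaleR g_diff)

text \<open>Here \<open>h\<close> is an approximate value of \<open>sharp y a\<close>; it will be the value at a nearby point.\<close>

lemma sharp_minus: "y \<in> S \<Longrightarrow> sharp y a = h - sharp y (flat y h - a)"
  using linear_diff[OF linear_sharp, of y "flat y h" a] by (simp add: sharp_flat)

lemma sharp_tendsto:
  assumes x: "x \<in> S"
  shows "((\<lambda>y. sharp y a) \<longlongrightarrow> sharp x a) (at x)"
proof -
  obtain c where c: "c > 0" "\<forall>\<^sub>F y in at x. y \<in> S \<and> (\<forall>a. norm (sharp y a) \<le> c * norm a)"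
    using sharp_bounded_near[OF x] .
  define h where "h = sharp x a"
  have "((\<lambda>y. flat y h) \<longlongrightarrow> flat x h) (at x)"
    using differentiable_imp_continuous_within[OF flat_diff[OF x]] by (simp add: continuous_within)
  then have "((\<lambda>y. flat y h - a) \<longlongrightarrow> a - a) (at x)"
    by (intro tendsto_diff tendsto_const) (simp add: h_def flat_sharp[OF x])
  then have "((\<lambda>y. c * norm (flat y h - a)) \<longlongrightarrow> 0) (at x)"
    by (intro tendsto_mult_right_zero tendsto_norm_zero) simp
  moreover have "\<forall>\<^sub>F y in at x. norm (sharp y a - h) \<le> c * norm (flat y h - a)"
    using c(2)
  proof eventually_elim
    case (elim y)
    then have "sharp y a - h = - sharp y (flat y h - a)" using sharp_minus[of y a h] by simp
    then show ?case using elim by simp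
  qed
  ultimately have "((\<lambda>y. sharp y a - h) \<longlongrightarrow> 0) (at x)"
    by (rule Lim_null_comparison[rotated])
  then show ?thesis using LIM_zero_iff h_def by blast
qed

text \<open>
  The derivative of an inverse. The error splits into the image under \<open>sharp y\<close> of the error for
  \<open>flat\<close>, and a term that tends to zero by continuity of \<open>sharp\<close>.
\<close>

lemma sharp_has_derivative:
  assumes x: "x \<in> S"
  shows "((\<lambda>y. sharp y a) has_derivative (\<lambda>w. - sharp x (dd (\<lambda>y. flat y (sharp x a)) x w))) (at x)"
proof -
  define h where "h = sharp x a"
  define k where "k y = flat y h" for y
  define Dk where "Dk = dd k x"
  have kx: "k x = a" by (simp add: k_def h_def flat_sharp[OF x])
  have kd: "k differentiable at x" unfolding k_def by (rule flat_diff[OF x])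
  have k': "(k has_derivative Dk) (at x)" unfolding Dk_def by (rule dd_works[OF kd])
  have linDk: "linear Dk" unfolding Dk_def by (rule linear_dd[OF kd])
  obtain c where c: "c > 0" "\<forall>\<^sub>F y in at x. y \<in> S \<and> (\<forall>a. norm (sharp y a) \<le> c * norm a)"
    using sharp_bounded_near[OF x] .
  define E where "E y = c * (norm (k y - k x - Dk (y - x)) / norm (y - x))
     + (\<Sum>i\<in>Basis. norm (sharp y (Dk i) - sharp x (Dk i)))" for y
  have lim0: "((\<lambda>y. norm (k y - k x - Dk (y - x)) / norm (y - x)) \<longlongrightarrow> 0) (at x)"
    using k' by (simp add: has_derivative_iff_norm)
  have "((\<lambda>y. c * (norm (k y - k x - Dk (y - x)) / norm (y - x))
     + (\<Sum>i\<in>Basis. norm (sharp y (Dk i) - sharp x (Dk i)))) \<longlongrightarrow>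
       c * 0 + (\<Sum>i\<in>Basis. norm (sharp x (Dk i) - sharp x (Dk i)))) (at x)"
    by (intro tendsto_intros lim0 sharp_tendsto x)
  then have E0: "(E \<longlongrightarrow> 0) (at x)" by (simp add: E_def[abs_def])
  have evx: "\<forall>\<^sub>F y in at x. y \<noteq> x" by (simp add: eventually_at_filter)
  have "\<forall>\<^sub>F y in at x. norm (norm (sharp y a - sharp x a - (- sharp x (Dk (y - x)))) / norm (y - x)) \<le> E y"
    using c(2) evx
  proof eventually_elim
    case (elim y)
    then have y: "y \<in> S" and ne: "norm (y - x) > 0" by auto
    define r where "r = k y - k x - Dk (y - x)"
    have "sharp y a = h - sharp y (r + Dk (y - x))"
      using sharp_minus[OF y, of a h] by (simp add: k_def[symmetric] r_def kx)
    then have "sharp y a - sharp x a - (- sharp x (Dk (y - x)))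
        = - sharp y r - (sharp y (Dk (y - x)) - sharp x (Dk (y - x)))"
      by (simp add: h_def linear_add[OF linear_sharp[OF y]])
    also have "norm \<dots> \<le> norm (sharp y r) + norm (sharp y (Dk (y - x)) - sharp x (Dk (y - x)))"
      by (metis norm_minus_cancel norm_triangle_ineq4)
    also have "norm (sharp y r) \<le> c * norm r" using elim by blast
    also have "norm (sharp y (Dk (y - x)) - sharp x (Dk (y - x)))
       \<le> (\<Sum>i\<in>Basis. norm (sharp y (Dk i) - sharp x (Dk i))) * norm (y - x)"
    proof -
      have l: "linear (\<lambda>w. sharp y (Dk w) - sharp x (Dk w))"
        using linear_compose[OF linDk linear_sharp[OF y]] linear_compose[OF linDk linear_sharp[OF x]]
        by (intro linear_compose_sub) (auto simp: o_def)
      have "norm (sharp y (Dk (y - x)) - sharp x (Dk (y - x)))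
         = norm (\<Sum>i\<in>Basis. ((y - x) \<bullet> i) *\<^sub>R (sharp y (Dk i) - sharp x (Dk i)))"
        using linear_Basis_expand[OF l, of "y - x"] by simp
      also have "\<dots> \<le> (\<Sum>i\<in>Basis. norm (sharp y (Dk i) - sharp x (Dk i)) * norm (y - x))"
      proof (rule sum_norm_le)
        fix i :: 'e assume i: "i \<in> Basis"
        show "norm (((y - x) \<bullet> i) *\<^sub>R (sharp y (Dk i) - sharp x (Dk i)))
          \<le> norm (sharp y (Dk i) - sharp x (Dk i)) * norm (y - x)"
          using mult_right_mono[OF Basis_le_norm[OF i, of "y - x"] norm_ge_zero[of "sharp y (Dk i) - sharp x (Dk i)"]]
          by (simp add: mult.commute)
      qed
      finally show ?thesis by (simp add: sum_distrib_right)
    qed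
    finally have "norm (sharp y a - sharp x a - (- sharp x (Dk (y - x))))
      \<le> c * norm r + (\<Sum>i\<in>Basis. norm (sharp y (Dk i) - sharp x (Dk i))) * norm (y - x)" by simp
    then have "norm (sharp y a - sharp x a - (- sharp x (Dk (y - x)))) / norm (y - x)
      \<le> (c * norm r + (\<Sum>i\<in>Basis. norm (sharp y (Dk i) - sharp x (Dk i))) * norm (y - x)) / norm (y - x)"
      using ne by (intro divide_right_mono) auto
    also have "\<dots> = E y" using ne by (simp add: E_def r_def add_divide_distrib)
    finally show ?case by simp
  qed
  then have lim: "((\<lambda>y. norm (sharp y a - sharp x a - (- sharp x (Dk (y - x)))) / norm (y - x)) \<longlongrightarrow> 0) (at x)"
    using E0 by (rule Lim_null_comparison)
  have "bounded_linear (\<lambda>w. - sharp x (Dk w))"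
    using linear_compose_neg[OF linear_compose[OF linDk linear_sharp[OF x]]]
    by (simp add: linear_conv_bounded_linear o_def)
  then have "((\<lambda>y. sharp y a) has_derivative (\<lambda>w. - sharp x (Dk w))) (at x)"
    using lim by (simp add: has_derivative_iff_norm)
  then show ?thesis by (simp add: Dk_def k_def[abs_def] h_def)
qed

text \<open>
  By the derivative formula, the derivative of \<open>sharp\<close> is a polynomial in \<open>sharp\<close> and the derivatives of \<open>flat\<close>,
  so each order of differentiability yields the next one.
\<close>

lemma smooth_sharp: "smooth_on S (\<lambda>x. sharp x a)"
proof -
  have "\<forall>a. Ck_on k S (\<lambda>x. sharp x a)" for k
  proof (induction k)
    case 0
    have "isCont (\<lambda>x. sharp x a) x" if "x \<in> S" for a x
      using has_derivative_continuous[OF sharp_has_derivative[OF that]] .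
    then show ?case by (auto intro: continuous_at_imp_continuous_on)
  next
    case (Suc k)
    show ?case
    proof
      fix a
      have 1: "Ck_on k S (\<lambda>y. (sharp y a \<bullet> j) *\<^sub>R dd (\<lambda>z. flat z j) y w)" for j w
      proof (rule Ck_on_bilinear[OF open_S bounded_bilinear_scaleR])
        show "Ck_on k S (\<lambda>y. sharp y a \<bullet> j)"
          by (rule Ck_on_linear_compose[OF open_S bounded_linear_inner_left]) (use Suc in blast)
        have "smooth_on S (\<lambda>z. flat z j)"
          unfolding flat_def
          by (intro smooth_on_sum smooth_on_scaleR smooth smooth_on_const open_S)
        then show "Ck_on k S (\<lambda>y. dd (\<lambda>z. flat z j) y w)"
          using smooth_on_dd unfolding smooth_on_def by blast
      qed
      have expand: "dd (\<lambda>z. flat z u) y w = (\<Sum>j\<in>Basis. (u \<bullet> j) *\<^sub>R dd (\<lambda>z. flat z j) y w)" if "y \<in> S" for u y w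
        by (rule linear_Basis_expand, rule linear_dd_apply[OF open_S that])
          (use linear_flat flat_diff that in auto)
      have 2: "Ck_on k S (\<lambda>y. \<Sum>j\<in>Basis. (sharp y a \<bullet> j) *\<^sub>R dd (\<lambda>z. flat z j) y w)" for w
        by (intro Ck_on_sum[OF open_S] 1)
      have 3: "Ck_on k S (\<lambda>y. \<Sum>b\<in>Basis. ((\<Sum>j\<in>Basis. (sharp y a \<bullet> j) *\<^sub>R dd (\<lambda>z. flat z j) y w) \<bullet> b) *\<^sub>R sharp y b)" for w
        by (intro Ck_on_sum[OF open_S] Ck_on_bilinear[OF open_S bounded_bilinear_scaleR]
            Ck_on_linear_compose[OF open_S bounded_linear_inner_left] 2) (use Suc in blast)
      have 4: "Ck_on k S (\<lambda>y. - (\<Sum>b\<in>Basis. ((\<Sum>j\<in>Basis. (sharp y a \<bullet> j) *\<^sub>R dd (\<lambda>z. flat z j) y w) \<bullet> b) *\<^sub>R sharp y b))" for w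
        by (rule Ck_on_linear_compose[OF open_S bounded_linear_minus[OF bounded_linear_ident] 3])
      have e: "dd (\<lambda>y. sharp y a) y w = - (\<Sum>b\<in>Basis. ((\<Sum>j\<in>Basis. (sharp y a \<bullet> j) *\<^sub>R dd (\<lambda>z. flat z j) y w) \<bullet> b) *\<^sub>R sharp y b)"
        if "y \<in> S" for y w
        unfolding dd_eqI[OF sharp_has_derivative[OF that]] expand[OF that, of "sharp y a", symmetric]
          linear_Basis_expand[OF linear_sharp[OF that], symmetric] ..
      have "Ck_on k S (\<lambda>y. dd (\<lambda>y. sharp y a) y w)" for w
        by (subst Ck_on_cong[OF open_S e]) (auto intro: 4)
      moreover have "(\<lambda>y. sharp y a) differentiable at y" if "y \<in> S" for y
        using sharp_has_derivative[OF that] by (auto simp: differentiable_def)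
      ultimately show "Ck_on (Suc k) S (\<lambda>x. sharp x a)" by simp
    qed
  qed
  then show ?thesis by (simp add: smooth_on_def)
qed

text \<open>The Koszul formula for vector fields with constant components.\<close>

definition koszul :: "'e \<Rightarrow> 'e \<Rightarrow> 'e \<Rightarrow> 'e \<Rightarrow> real" where
  "koszul x u v w = (dd (\<lambda>y. g y v w) x u + dd (\<lambda>y. g y u w) x v - dd (\<lambda>y. g y u v) x w) / 2"

lemma dg_linear:
  assumes "x \<in> S"
  shows "linear (\<lambda>w. dd (\<lambda>y. g y u v) x w)" "linear (\<lambda>u. dd (\<lambda>y. g y u v) x w)" "linear (\<lambda>v. dd (\<lambda>y. g y u v) x w)"
  using linear_dd[OF g_diff[OF assms]] linear_dd_apply[OF open_S assms, of "\<lambda>y u. g y u v"]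
    linear_dd_apply[OF open_S assms, of "\<lambda>y v. g y u v"] g_lin g_diff assms by auto

lemmas dg_simps = linear_add[OF dg_linear(1)] linear_add[OF dg_linear(2)] linear_add[OF dg_linear(3)]
  linear_cmul[OF dg_linear(1)] linear_cmul[OF dg_linear(2)] linear_cmul[OF dg_linear(3)]

lemma dg_sym: "x \<in> S \<Longrightarrow> dd (\<lambda>y. g y u v) x w = dd (\<lambda>y. g y v u) x w"
  using dd_cong_open[OF open_S, of x "\<lambda>y. g y u v" "\<lambda>y. g y v u"] sym by metis

lemma koszul_linear:
  assumes "x \<in> S"
  shows "linear (koszul x u v)" "linear (\<lambda>v. koszul x u v w)" "linear (\<lambda>u. koszul x u v w)"
  by (auto simp: koszul_def linear_iff dg_simps[OF assms] field_simps)

definition Gam :: "'e \<Rightarrow> 'e \<Rightarrow> 'e \<Rightarrow> 'e" where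
  "Gam x u v = sharp x (\<Sum>i\<in>Basis. koszul x u v i *\<^sub>R i)"

lemma g_Gam: "x \<in> S \<Longrightarrow> g x (Gam x u v) w = koszul x u v w"
  using linear_Basis_expand[OF koszul_linear(1), of x u v w]
  by (simp add: Gam_def g_sharp inner_sum_right inner_commute[of _ w] mult.commute)

lemma bilinear_Gam: "x \<in> S \<Longrightarrow> bilinear (Gam x)"
  unfolding bilinear_def
  by (intro conjI allI; rule linearI; rule g_nondegenerate)
    (auto simp: g_Gam gx_simps linear_add[OF koszul_linear(2)] linear_add[OF koszul_linear(3)]
      linear_cmul[OF koszul_linear(2)] linear_cmul[OF koszul_linear(3)])

lemma Gam_sym: "x \<in> S \<Longrightarrow> Gam x u v = Gam x v u"
  by (rule g_nondegenerate) (auto simp: g_Gam koszul_def dg_sym[of x u v])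

lemma dg_Gam: "x \<in> S \<Longrightarrow> dd (\<lambda>y. g y v w) x u = g x (Gam x u v) w + g x v (Gam x u w)"
  using sym[of x v "Gam x u w"] dg_sym[of x w v u] dg_sym[of x u v w] dg_sym[of x u w v]
  by (simp add: g_Gam koszul_def field_simps)

lemma Gam_unique:
  assumes x: "x \<in> S" and s: "\<And>u v. \<Gamma> u v = \<Gamma> v u"
    and m: "\<And>u v w. dd (\<lambda>y. g y v w) x u = g x (\<Gamma> u v) w + g x v (\<Gamma> u w)"
  shows "\<Gamma> = Gam x"
proof (intro ext g_nondegenerate[OF x])
  fix u v w
  have "koszul x u v w = g x (\<Gamma> u v) w"
    using m[of v w u] m[of u w v] m[of u v w] s[of v u] s[of w u] s[of w v]
      sym[OF x, of v "\<Gamma> u w"] sym[OF x, of u "\<Gamma> v w"]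
    by (simp add: koszul_def)
  then show "g x (\<Gamma> u v) w = g x (Gam x u v) w" by (simp add: g_Gam x)
qed

lemma chris_eq: "x \<in> S \<Longrightarrow> chris g x = Gam x"
  unfolding chris_def
  by (rule the_equality) (use bilinear_Gam Gam_sym dg_Gam Gam_unique in blast)+

lemma smooth_Gam: "smooth_on S (\<lambda>x. Gam x u v)"
  unfolding Gam_def
proof (rule smooth_on_apply_linear[OF open_S linear_sharp smooth_sharp])
  show "smooth_on S (\<lambda>y. \<Sum>i\<in>Basis. koszul y u v i *\<^sub>R i)"
    unfolding koszul_def divide_inverse
    by (intro smooth_on_sum smooth_on_scaleR smooth_on_const smooth_on_mult smooth_on_diff smooth_on_add
        smooth_on_dd smooth open_S)
qed

lemma Gam_diff: "x \<in> S \<Longrightarrow> (\<lambda>y. Gam y u v) differentiable at x"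
  using smooth_Gam smooth_on_differentiable by blast

lemma Gam_simps:
  assumes "x \<in> S"
  shows "Gam x (u + v) w = Gam x u w + Gam x v w" "Gam x u (v + w) = Gam x u v + Gam x u w"
    "Gam x (c *\<^sub>R u) w = c *\<^sub>R Gam x u w" "Gam x u (c *\<^sub>R w) = c *\<^sub>R Gam x u w"
    "Gam x (u - v) w = Gam x u w - Gam x v w" "Gam x u (v - w) = Gam x u v - Gam x u w"
    "Gam x (- u) w = - Gam x u w" "Gam x u (- w) = - Gam x u w" "Gam x 0 w = 0" "Gam x u 0 = 0"
  using bilinear_Gam[OF assms] by (auto simp: bilinear_ladd bilinear_radd bilinear_lmul bilinear_rmul
      bilinear_lsub bilinear_rsub bilinear_lneg bilinear_rneg bilinear_lzero bilinear_rzero)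

lemma has_derivative_g:
  assumes x: "x \<in> S" and "X differentiable at x" "Y differentiable at x"
  shows "((\<lambda>y. g y (X y) (Y y)) has_derivative (\<lambda>w. g x (Gam x w (X x)) (Y x) + g x (X x) (Gam x w (Y x))
     + g x (dd X x w) (Y x) + g x (X x) (dd Y x w))) (at x)"
  using has_derivative_apply_bilinear[OF open_S x bil g_diff[OF x] assms(2,3)]
  by (simp add: dg_Gam[OF x])

lemma has_derivative_Gam:
  assumes x: "x \<in> S" and "X differentiable at x" "Y differentiable at x"
  shows "((\<lambda>y. Gam y (X y) (Y y)) has_derivative (\<lambda>w. dd (\<lambda>y. Gam y (X x) (Y x)) x w
     + Gam x (dd X x w) (Y x) + Gam x (X x) (dd Y x w))) (at x)"
  using has_derivative_apply_bilinear[OF open_S x bilinear_Gam Gam_diff[OF x] assms(2,3)] by simp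

abbreviation DGam :: "'e \<Rightarrow> 'e \<Rightarrow> 'e \<Rightarrow> 'e \<Rightarrow> 'e" where
  "DGam x t u v \<equiv> dd (\<lambda>y. Gam y u v) x t"

lemma DGam_linear:
  assumes "x \<in> S"
  shows "linear (\<lambda>w. DGam x w u v)" "linear (\<lambda>u. DGam x w u v)" "linear (\<lambda>v. DGam x w u v)"
  using linear_dd[OF Gam_diff[OF assms]] linear_dd_apply[OF open_S assms, of "\<lambda>y u. Gam y u v"]
    linear_dd_apply[OF open_S assms, of "\<lambda>y v. Gam y u v"] bilinear_Gam Gam_diff assms
  by (auto simp: bilinear_def)

lemma DGam_sym: "x \<in> S \<Longrightarrow> DGam x w u v = DGam x w v u"
  using dd_cong_open[OF open_S, of x "\<lambda>y. Gam y u v" "\<lambda>y. Gam y v u"] Gam_sym by metis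

definition Rm :: "'e \<Rightarrow> 'e \<Rightarrow> 'e \<Rightarrow> 'e \<Rightarrow> 'e" where
  "Rm x u v w = DGam x u v w - DGam x v u w + Gam x u (Gam x v w) - Gam x v (Gam x u w)"

definition R4 :: "'e \<Rightarrow> 'e \<Rightarrow> 'e \<Rightarrow> 'e \<Rightarrow> 'e \<Rightarrow> real" where
  "R4 x u v z t = g x (Rm x u v z) t"

lemmas DGam_add = linear_add[OF DGam_linear(1)] linear_add[OF DGam_linear(2)] linear_add[OF DGam_linear(3)]
lemmas DGam_cmul = linear_cmul[OF DGam_linear(1)] linear_cmul[OF DGam_linear(2)] linear_cmul[OF DGam_linear(3)]

lemma Rm_skew: "Rm x u v w = - Rm x v u w"
  by (simp add: Rm_def)

lemma Rm_cyclic: "x \<in> S \<Longrightarrow> Rm x u v w + Rm x v w u + Rm x w u v = 0"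
  by (simp add: Rm_def Gam_sym[of x v u] Gam_sym[of x w u] Gam_sym[of x w v]
      DGam_sym[of x v u] DGam_sym[of x w u] DGam_sym[of x w v])

lemma dd_Gam_Gam:
  assumes x: "x \<in> S"
  shows "((\<lambda>y. Gam y u (Gam y v w)) has_derivative
    (\<lambda>t. DGam x t u (Gam x v w) + Gam x u (DGam x t v w))) (at x)"
  using has_derivative_Gam[OF x differentiable_const Gam_diff[OF x], of u v w] by (simp add: Gam_simps[OF x])

text \<open>The second derivatives of the function \<open>g z t\<close> commute.\<close>

lemma R4_skew_right:
  assumes x: "x \<in> S"
  shows "R4 x u v z t = - R4 x u v t z"
proof -
  define f where "f y = g y z t" for y
  have "smooth_on S f" unfolding f_def by (rule smooth)
  then have "Ck_on 2 S f" by (simp add: smooth_on_def)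
  from dd_symmetric_real[OF open_S x this]
  have sym2: "dd (\<lambda>y. dd f y v) x u = dd (\<lambda>y. dd f y u) x v" .
  have e: "dd (\<lambda>y. dd f y v) x u =
       g x (Gam x u (Gam x v z)) t + g x (Gam x v z) (Gam x u t) + g x (DGam x u v z) t
     + (g x (Gam x u z) (Gam x v t) + g x z (Gam x u (Gam x v t)) + g x z (DGam x u v t))" for u v
  proof -
    have e1: "dd (\<lambda>y. dd f y v) x = dd (\<lambda>y. g y (Gam y v z) t + g y z (Gam y v t)) x"
      by (rule dd_cong_open[OF open_S x]) (simp add: f_def[abs_def] dg_Gam)
    have d: "((\<lambda>y. g y (Gam y v z) t + g y z (Gam y v t)) has_derivative
      (\<lambda>w. (g x (Gam x w (Gam x v z)) t + g x (Gam x v z) (Gam x w t) + g x (DGam x w v z) t + g x (Gam x v z) 0)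
        + (g x (Gam x w z) (Gam x v t) + g x z (Gam x w (Gam x v t)) + g x 0 (Gam x v t) + g x z (DGam x w v t)))) (at x)"
      using has_derivative_g[OF x Gam_diff[OF x] differentiable_const, of v z t]
        has_derivative_g[OF x differentiable_const Gam_diff[OF x], of z v t]
      by (intro has_derivative_add) simp_all
    show ?thesis unfolding e1 dd_eqI[OF d] by (simp add: gx_simps[OF x])
  qed
  show ?thesis
    using sym2 sym[OF x, of z] unfolding e R4_def Rm_def by (simp add: gx_simps[OF x])
qed

lemma R4_curv_like:
  assumes x: "x \<in> S"
  shows "linear (R4 x u v z)" "R4 x u v z t = - R4 x v u z t"
    "R4 x u v z t + R4 x v z u t + R4 x z u v t = 0"
proof -
  show "linear (R4 x u v z)" using g_lin[OF x] by (simp add: R4_def[abs_def])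
  show "R4 x u v z t = - R4 x v u z t" unfolding R4_def by (subst Rm_skew) (simp add: gx_simps[OF x])
  show "R4 x u v z t + R4 x v z u t + R4 x z u v t = 0"
    unfolding R4_def gx_simps(1)[OF x, symmetric] Rm_cyclic[OF x] by (simp add: gx_simps[OF x])
qed

lemma curv_like_R4: "x \<in> S \<Longrightarrow> curv_like (R4 x)"
  unfolding curv_like_def
  by (intro conjI allI; rule R4_curv_like R4_skew_right; assumption)

lemma smooth_Gam_Gam: "smooth_on S (\<lambda>y. Gam y u (Gam y v w))"
  by (rule smooth_on_apply_linear[OF open_S _ smooth_Gam smooth_Gam])
    (use bilinear_Gam in \<open>auto simp: bilinear_def\<close>)

lemma smooth_Rm: "smooth_on S (\<lambda>x. Rm x u v w)"
  unfolding Rm_def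
  by (intro smooth_on_diff smooth_on_add smooth_on_dd smooth_Gam smooth_Gam_Gam open_S)

lemma smooth_R4: "smooth_on S (\<lambda>x. R4 x u v z t)"
  unfolding R4_def
  by (rule smooth_on_apply_linear[OF open_S g_lin(2) smooth smooth_Rm])

lemma dd_Rm:
  assumes x: "x \<in> S"
  shows "dd (\<lambda>y. Rm y u v z) x w = dd (\<lambda>y. DGam y u v z) x w - dd (\<lambda>y. DGam y v u z) x w
     + (DGam x w u (Gam x v z) + Gam x u (DGam x w v z)) - (DGam x w v (Gam x u z) + Gam x v (DGam x w u z))"
proof -
  have d: "((\<lambda>y. DGam y u v z) has_derivative (\<lambda>w. dd (\<lambda>y. DGam y u v z) x w)) (at x)" for u v
    by (rule dd_works) (rule smooth_on_differentiable[OF smooth_on_dd[OF smooth_Gam] x])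
  have "((\<lambda>y. Rm y u v z) has_derivative (\<lambda>w. dd (\<lambda>y. DGam y u v z) x w - dd (\<lambda>y. DGam y v u z) x w
     + (DGam x w u (Gam x v z) + Gam x u (DGam x w v z)) - (DGam x w v (Gam x u z) + Gam x v (DGam x w u z)))) (at x)"
    unfolding Rm_def by (intro has_derivative_diff has_derivative_add d dd_Gam_Gam x)
  then show ?thesis by (simp add: dd_eqI)
qed

text \<open>
  The derivatives of \<open>Gam\<close> of second order cancel by symmetry. The terms of the covariant derivative in which
  the connection acts on the first two arguments of \<open>Rm\<close> would cancel in the cyclic sum, and are left out.
\<close>

lemma second_bianchi_Rm:
  assumes x: "x \<in> S"
  shows "dd (\<lambda>y. Rm y u v z) x w + Gam x w (Rm x u v z) - Rm x u v (Gam x w z)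
    + (dd (\<lambda>y. Rm y v w z) x u + Gam x u (Rm x v w z) - Rm x v w (Gam x u z))
    + (dd (\<lambda>y. Rm y w u z) x v + Gam x v (Rm x w u z) - Rm x w u (Gam x v z)) = 0"
proof -
  have s: "dd (\<lambda>y. DGam y u v z) x w = dd (\<lambda>y. DGam y w v z) x u"
    "dd (\<lambda>y. DGam y v w z) x u = dd (\<lambda>y. DGam y u w z) x v"
    "dd (\<lambda>y. DGam y w u z) x v = dd (\<lambda>y. DGam y v u z) x w"
    by (rule dd_symmetric[OF open_S x smooth_Gam])+
  show ?thesis
    unfolding dd_Rm[OF x] s unfolding Rm_def
    by (simp add: Gam_simps[OF x] algebra_simps)
qed

lemma second_bianchi:
  assumes x: "x \<in> S"
  shows "(dd (\<lambda>y. R4 y u v z t) x w - R4 x u v (Gam x w z) t - R4 x u v z (Gam x w t))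
    + (dd (\<lambda>y. R4 y v w z t) x u - R4 x v w (Gam x u z) t - R4 x v w z (Gam x u t))
    + (dd (\<lambda>y. R4 y w u z t) x v - R4 x w u (Gam x v z) t - R4 x w u z (Gam x v t)) = 0"
proof -
  have e: "dd (\<lambda>y. R4 y u v z t) x w - R4 x u v (Gam x w z) t - R4 x u v z (Gam x w t)
     = g x (dd (\<lambda>y. Rm y u v z) x w + Gam x w (Rm x u v z) - Rm x u v (Gam x w z)) t" for u v w
  proof -
    have "dd (\<lambda>y. R4 y u v z t) x w = g x (Gam x w (Rm x u v z)) t + g x (Rm x u v z) (Gam x w t)
      + g x (dd (\<lambda>y. Rm y u v z) x w) t + g x (Rm x u v z) 0"
      using dd_eqI[OF has_derivative_g[OF x smooth_on_differentiable[OF smooth_Rm x] differentiable_const, of u v z t]]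
      by (simp add: R4_def)
    then show ?thesis by (simp add: R4_def gx_simps[OF x])
  qed
  show ?thesis
    unfolding e gx_simps(1)[OF x, symmetric] second_bianchi_Rm[OF x] by (simp add: gx_simps[OF x])
qed

end

section \<open>Hermitian geometry in a chart\<close>

text \<open>
  A Hermitian metric in coordinates. The condition \<open>integrable\<close> is the Nijenhuis tensor on vector
  fields with constant components.
\<close>

locale hermitian_chart = riemannian_chart +
  fixes J :: "'a \<Rightarrow> 'a \<Rightarrow> 'a" and \<nu> :: "'a \<Rightarrow> real"
  assumes J_lin: "x \<in> S \<Longrightarrow> linear (J x)" and J_sq: "x \<in> S \<Longrightarrow> J x (J x u) = - u"
    and J_isom: "x \<in> S \<Longrightarrow> g x (J x u) (J x v) = g x u v" and J_smooth: "smooth_on S (\<lambda>x. J x u)"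
    and integrable: "x \<in> S \<Longrightarrow> dd (\<lambda>y. J y v) x (J x u) - dd (\<lambda>y. J y u) x (J x v)
       + J x (dd (\<lambda>y. J y u) x v) - J x (dd (\<lambda>y. J y v) x u) = 0"
    and antiholomorphic: "x \<in> S \<Longrightarrow> g x (J x u) v = 0 \<Longrightarrow>
       R4 x u v v u = \<nu> x * (g x u u * g x v v - (g x u v)\<^sup>2)"
    and dim: "DIM('a) \<ge> 6"
begin

lemma hermitian_form_at: "x \<in> S \<Longrightarrow> hermitian_form (g x) (J x)"
  by (intro hermitian_form.intro bil sym pos J_lin J_sq J_isom)

definition om :: "'a \<Rightarrow> 'a \<Rightarrow> 'a \<Rightarrow> real" where "om x = hermitian_form.om (g x) (J x)"

lemma om_eq: "x \<in> S \<Longrightarrow> om x u v = g x (J x u) v"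
  unfolding om_def by (rule hermitian_form.om_def[OF hermitian_form_at])

lemma Jx_simps:
  assumes "x \<in> S"
  shows "J x (u + v) = J x u + J x v" "J x (c *\<^sub>R u) = c *\<^sub>R J x u" "J x (u - v) = J x u - J x v"
    "J x (- u) = - J x u" "J x 0 = 0"
  using J_lin[OF assms] by (auto simp: linear_add linear_cmul linear_diff linear_neg linear_0)

lemma J_diff: "x \<in> S \<Longrightarrow> (\<lambda>y. J y u) differentiable at x"
  using J_smooth smooth_on_differentiable by blast

abbreviation DJ where "DJ x w v \<equiv> dd (\<lambda>y. J y v) x w"

lemma DJ_linear: "x \<in> S \<Longrightarrow> linear (\<lambda>w. DJ x w v)" "x \<in> S \<Longrightarrow> linear (\<lambda>v. DJ x w v)"
  using linear_dd[OF J_diff] linear_dd_apply[OF open_S, of x J] J_lin J_diff by auto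

text \<open>The two-form \<open>\<sigma>\<close> of \<open>curv_like_decomposition\<close>, as a function of the point.\<close>

definition sg :: "'a \<Rightarrow> 'a \<Rightarrow> 'a \<Rightarrow> real" where
  "sg x = (SOME \<sigma>. bilinear \<sigma> \<and> (\<forall>u v. \<sigma> u v = - \<sigma> v u) \<and>
     (\<forall>u v z t. R4 x u v z t = \<nu> x * Pi4 (g x) u v z t - Phi4 (om x) \<sigma> u v z t / 6))"

lemma sg_properties:
  assumes x: "x \<in> S"
  shows "bilinear (sg x)" "sg x u v = - sg x v u"
    "R4 x u v z t = \<nu> x * Pi4 (g x) u v z t - Phi4 (om x) (sg x) u v z t / 6"
proof -
  interpret H: hermitian_form "g x" "J x" by (rule hermitian_form_at[OF x])
  have K: "R4 x u v v u = \<nu> x * Pi4 (g x) u v v u" if "H.om u v = 0" for u v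
    using antiholomorphic[OF x, of u v] that sym[OF x, of v u]
    by (simp add: H.om_def Pi4_def power2_eq_square mult.commute)
  obtain \<sigma> where "bilinear \<sigma>" "\<And>u v. \<sigma> u v = - \<sigma> v u"
    "\<And>u v z t. R4 x u v z t = \<nu> x * Pi4 (g x) u v z t - Phi4 H.om \<sigma> u v z t / 6"
    using H.curv_like_decomposition[OF curv_like_R4[OF x] K] by metis
  then have "\<exists>\<sigma>. bilinear \<sigma> \<and> (\<forall>u v. \<sigma> u v = - \<sigma> v u) \<and>
     (\<forall>u v z t. R4 x u v z t = \<nu> x * Pi4 (g x) u v z t - Phi4 (om x) \<sigma> u v z t / 6)"
    unfolding om_def by blast
  from someI_ex[OF this]
  show "bilinear (sg x)" "sg x u v = - sg x v u"
    "R4 x u v z t = \<nu> x * Pi4 (g x) u v z t - Phi4 (om x) (sg x) u v z t / 6"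
    unfolding sg_def[symmetric] by blast+
qed

lemmas sgx_simps = bilinear_simps[OF sg_properties(1)]

lemma om_properties:
  assumes x: "x \<in> S"
  shows "bilinear (om x)" "om x u v = - om x v u" "om x u (J x u) = g x u u" "om x u u = 0"
proof -
  interpret H: hermitian_form "g x" "J x" by (rule hermitian_form_at[OF x])
  show "bilinear (om x)" "om x u v = - om x v u" "om x u (J x u) = g x u u" "om x u u = 0"
    unfolding om_def using H.bil_om H.om_skew[of u v] H.om_J_self by auto
qed

lemmas omx_simps = bilinear_simps[OF om_properties(1)]

lemma sectional_value:
  assumes x: "x \<in> S"
  shows "R4 x u v v u = \<nu> x * (g x u u * g x v v - (g x u v)\<^sup>2) + om x u v * sg x u v"
  using sg_properties(2)[OF x, of v u] om_properties(2)[OF x, of v u] sg_properties(2)[OF x, of v v]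
    om_properties(4)[OF x] sym[OF x, of v u]
  unfolding sg_properties(3)[OF x] Pi4_def Phi4_def by (simp add: power2_eq_square algebra_simps)

lemma smooth_om: "smooth_on S (\<lambda>x. om x u v)"
proof -
  have "smooth_on S (\<lambda>x. g x (J x u) v)"
    by (rule smooth_on_apply_linear[OF open_S g_lin(2) smooth J_smooth])
  then show ?thesis by (subst smooth_on_cong[OF open_S om_eq]) auto
qed

text \<open>Near each point, \<open>\<nu>\<close> is a quotient of smooth functions: the second basis vector of an
  antiholomorphic plane is corrected along a fixed vector to keep it antiholomorphic.\<close>

lemma smooth_nu: "smooth_on S \<nu>"
proof (rule smooth_on_local)
  fix p assume p: "p \<in> S"
  interpret H: hermitian_form "g p" "J p" by (rule hermitian_form_at[OF p])
  obtain u :: 'a where u: "u \<in> Basis" using nonempty_Basis by blast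
  then have u0: "u \<noteq> 0" by auto
  have "card {u, J p u} < DIM('a)" using dim card_two_le[of u "J p u"] by linarith
  then obtain v where v: "v \<noteq> 0" "\<And>b. b \<in> {u, J p u} \<Longrightarrow> g p b v = 0"
    using H.common_orthogonal_vector[of "{u, J p u}"] by auto
  define v' where "v' = J p u"
  define t where "t y = - om y u v / om y u v'" for y
  define N0 where "N0 = {y \<in> S. om y u v' \<noteq> 0}"
  have N0: "open N0" "N0 \<subseteq> S" unfolding N0_def using open_nonzero_set[OF open_S smooth_om] by auto
  have pN0: "p \<in> N0"
    using p u0 om_properties(3)[OF p, of u] pos[OF p u0] by (simp add: N0_def v'_def)
  have tp: "t p = 0" using v(2) om_eq[OF p] by (simp add: t_def)
  define n where "n y = R4 y u v v u + t y * (R4 y u v v' u + R4 y u v' v u) + t y * t y * R4 y u v' v' u" for y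
  define d where "d y = g y u u * (g y v v + 2 * t y * g y v v' + t y * t y * g y v' v')
     - (g y u v + t y * g y u v') * (g y u v + t y * g y u v')" for y
  have st: "smooth_on N0 t"
    unfolding t_def by (intro smooth_on_divide smooth_on_minus N0(1) smooth_on_subset[OF smooth_om N0(2)])
      (simp add: N0_def)
  note sm = N0(1) st smooth_on_subset[OF smooth_R4 N0(2)] smooth_on_subset[OF smooth N0(2)] smooth_on_const
  have sn: "smooth_on N0 n" unfolding n_def by (intro smooth_on_add smooth_on_mult sm)
  have sd: "smooth_on N0 d" unfolding d_def by (intro smooth_on_add smooth_on_diff smooth_on_mult sm)
  have nd: "n y = \<nu> y * d y" if "y \<in> N0" for y
  proof -
    have y: "y \<in> S" "om y u v' \<noteq> 0" using that by (auto simp: N0_def)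
    have "om y u (v + t y *\<^sub>R v') = 0" using y by (simp add: omx_simps t_def)
    then have "R4 y u (v + t y *\<^sub>R v') (v + t y *\<^sub>R v') u
      = \<nu> y * (g y u u * g y (v + t y *\<^sub>R v') (v + t y *\<^sub>R v') - (g y u (v + t y *\<^sub>R v'))\<^sup>2)"
      using antiholomorphic[OF y(1)] om_eq[OF y(1)] by simp
    then show ?thesis
      using sym[OF y(1), of v' v]
      by (simp add: n_def d_def curv_like_simps[OF curv_like_R4[OF y(1)]] gx_simps[OF y(1)]
          power2_eq_square algebra_simps)
  qed
  define N where "N = {y \<in> N0. d y \<noteq> 0}"
  have N: "open N" "N \<subseteq> N0" unfolding N_def using open_nonzero_set[OF N0(1) sd] by auto
  have "d p = g p u u * g p v v" using v(2) tp by (simp add: d_def)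
  then have "p \<in> N" using pN0 pos[OF p u0] pos[OF p v(1)] by (simp add: N_def)
  moreover have "smooth_on N (\<lambda>y. n y / d y)"
    by (intro smooth_on_divide N smooth_on_subset[OF sn N(2)] smooth_on_subset[OF sd N(2)]) (simp add: N_def)
  then have "smooth_on N \<nu>"
    by (subst (asm) smooth_on_cong[OF N(1), of _ \<nu>]) (auto simp: N_def nd)
  ultimately show "\<exists>N. open N \<and> p \<in> N \<and> smooth_on N \<nu>" using N by blast
qed

text \<open>
  Where \<open>om u v \<noteq> 0\<close> the value of \<open>\<sigma>\<close> is a quotient of smooth functions; otherwise \<open>v\<close> is a
  difference of two vectors with this property.
\<close>

lemma smooth_sg: "smooth_on S (\<lambda>x. sg x u v)"
proof (rule smooth_on_local)
  fix p assume p: "p \<in> S"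
  have *: "\<exists>N. open N \<and> p \<in> N \<and> N \<subseteq> S \<and> smooth_on N (\<lambda>x. sg x u v)" if "om p u v \<noteq> 0" for u v
  proof -
    define N where "N = {y \<in> S. om y u v \<noteq> 0}"
    have N: "open N" "N \<subseteq> S" "p \<in> N"
      unfolding N_def using open_nonzero_set[OF open_S smooth_om] that p by auto
    have "smooth_on N (\<lambda>x. (R4 x u v v u - \<nu> x * (g x u u * g x v v - g x u v * g x u v)) / om x u v)"
      by (intro smooth_on_divide smooth_on_diff smooth_on_mult N(1) smooth_on_subset[OF smooth_R4 N(2)]
          smooth_on_subset[OF smooth N(2)] smooth_on_subset[OF smooth_nu N(2)] smooth_on_subset[OF smooth_om N(2)])
        (simp add: N_def)
    moreover have "sg x u v = (R4 x u v v u - \<nu> x * (g x u u * g x v v - g x u v * g x u v)) / om x u v"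
      if "x \<in> N" for x
      using sectional_value[of x u v] that by (simp add: N_def power2_eq_square)
    ultimately have "smooth_on N (\<lambda>x. sg x u v)" by (subst smooth_on_cong[OF N(1)]) auto
    then show ?thesis using N by blast
  qed
  show "\<exists>N. open N \<and> p \<in> N \<and> smooth_on N (\<lambda>x. sg x u v)"
  proof (cases "om p u v = 0")
    case False
    then show ?thesis using * by blast
  next
    case om0: True
    show ?thesis
    proof (cases "u = 0")
      case True
      have "smooth_on S (\<lambda>x. sg x u v)"
        by (subst smooth_on_cong[OF open_S, of _ "\<lambda>x. 0"]) (auto simp: True sgx_simps smooth_on_const)
      then show ?thesis using open_S p by blast
    next
      case False
      define v' where "v' = J p u"
      have "om p u v' \<noteq> 0" using om_properties(3)[OF p, of u] pos[OF p False] by (simp add: v'_def)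
      moreover from this have "om p u (v + v') \<noteq> 0" using om0 by (simp add: omx_simps[OF p])
      ultimately obtain N1 N2 where N: "open N1" "p \<in> N1" "N1 \<subseteq> S" "smooth_on N1 (\<lambda>x. sg x u v')"
        "open N2" "p \<in> N2" "smooth_on N2 (\<lambda>x. sg x u (v + v'))"
        using *[of u v'] *[of u "v + v'"] by metis
      have "smooth_on (N1 \<inter> N2) (\<lambda>x. sg x u (v + v') - sg x u v')"
        using N by (intro smooth_on_diff) (auto intro: smooth_on_subset)
      then have "smooth_on (N1 \<inter> N2) (\<lambda>x. sg x u v)"
        by (subst smooth_on_cong[of _ _ "\<lambda>x. sg x u (v + v') - sg x u v'"]) (use N in \<open>auto simp: sgx_simps\<close>)
      then show ?thesis using N by blast
    qed
  qed
qed

definition nabla_J :: "'a \<Rightarrow> 'a \<Rightarrow> 'a \<Rightarrow> 'a" where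
  "nabla_J x w v = DJ x w v + Gam x w (J x v) - J x (Gam x w v)"

definition nabla_om :: "'a \<Rightarrow> 'a \<Rightarrow> 'a \<Rightarrow> 'a \<Rightarrow> real" where "nabla_om x w u v = g x (nabla_J x w u) v"

definition nabla_sg :: "'a \<Rightarrow> 'a \<Rightarrow> 'a \<Rightarrow> 'a \<Rightarrow> real" where
  "nabla_sg x w u v = dd (\<lambda>y. sg y u v) x w - sg x (Gam x w u) v - sg x u (Gam x w v)"

lemma om_diff: "x \<in> S \<Longrightarrow> (\<lambda>y. om y u v) differentiable at x"
  and sg_diff: "x \<in> S \<Longrightarrow> (\<lambda>y. sg y u v) differentiable at x"
  and nu_diff: "x \<in> S \<Longrightarrow> \<nu> differentiable at x"
  using smooth_om smooth_sg smooth_nu smooth_on_differentiable by blast+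

lemma d_om:
  assumes x: "x \<in> S"
  shows "dd (\<lambda>y. om y u v) x w = nabla_om x w u v + om x (Gam x w u) v + om x u (Gam x w v)"
proof -
  have "dd (\<lambda>y. om y u v) x = dd (\<lambda>y. g y (J y u) v) x"
    by (rule dd_cong_open[OF open_S x]) (simp add: om_eq)
  then show ?thesis
    using dd_eqI[OF has_derivative_g[OF x J_diff[OF x] differentiable_const, of u v]]
    by (simp add: nabla_om_def nabla_J_def om_eq[OF x] gx_simps[OF x])
qed

lemma d_sg: "dd (\<lambda>y. sg y u v) x w = nabla_sg x w u v + sg x (Gam x w u) v + sg x u (Gam x w v)"
  by (simp add: nabla_sg_def)

lemma bilinear_nabla_J:
  assumes x: "x \<in> S"
  shows "bilinear (nabla_J x)"
  unfolding bilinear_def nabla_J_def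
  by (auto simp: linear_iff Gam_simps[OF x] Jx_simps[OF x] linear_add[OF DJ_linear(1)[OF x]]
      linear_add[OF DJ_linear(2)[OF x]] linear_cmul[OF DJ_linear(1)[OF x]] linear_cmul[OF DJ_linear(2)[OF x]]
      algebra_simps)

lemma nabla_J_skew:
  assumes x: "x \<in> S"
  shows "g x (nabla_J x w u) v = - g x u (nabla_J x w v)"
proof -
  have e: "dd (\<lambda>y. om y v u) x = dd (\<lambda>y. - om y u v) x"
    by (rule dd_cong_open[OF open_S x]) (simp add: om_properties(2)[of _ v u])
  have "dd (\<lambda>y. om y v u) x w = - dd (\<lambda>y. om y u v) x w"
    unfolding e by (simp add: dd_eqI[OF has_derivative_minus[OF dd_works[OF om_diff[OF x]]]])
  then have "nabla_om x w v u = - nabla_om x w u v"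
    unfolding d_om[OF x]
    using om_properties(2)[OF x, of v "Gam x w u"] om_properties(2)[OF x, of "Gam x w v" u] by simp
  then show ?thesis using sym[OF x, of u] by (simp add: nabla_om_def)
qed

lemma nabla_J_anticommutes:
  assumes x: "x \<in> S"
  shows "nabla_J x w (J x v) = - J x (nabla_J x w v)"
proof -
  have "dd (\<lambda>y. J y (J y v)) x w = DJ x w (J x v) + J x (DJ x w v)"
    using dd_eqI[OF has_derivative_apply_linear[OF open_S x J_lin J_diff[OF x] J_diff[OF x]], of v] by simp
  moreover have "dd (\<lambda>y. J y (J y v)) x = dd (\<lambda>y. - v) x"
    by (rule dd_cong_open[OF open_S x]) (simp add: J_sq)
  ultimately have "DJ x w (J x v) = - J x (DJ x w v)" by (simp add: eq_neg_iff_add_eq_0)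
  then show ?thesis
    by (simp add: nabla_J_def J_sq[OF x] Jx_simps[OF x] Gam_simps[OF x])
qed

text \<open>
  The integrability condition says that \<open>g (nabla_J (J u) v - J (nabla_J u v)) w\<close> is symmetric in \<open>u\<close> and \<open>v\<close>.
  It is skew in \<open>v\<close> and \<open>w\<close> too, hence zero.
\<close>

lemma nabla_J_left_J:
  assumes x: "x \<in> S"
  shows "nabla_J x (J x u) v = J x (nabla_J x u v)"
proof -
  define B where "B u v w = g x (nabla_J x (J x u) v - J x (nabla_J x u v)) w" for u v w
  have "nabla_J x (J x u) v - J x (nabla_J x u v) = nabla_J x (J x v) u - J x (nabla_J x v u)" for u v
    using integrable[OF x, of v u] Gam_sym[OF x, of "J x u" v] Gam_sym[OF x, of u "J x v"]
      Gam_sym[OF x, of "J x u" "J x v"] Gam_sym[OF x, of u v]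
    by (simp add: nabla_J_def Jx_simps[OF x] J_sq[OF x] algebra_simps)
  then have sy: "B u v w = B v u w" for u v w by (simp add: B_def)
  have gJ: "g x (J x a) b = - g x a (J x b)" for a b
    using om_properties(2)[OF x, of a b] sym[OF x, of a] by (simp add: om_eq[OF x])
  have sk: "B u v w = - B u w v" for u v w
    using nabla_J_skew[OF x, of "J x u" v w] nabla_J_skew[OF x, of u v "J x w"] nabla_J_anticommutes[OF x, of u w]
      gJ[of "nabla_J x u v" w] sym[OF x, of v]
    by (simp add: B_def gx_simps[OF x])
  have "B u v w = 0" for u v w
    using sy[of u v w] sk[of v u w] sy[of v w u] sk[of w v u] sy[of w u v] sk[of u w v] by linarith
  then have "nabla_J x (J x u) v - J x (nabla_J x u v) = 0"
    by (intro g_nondegenerate[OF x]) (simp add: B_def gx_simps[OF x])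
  then show ?thesis by simp
qed

lemma nabla_R4:
  assumes x: "x \<in> S"
  shows "dd (\<lambda>y. R4 y u v z t) x w =
      dd \<nu> x w * Pi4 (g x) u v z t - (Phi4 (nabla_om x w) (sg x) u v z t + Phi4 (om x) (nabla_sg x w) u v z t) / 6
      + R4 x (Gam x w u) v z t + R4 x u (Gam x w v) z t + R4 x u v (Gam x w z) t + R4 x u v z (Gam x w t)"
proof -
  have g': "((\<lambda>y. g y a b) has_derivative (\<lambda>w. g x (Gam x w a) b + g x a (Gam x w b))) (at x)" for a b
    using dd_works[OF g_diff[OF x]] dg_Gam[OF x, abs_def] by (metis (no_types, lifting) ext)
  have om': "((\<lambda>y. om y a b) has_derivative (\<lambda>w. nabla_om x w a b + om x (Gam x w a) b + om x a (Gam x w b))) (at x)" for a b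
    using dd_works[OF om_diff[OF x]] d_om[OF x] by (metis (no_types, lifting) ext)
  have sg': "((\<lambda>y. sg y a b) has_derivative (\<lambda>w. nabla_sg x w a b + sg x (Gam x w a) b + sg x a (Gam x w b))) (at x)" for a b
    using dd_works[OF sg_diff[OF x]] d_sg by (metis (no_types, lifting) ext)
  note nu' = dd_works[OF nu_diff[OF x]]
  have e: "dd (\<lambda>y. R4 y u v z t) x = dd (\<lambda>y. \<nu> y * Pi4 (g y) u v z t - (1/6) * Phi4 (om y) (sg y) u v z t) x"
    by (rule dd_cong_open[OF open_S x]) (simp add: sg_properties(3))
  have d: "((\<lambda>y. \<nu> y * Pi4 (g y) u v z t - (1/6) * Phi4 (om y) (sg y) u v z t) has_derivative
    (\<lambda>w. dd \<nu> x w * Pi4 (g x) u v z t - (Phi4 (nabla_om x w) (sg x) u v z t + Phi4 (om x) (nabla_sg x w) u v z t) / 6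
      + R4 x (Gam x w u) v z t + R4 x u (Gam x w v) z t + R4 x u v (Gam x w z) t + R4 x u v z (Gam x w t))) (at x)"
    unfolding Pi4_def Phi4_def sg_properties(3)[OF x]
    by (rule has_derivative_eq_rhs, (rule has_derivative_diff has_derivative_add has_derivative_mult
          has_derivative_const g' om' sg' nu')+)
      (simp add: fun_eq_iff field_simps)
  show ?thesis unfolding e dd_eqI[OF d] ..
qed

lemma bianchi_chart:
  assumes x: "x \<in> S"
  shows "bianchi (dd \<nu> x) (g x) (om x) (nabla_om x) (sg x) (nabla_sg x) w u v z t = 0"
proof -
  have R1: "R4 x a b c d = - R4 x b a c d" for a b c d by (rule R4_curv_like(2)[OF x])
  have "bianchi (dd \<nu> x) (g x) (om x) (nabla_om x) (sg x) (nabla_sg x) w u v z t = -6 * (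
      (dd \<nu> x w * Pi4 (g x) u v z t - (Phi4 (nabla_om x w) (sg x) u v z t + Phi4 (om x) (nabla_sg x w) u v z t) / 6)
    + (dd \<nu> x u * Pi4 (g x) v w z t - (Phi4 (nabla_om x u) (sg x) v w z t + Phi4 (om x) (nabla_sg x u) v w z t) / 6)
    + (dd \<nu> x v * Pi4 (g x) w u z t - (Phi4 (nabla_om x v) (sg x) w u z t + Phi4 (om x) (nabla_sg x v) w u z t) / 6))"
    unfolding bianchi_def by (simp add: field_simps)
  also have "(dd \<nu> x w * Pi4 (g x) u v z t - (Phi4 (nabla_om x w) (sg x) u v z t + Phi4 (om x) (nabla_sg x w) u v z t) / 6)
    + (dd \<nu> x u * Pi4 (g x) v w z t - (Phi4 (nabla_om x u) (sg x) v w z t + Phi4 (om x) (nabla_sg x u) v w z t) / 6)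
    + (dd \<nu> x v * Pi4 (g x) w u z t - (Phi4 (nabla_om x v) (sg x) w u z t + Phi4 (om x) (nabla_sg x v) w u z t) / 6) = 0"
    using second_bianchi[OF x, of u v z t w] Gam_sym[OF x, of u w] Gam_sym[OF x, of v w] Gam_sym[OF x, of v u]
      R1[of "Gam x w u" v z t] R1[of u "Gam x w v" z t] R1[of "Gam x u v" w z t]
    unfolding nabla_R4[OF x] by simp
  finally show ?thesis by simp
qed

lemma bianchi_point_at:
  assumes x: "x \<in> S"
  shows "bianchi_point (g x) (J x) (sg x) (nabla_J x) (nabla_sg x) (dd \<nu> x)"
proof -
  interpret H: hermitian_form "g x" "J x" by (rule hermitian_form_at[OF x])
  have l1: "linear (\<lambda>w. dd (\<lambda>y. sg y u v) x w)" "linear (\<lambda>u. dd (\<lambda>y. sg y u v) x w)" "linear (\<lambda>v. dd (\<lambda>y. sg y u v) x w)" for u v w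
    using linear_dd[OF sg_diff[OF x]] linear_dd_apply[OF open_S x, of "\<lambda>y u. sg y u v"]
      linear_dd_apply[OF open_S x, of "\<lambda>y v. sg y u v"] sg_properties(1) sg_diff x
    by (auto simp: bilinear_def)
  have bs: "bilinear (nabla_sg x w)" for w
    unfolding bilinear_def nabla_sg_def
    by (auto simp: linear_iff Gam_simps[OF x] sgx_simps[OF x] linear_add[OF l1(2)] linear_add[OF l1(3)]
        linear_cmul[OF l1(2)] linear_cmul[OF l1(3)] algebra_simps)
  have ls: "linear (\<lambda>w. nabla_sg x w u v)" for u v
    unfolding nabla_sg_def
    by (auto simp: linear_iff Gam_simps[OF x] sgx_simps[OF x] linear_add[OF l1(1)] linear_cmul[OF l1(1)] algebra_simps)
  have ss: "nabla_sg x w u v = - nabla_sg x w v u" for w u v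
  proof -
    have e: "dd (\<lambda>y. sg y u v) x = dd (\<lambda>y. - sg y v u) x"
      by (rule dd_cong_open[OF open_S x]) (rule sg_properties(2))
    have "dd (\<lambda>y. sg y u v) x w = - dd (\<lambda>y. sg y v u) x w"
      unfolding e by (simp add: dd_eqI[OF has_derivative_minus[OF dd_works[OF sg_diff[OF x]]]])
    then show ?thesis
      using sg_properties(2)[OF x, of v "Gam x w u"] sg_properties(2)[OF x, of "Gam x w v" u]
      by (simp add: nabla_sg_def)
  qed
  have bi: "bianchi (dd \<nu> x) (g x) H.om (\<lambda>w u v. g x (nabla_J x w u) v) (sg x) (nabla_sg x) w u v z t = 0" for w u v z t
    using bianchi_chart[OF x, of w u v z t] by (simp add: om_def nabla_om_def[abs_def])
  show ?thesis
    by (intro bianchi_point.intro hermitian_form_at[OF x] bianchi_point_axioms.intro sg_properties(1)[OF x]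
        sg_properties(2)[OF x] bilinear_nabla_J[OF x] nabla_J_skew[OF x] nabla_J_anticommutes[OF x] nabla_J_left_J[OF x] bs ls ss
        linear_dd[OF nu_diff[OF x]] bi dim)
qed

lemma bianchi_point_nabla_om: "x \<in> S \<Longrightarrow> bianchi_point.nabla_om (g x) (nabla_J x) = nabla_om x"
  by (intro ext) (simp add: bianchi_point.nabla_om_def[OF bianchi_point_at] nabla_om_def)

lemma frame_at:
  assumes x: "x \<in> S" and inv: "\<And>u v. sg x (J x u) (J x v) = sg x u v"
  obtains F l where "hermitian_form.frame (g x) (J x) F" "\<And>a v. a \<in> F \<Longrightarrow> sg x a v = l a * om x a v"
proof -
  interpret H: hermitian_form "g x" "J x" by (rule hermitian_form_at[OF x])
  define h where "h u v = sg x u (J x v)" for u v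
  have bh: "bilinear h"
    unfolding bilinear_def h_def by (auto simp: linear_iff sgx_simps[OF x] Jx_simps[OF x])
  have hs: "h u v = h v u" for u v
    using inv[of v "J x u"] sg_properties(2)[OF x, of "J x v" u] by (simp add: h_def J_sq[OF x] sgx_simps[OF x])
  have hJ: "h (J x u) (J x v) = h u v" for u v
    using inv[of u "J x v"] by (simp add: h_def J_sq[OF x] sgx_simps[OF x])
  obtain F l where F: "H.frame F" "\<And>a v. a \<in> F \<Longrightarrow> h a v = l a * g x a v"
    using H.unitary_eigenframe_exists[OF bh hs hJ] by metis
  have "sg x a v = l a * om x a v" if "a \<in> F" for a v
    using F(2)[OF that, of "J x v"] H.g_J_right[of a v] by (simp add: h_def J_sq[OF x] sgx_simps[OF x] om_eq[OF x])
  then show ?thesis using that F(1) by blast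
qed

lemma frame_exists:
  assumes x: "x \<in> S"
  obtains F where "hermitian_form.frame (g x) (J x) F"
proof -
  interpret H: hermitian_form "g x" "J x" by (rule hermitian_form_at[OF x])
  show ?thesis using H.unitary_eigenframe_exists[OF bil[OF x] sym[OF x] J_isom[OF x]] that by metis
qed

lemma nabla_om_zero_or_invariant:
  assumes x: "x \<in> S"
  shows "(\<forall>w u v. nabla_om x w u v = 0) \<or> (\<forall>u v. sg x (J x u) (J x v) = sg x u v)"
proof -
  obtain F where F: "hermitian_form.frame (g x) (J x) F" using frame_exists[OF x] .
  show ?thesis using bianchi_point.nabla_om_zero_or_sg_J_invariant[OF bianchi_point_at[OF x] F] unfolding bianchi_point_nabla_om[OF x] .
qed

lemma nabla_sg_J_invariant:
  assumes N: "open N" "x \<in> N" "N \<subseteq> S" and inv: "\<And>y u v. y \<in> N \<Longrightarrow> sg y (J y u) (J y v) = sg y u v"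
  shows "nabla_sg x w (J x u) (J x v) + sg x (nabla_J x w u) (J x v) + sg x (J x u) (nabla_J x w v) = nabla_sg x w u v"
proof -
  have x: "x \<in> S" using N by auto
  have "dd (\<lambda>y. sg y (J y u) (J y v)) x w
     = dd (\<lambda>y. sg y (J x u) (J x v)) x w + sg x (DJ x w u) (J x v) + sg x (J x u) (DJ x w v)"
    using dd_eqI[OF has_derivative_apply_bilinear[OF open_S x sg_properties(1) sg_diff[OF x] J_diff[OF x] J_diff[OF x]]] by simp
  moreover have "dd (\<lambda>y. sg y (J y u) (J y v)) x = dd (\<lambda>y. sg y u v) x"
    by (rule dd_cong_open[OF N(1,2)]) (rule inv)
  moreover have "sg x (J x (Gam x w u)) (J x v) = sg x (Gam x w u) v"
    "sg x (J x u) (J x (Gam x w v)) = sg x u (Gam x w v)" using inv[OF N(2)] by auto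
  ultimately show ?thesis
    by (simp add: d_sg nabla_J_def sgx_simps[OF x] algebra_simps)
qed

lemma frame_point:
  assumes N: "open N" "x \<in> N" "N \<subseteq> S" and inv: "\<And>y u v. y \<in> N \<Longrightarrow> sg y (J y u) (J y v) = sg y u v"
  obtains F l where "bianchi_frame (g x) (J x) (sg x) (nabla_J x) (nabla_sg x) (dd \<nu> x) F l"
proof -
  have x: "x \<in> S" using N by auto
  obtain F l where F: "hermitian_form.frame (g x) (J x) F" "\<And>a v. a \<in> F \<Longrightarrow> sg x a v = l a * om x a v"
    using frame_at[OF x inv[OF N(2)]] by metis
  have "bianchi_frame (g x) (J x) (sg x) (nabla_J x) (nabla_sg x) (dd \<nu> x) F l"
    by (intro bianchi_frame.intro bianchi_point_at[OF x] bianchi_frame_axioms.intro F(1))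
      (use F(2) inv[OF N(2)] nabla_sg_J_invariant[OF N inv] in \<open>auto simp: om_def\<close>)
  then show ?thesis by (rule that)
qed

lemma dnu_zero:
  assumes "open N" "x \<in> N" "N \<subseteq> S" "\<And>y u v. y \<in> N \<Longrightarrow> sg y (J y u) (J y v) = sg y u v"
  shows "dd \<nu> x w = 0"
proof -
  obtain F l where "bianchi_frame (g x) (J x) (sg x) (nabla_J x) (nabla_sg x) (dd \<nu> x) F l"
    using frame_point[OF assms] by blast
  then show ?thesis by (rule bianchi_frame.n_zero)
qed

definition non_kaehler :: "'a set" where "non_kaehler = {x \<in> S. \<exists>w u v. nabla_om x w u v \<noteq> 0}"

lemma smooth_nabla_om: "smooth_on S (\<lambda>x. nabla_om x w u v)"
proof -
  have l: "linear (Gam x w)" if "x \<in> S" for x using bilinear_Gam[OF that] by (simp add: bilinear_def)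
  have "smooth_on S (\<lambda>x. nabla_J x w u)"
    unfolding nabla_J_def
    by (intro smooth_on_diff smooth_on_add smooth_on_dd J_smooth open_S
        smooth_on_apply_linear[OF open_S l smooth_Gam J_smooth]
        smooth_on_apply_linear[OF open_S J_lin J_smooth smooth_Gam])
  from smooth_on_apply_linear[OF open_S g_lin(2) smooth this] show ?thesis
    by (simp add: nabla_om_def)
qed

lemma open_non_kaehler: "open non_kaehler"
proof -
  have "non_kaehler = (\<Union>w. \<Union>u. \<Union>v. {x \<in> S. nabla_om x w u v \<noteq> 0})" by (auto simp: non_kaehler_def)
  then show ?thesis by (simp only:) (intro open_UN ballI open_nonzero_set[OF open_S smooth_nabla_om])
qed

lemma non_kaehler_sub: "non_kaehler \<subseteq> S" by (auto simp: non_kaehler_def)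

lemma non_kaehler_invariant: "y \<in> non_kaehler \<Longrightarrow> sg y (J y u) (J y v) = sg y u v"
  using nabla_om_zero_or_invariant[of y] by (auto simp: non_kaehler_def)

text \<open>
  Near a point with \<open>\<nabla>J \<noteq> 0\<close> all forms \<open>\<sigma>\<close> are multiples \<open>t om\<close>, and \<open>t\<close> is smooth, being a quotient.
\<close>

lemma non_kaehler_sg_zero:
  assumes p: "p \<in> non_kaehler"
  shows "sg p u v = 0"
proof -
  have pS: "p \<in> S" using p non_kaehler_sub by auto
  have mult: "\<exists>t. \<forall>u v. sg y u v = t * om y u v" if y: "y \<in> non_kaehler" for y
  proof -
    have yS: "y \<in> S" using y non_kaehler_sub by auto
    obtain F l where "bianchi_frame (g y) (J y) (sg y) (nabla_J y) (nabla_sg y) (dd \<nu> y) F l"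
      using frame_point[OF open_non_kaehler y non_kaehler_sub non_kaehler_invariant] by metis
    from bianchi_frame.nabla_om_zero_or_sg_multiple_om[OF this]
    show ?thesis using y unfolding bianchi_point_nabla_om[OF yS] om_def by (auto simp: non_kaehler_def)
  qed
  obtain a :: 'a where "a \<in> Basis" using nonempty_Basis by blast
  then have a: "a \<noteq> 0" by auto
  define b where "b = J p a"
  define N where "N = {y \<in> non_kaehler. om y a b \<noteq> 0}"
  have N: "open N" "N \<subseteq> non_kaehler"
    unfolding N_def using open_nonzero_set[OF open_non_kaehler smooth_on_subset[OF smooth_om non_kaehler_sub]] by auto
  have NS: "N \<subseteq> S" using N non_kaehler_sub by auto
  have pN: "p \<in> N" using p om_properties(3)[OF pS, of a] pos[OF pS a] by (simp add: N_def b_def)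
  define t where "t y = sg y a b / om y a b" for y
  have st: "smooth_on N t"
    unfolding t_def by (intro smooth_on_divide N smooth_on_subset[OF smooth_sg NS] smooth_on_subset[OF smooth_om NS])
      (simp add: N_def)
  have sgt: "sg y u v = t y * om y u v" if "y \<in> N" for y u v
    using mult[of y] that by (auto simp: t_def N_def)
  have "nabla_sg p w u v = dd t p w * om p u v + t p * nabla_om p w u v" for w u v
  proof -
    have "dd (\<lambda>y. sg y u v) p = dd (\<lambda>y. t y * om y u v) p"
      by (rule dd_cong_open[OF N(1) pN]) (rule sgt)
    moreover have "((\<lambda>y. t y * om y u v) has_derivative (\<lambda>w. t p * dd (\<lambda>y. om y u v) p w + dd t p w * om p u v)) (at p)"
      by (intro has_derivative_mult dd_works om_diff pS smooth_on_differentiable[OF st pN])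
    ultimately have "dd (\<lambda>y. sg y u v) p w = t p * dd (\<lambda>y. om y u v) p w + dd t p w * om p u v"
      by (simp add: dd_eqI)
    then show ?thesis by (simp add: nabla_sg_def sgt[OF pN] d_om[OF pS] algebra_simps)
  qed
  note sp = this
  obtain F l where "bianchi_frame (g p) (J p) (sg p) (nabla_J p) (nabla_sg p) (dd \<nu> p) F l"
    using frame_point[OF open_non_kaehler p non_kaehler_sub non_kaehler_invariant] by metis
  from bianchi_frame.nabla_om_zero_or_multiple_zero[OF this, of "t p" "dd t p"]
  have "t p * nabla_om p w u v = 0" for w u v
    unfolding bianchi_point_nabla_om[OF pS] om_def[symmetric] using sgt[OF pN] sp by blast
  then have "t p = 0" using p by (auto simp: non_kaehler_def)
  then show ?thesis using sgt[OF pN] by simp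
qed

text \<open>
  Where \<open>J\<close> is parallel, its ordinary derivative is its commutator with \<open>Gam\<close>. Differentiating once more, the
  symmetry of second derivatives says that \<open>J\<close> commutes with the curvature.
\<close>

lemma kaehler_Rm_J:
  assumes V: "open V" "x \<in> V" "V \<subseteq> S" and nabla_om: "\<And>y w u v. y \<in> V \<Longrightarrow> nabla_om y w u v = 0"
  shows "Rm x u v (J x z) = J x (Rm x u v z)"
proof -
  have x: "x \<in> S" using V by auto
  have DJ: "DJ y w z = J y (Gam y w z) - Gam y w (J y z)" if "y \<in> V" for y w z
  proof -
    have y: "y \<in> S" using that V by auto
    have "nabla_J y w z = 0" using nabla_om[OF that] by (intro g_nondegenerate[OF y]) (simp add: nabla_om_def gx_simps[OF y])
    then show ?thesis by (simp add: nabla_J_def algebra_simps)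
  qed
  have lG: "linear (Gam y v)" if "y \<in> S" for y v using bilinear_Gam[OF that] by (simp add: bilinear_def)
  have e: "dd (\<lambda>y. DJ y v z) x u = DJ x u (Gam x v z) + J x (DGam x u v z) - (DGam x u v (J x z) + Gam x v (DJ x u z))" for u v
  proof -
    have 1: "dd (\<lambda>y. DJ y v z) x = dd (\<lambda>y. J y (Gam y v z) - Gam y v (J y z)) x"
      by (rule dd_cong_open[OF V(1,2)]) (rule DJ)
    have 2: "((\<lambda>y. J y (Gam y v z) - Gam y v (J y z)) has_derivative
      (\<lambda>u. (DJ x u (Gam x v z) + J x (DGam x u v z)) - (DGam x u v (J x z) + Gam x v (DJ x u z)))) (at x)"
      by (intro has_derivative_diff has_derivative_apply_linear[OF open_S x J_lin J_diff[OF x] Gam_diff[OF x]]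
          has_derivative_apply_linear[OF open_S x lG Gam_diff[OF x] J_diff[OF x]])
    show ?thesis unfolding 1 dd_eqI[OF 2] ..
  qed
  have "dd (\<lambda>y. DJ y v z) x u = dd (\<lambda>y. DJ y u z) x v"
    by (rule dd_symmetric[OF open_S x J_smooth])
  then show ?thesis
    unfolding e DJ[OF V(2)] Rm_def by (simp add: Jx_simps[OF x] Gam_simps[OF x] algebra_simps)
qed

lemma kaehler_sg:
  assumes V: "open V" "x \<in> V" "V \<subseteq> S" and nabla_om: "\<And>y w u v. y \<in> V \<Longrightarrow> nabla_om y w u v = 0"
  shows "sg x u v = 3 * \<nu> x * om x u v"
proof -
  have x: "x \<in> S" using V by auto
  interpret H: hermitian_form "g x" "J x" by (rule hermitian_form_at[OF x])
  have R: "R4 x u v z t = \<nu> x * Pi4 (g x) u v z t - Phi4 H.om (sg x) u v z t / 6" for u v z t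
    using sg_properties(3)[OF x] by (simp add: om_def)
  have RJ: "R4 x u v (J x z) (J x t) = R4 x u v z t" for u v z t
    by (simp add: R4_def kaehler_Rm_J[OF V nabla_om] J_isom[OF x])
  show ?thesis
    using H.J_invariant_curvature[OF dim sg_properties(1)[OF x] sg_properties(2)[OF x] R RJ] by (simp add: om_def)
qed

text \<open>
  Conditions given by smooth functions that hold on \<open>non_kaehler\<close> extend to its closure, and the
  rest of the chart is open.
\<close>

definition kaehler_interior :: "'a set" where "kaehler_interior = S - closure non_kaehler"

lemma kaehler_interior_open: "open kaehler_interior" "kaehler_interior \<subseteq> S"
  by (auto simp: kaehler_interior_def open_Diff open_S)

lemma kaehler_interior_sg: "x \<in> kaehler_interior \<Longrightarrow> sg x u v = 3 * \<nu> x * om x u v"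
proof (rule kaehler_sg[OF kaehler_interior_open(1) _ kaehler_interior_open(2)])
  fix y w u v assume "y \<in> kaehler_interior"
  then show "nabla_om y w u v = 0"
    using closure_subset[of non_kaehler] by (auto simp: kaehler_interior_def non_kaehler_def)
qed

lemma closed_condition_on_closure:
  assumes f: "smooth_on S (f :: 'a \<Rightarrow> real)" and z: "\<And>y. y \<in> non_kaehler \<Longrightarrow> f y = 0"
    and x: "x \<in> S" "x \<in> closure non_kaehler"
  shows "f x = 0"
proof (rule ccontr)
  assume "f x \<noteq> 0"
  then have "open {y \<in> S. f y \<noteq> 0}" "x \<in> {y \<in> S. f y \<noteq> 0}" using open_nonzero_set[OF open_S f] x by auto
  then obtain y where "y \<in> non_kaehler" "y \<in> {y \<in> S. f y \<noteq> 0}"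
    using x(2) by (meson closure_iff_nhds_not_empty disjoint_iff subset_refl)
  then show False using z by auto
qed

theorem dnu_zero_everywhere:
  assumes x: "x \<in> S"
  shows "dd \<nu> x w = 0"
proof (cases "x \<in> kaehler_interior")
  case True
  show ?thesis
  proof (rule dnu_zero[OF kaehler_interior_open(1) True kaehler_interior_open(2)])
    fix y u v assume y: "y \<in> kaehler_interior"
    then have yS: "y \<in> S" using kaehler_interior_open by auto
    show "sg y (J y u) (J y v) = sg y u v"
      unfolding kaehler_interior_sg[OF y] by (simp add: om_eq[OF yS] J_isom[OF yS])
  qed
next
  case False
  have "dd \<nu> y w = 0" if "y \<in> non_kaehler" for y
    by (rule dnu_zero[OF open_non_kaehler that non_kaehler_sub]) (rule non_kaehler_invariant)
  then show ?thesis
    using closed_condition_on_closure[OF smooth_on_dd[OF smooth_nu]] False x by (auto simp: kaehler_interior_def)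
qed

theorem sectional_dichotomy:
  assumes x: "x \<in> S"
  shows "(\<forall>u v. R4 x u v v u = \<nu> x * (g x u u * g x v v - (g x u v)\<^sup>2)) \<or>
    (\<forall>u v. R4 x u v v u = \<nu> x * (g x u u * g x v v - (g x u v)\<^sup>2 + 3 * (g x (J x u) v)\<^sup>2))"
proof (cases "x \<in> kaehler_interior")
  case True
  show ?thesis
    using sectional_value[OF x] kaehler_interior_sg[OF True]
    by (auto simp: om_eq[OF x] power2_eq_square algebra_simps)
next
  case False
  have "sg x u v = 0" for u v
    using closed_condition_on_closure[OF smooth_sg] non_kaehler_sg_zero False x by (auto simp: kaehler_interior_def)
  then show ?thesis using sectional_value[OF x] by simp
qed

theorem non_kaehler_sectional:
  assumes "x \<in> non_kaehler"
  shows "R4 x u v v u = \<nu> x * (g x u u * g x v v - (g x u v)\<^sup>2)"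
  using sectional_value[of x] non_kaehler_sg_zero[OF assms] assms non_kaehler_sub by auto

end

section \<open>Change of charts\<close>

locale chart_change = R: riemannian_chart S g + R': riemannian_chart S' g'
  for S :: "'e::euclidean_space set" and g and S' :: "'e set" and g' +
  fixes V :: "'e set" and \<phi> :: "'e \<Rightarrow> 'e"
  assumes open_V: "open V" and V_sub: "V \<subseteq> S" and smooth_phi: "smooth_on V \<phi>" and phi_V: "\<phi> ` V \<subseteq> S'"
    and isometric: "x \<in> V \<Longrightarrow> g x u v = g' (\<phi> x) (dd \<phi> x u) (dd \<phi> x v)"
begin

abbreviation D2 where "D2 x u v \<equiv> dd (\<lambda>y. dd \<phi> y v) x u"

lemma phi_diff: "x \<in> V \<Longrightarrow> \<phi> differentiable at x" "x \<in> V \<Longrightarrow> (\<lambda>y. dd \<phi> y v) differentiable at x"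
  using smooth_phi smooth_on_dd smooth_on_differentiable by blast+

lemma linear_dphi: "x \<in> V \<Longrightarrow> linear (dd \<phi> x)"
  by (rule linear_dd[OF phi_diff(1)])

lemma D2_sym: "x \<in> V \<Longrightarrow> D2 x u v = D2 x v u"
  by (rule dd_symmetric[OF open_V _ smooth_phi])

lemma bij_dphi:
  assumes x: "x \<in> V"
  shows "bij (dd \<phi> x)"
proof -
  have "inj (dd \<phi> x)"
  proof (rule injI)
    fix u v assume e: "dd \<phi> x u = dd \<phi> x v"
    show "u = v"
      by (rule R.g_nondegenerate[of x]) (use x V_sub isometric[OF x] e in auto)
  qed
  then show ?thesis using linear_injective_imp_surjective[OF linear_dphi[OF x]] by (simp add: bij_def)
qed

lemma phi_in: "x \<in> V \<Longrightarrow> \<phi> x \<in> S'" using phi_V by auto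
lemma in_S: "x \<in> V \<Longrightarrow> x \<in> S" using V_sub by auto

lemma chain:
  fixes f :: "'e \<Rightarrow> 'b::real_normed_vector"
  assumes x: "x \<in> V" and f: "f differentiable at (\<phi> x)"
  shows "((\<lambda>y. f (\<phi> y)) has_derivative (\<lambda>w. dd f (\<phi> x) (dd \<phi> x w))) (at x)"
  using diff_chain_at[OF dd_works[OF phi_diff(1)[OF x]] dd_works[OF f]] by (simp add: o_def)

text \<open>
  The sum of the left-hand side and \<open>D2 x u v\<close>, pulled back by the derivative of \<open>\<phi>\<close>, has the
  properties that characterise the Christoffel symbols of \<open>g\<close>.
\<close>

theorem Gam_change:
  assumes x: "x \<in> V"
  shows "R'.Gam (\<phi> x) (dd \<phi> x u) (dd \<phi> x v) = dd \<phi> x (R.Gam x u v) - D2 x u v"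
proof -
  let ?P = "dd \<phi> x"
  define B where "B u v = inv ?P (R'.Gam (\<phi> x) (?P u) (?P v) + D2 x u v)" for u v
  have PB: "?P (B u v) = R'.Gam (\<phi> x) (?P u) (?P v) + D2 x u v" for u v
    unfolding B_def using bij_dphi[OF x] by (simp add: bij_is_surj surj_f_inv_f)
  have "B = R.Gam x"
  proof (rule R.Gam_unique[OF in_S[OF x]])
    fix u v
    show "B u v = B v u"
      unfolding B_def using R'.Gam_sym[OF phi_in[OF x], of "?P u" "?P v"] D2_sym[OF x, of u v] by simp
  next
    fix u v w
    have 1: "dd (\<lambda>y. g y v w) x = dd (\<lambda>y. g' (\<phi> y) (dd \<phi> y v) (dd \<phi> y w)) x"
      by (rule dd_cong_open[OF open_V x]) (rule isometric)
    have c: "((\<lambda>y. g' (\<phi> y) a b) has_derivative (\<lambda>w. dd (\<lambda>z. g' z a b) (\<phi> x) (?P w))) (at x)" for a b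
      by (rule chain[OF x R'.g_diff[OF phi_in[OF x]]])
    have "((\<lambda>y. g' (\<phi> y) (dd \<phi> y v) (dd \<phi> y w)) has_derivative
      (\<lambda>u. dd (\<lambda>y. g' (\<phi> y) (?P v) (?P w)) x u + g' (\<phi> x) (D2 x u v) (?P w) + g' (\<phi> x) (?P v) (D2 x u w))) (at x)"
      by (rule has_derivative_apply_bilinear[OF open_V x R'.bil[OF phi_in] _ phi_diff(2)[OF x] phi_diff(2)[OF x]])
        (use c in \<open>auto simp: differentiable_def\<close>)
    then have "dd (\<lambda>y. g y v w) x u = dd (\<lambda>z. g' z (?P v) (?P w)) (\<phi> x) (?P u)
        + g' (\<phi> x) (D2 x u v) (?P w) + g' (\<phi> x) (?P v) (D2 x u w)"
      unfolding 1 by (simp add: dd_eqI dd_eqI[OF c])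
    then show "dd (\<lambda>y. g y v w) x u = g x (B u v) w + g x v (B u w)"
      unfolding isometric[OF x] PB R'.dg_Gam[OF phi_in[OF x]] by (simp add: R'.gx_simps[OF phi_in[OF x]])
  qed
  then show ?thesis using PB[of u v] by simp
qed

text \<open>
  The derivative of the law for \<open>Gam\<close> is antisymmetrised; third derivatives of \<open>\<phi>\<close> cancel by
  symmetry, and the terms with second derivatives cancel against those from the products of \<open>Gam\<close>.
\<close>

theorem Rm_change:
  assumes x: "x \<in> V"
  shows "dd \<phi> x (R.Rm x u v w) = R'.Rm (\<phi> x) (dd \<phi> x u) (dd \<phi> x v) (dd \<phi> x w)"
proof -
  let ?P = "dd \<phi> x"
  note xS = in_S[OF x] and xS' = phi_in[OF x]
  have e: "R'.DGam (\<phi> x) (?P u) (?P v) (?P w) + R'.Gam (\<phi> x) (D2 x u v) (?P w) + R'.Gam (\<phi> x) (?P v) (D2 x u w)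
     = D2 x u (R.Gam x v w) + ?P (R.DGam x u v w) - dd (\<lambda>y. D2 y v w) x u" for u v w
  proof -
    have 1: "dd (\<lambda>y. R'.Gam (\<phi> y) (dd \<phi> y v) (dd \<phi> y w)) x = dd (\<lambda>y. dd \<phi> y (R.Gam y v w) - D2 y v w) x"
      by (rule dd_cong_open[OF open_V x]) (rule Gam_change)
    have c: "((\<lambda>y. R'.Gam (\<phi> y) a b) has_derivative (\<lambda>w. R'.DGam (\<phi> x) (?P w) a b)) (at x)" for a b
      by (rule chain[OF x R'.Gam_diff[OF xS']])
    have 2: "((\<lambda>y. R'.Gam (\<phi> y) (dd \<phi> y v) (dd \<phi> y w)) has_derivative
      (\<lambda>u. dd (\<lambda>y. R'.Gam (\<phi> y) (?P v) (?P w)) x u + R'.Gam (\<phi> x) (D2 x u v) (?P w) + R'.Gam (\<phi> x) (?P v) (D2 x u w))) (at x)"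
      by (rule has_derivative_apply_bilinear[OF open_V x R'.bilinear_Gam[OF phi_in] _ phi_diff(2)[OF x] phi_diff(2)[OF x]])
        (use c in \<open>auto simp: differentiable_def\<close>)
    have "((\<lambda>y. dd \<phi> y (R.Gam y v w)) has_derivative (\<lambda>u. D2 x u (R.Gam x v w) + ?P (R.DGam x u v w))) (at x)"
      by (rule has_derivative_apply_linear[OF open_V x linear_dphi phi_diff(2)[OF x] R.Gam_diff[OF xS]])
    moreover have "((\<lambda>y. D2 y v w) has_derivative dd (\<lambda>y. D2 y v w) x) (at x)"
      by (rule dd_works, rule smooth_on_differentiable[OF smooth_on_dd[OF smooth_on_dd[OF smooth_phi]] x])
    ultimately have 3: "((\<lambda>y. dd \<phi> y (R.Gam y v w) - D2 y v w) has_derivative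
       (\<lambda>u. (D2 x u (R.Gam x v w) + ?P (R.DGam x u v w)) - dd (\<lambda>y. D2 y v w) x u)) (at x)"
      by (rule has_derivative_diff)
    show ?thesis
      using fun_cong[OF 1, of u] unfolding dd_eqI[OF 2] dd_eqI[OF 3] dd_eqI[OF c] .
  qed
  have s3: "dd (\<lambda>y. D2 y v w) x u = dd (\<lambda>y. D2 y u w) x v"
    by (rule dd_symmetric[OF open_V x smooth_on_dd[OF smooth_phi]])
  have d: "R'.DGam (\<phi> x) (?P u) (?P v) (?P w)
     = D2 x u (R.Gam x v w) + ?P (R.DGam x u v w) - dd (\<lambda>y. D2 y v w) x u
       - R'.Gam (\<phi> x) (D2 x u v) (?P w) - R'.Gam (\<phi> x) (?P v) (D2 x u w)" for u v w
    using e[of v w u] by (simp add: algebra_simps)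
  have lP: "?P (a + b) = ?P a + ?P b" "?P (a - b) = ?P a - ?P b" for a b
    using linear_dphi[OF x] by (auto simp: linear_add linear_diff)
  show ?thesis
    unfolding R'.Rm_def R.Rm_def d Gam_change[OF x] s3 D2_sym[OF x, of v u]
    by (simp add: lP R'.Gam_simps[OF xS'] Gam_change[OF x] algebra_simps)
qed

end

section \<open>Tangent vectors in charts\<close>

locale mfd =
  fixes M :: "'m topology" and A :: "('m, 'e::euclidean_space) chart set"
  assumes mfd: "smooth_manifold M A"
begin

lemma chart_properties:
  assumes c: "c \<in> A"
  shows "openin M (fst c)" "open (snd c ` fst c)" "inj_on (snd c) (fst c)" "fst c \<subseteq> topspace M"
    "homeomorphic_map (subtopology M (fst c)) (top_of_set (snd c ` fst c)) (snd c)"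
proof -
  have ic: "is_chart M c" using mfd c by (auto simp: smooth_manifold_def)
  then show h: "openin M (fst c)" "open (snd c ` fst c)"
    "homeomorphic_map (subtopology M (fst c)) (top_of_set (snd c ` fst c)) (snd c)"
    by (auto simp: is_chart_def)
  show t: "fst c \<subseteq> topspace M" using openin_subset[OF h(1)] .
  then show "inj_on (snd c) (fst c)"
    using homeomorphic_imp_injective_map[OF h(3)] by (simp add: topspace_subtopology inf_absorb2)
qed

lemma chart_inv: "c \<in> A \<Longrightarrow> p \<in> fst c \<Longrightarrow> chart_inv c (snd c p) = p"
  unfolding chart_inv_def using chart_properties(3) by (simp add: inv_into_f_f)

lemma chart_inv_in: "c \<in> A \<Longrightarrow> x \<in> snd c ` fst c \<Longrightarrow> chart_inv c x \<in> fst c"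
  "c \<in> A \<Longrightarrow> x \<in> snd c ` fst c \<Longrightarrow> snd c (chart_inv c x) = x"
  unfolding chart_inv_def by (auto simp: inv_into_into f_inv_into_f)

lemma open_image:
  assumes "c \<in> A" "openin M V" "V \<subseteq> fst c"
  shows "open (snd c ` V)"
proof -
  have "openin (subtopology M (fst c)) V" using assms by (simp add: openin_subset_topspace_eq openin_open_subtopology chart_properties(1))
  then have "openin (top_of_set (snd c ` fst c)) (snd c ` V)"
    using homeomorphic_imp_open_map[OF chart_properties(5)[OF assms(1)]] by (simp add: open_map_def)
  then show ?thesis using chart_properties(2)[OF assms(1)] openin_open_eq by blast
qed

lemma open_overlap:
  assumes "c \<in> A" "openin M W"
  shows "open (snd c ` (fst c \<inter> W))"
  by (rule open_image[OF assms(1) openin_Int[OF chart_properties(1)[OF assms(1)] assms(2)]]) blast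

lemma open_preimage:
  assumes c: "c \<in> A" and N: "open N"
  shows "openin M {p \<in> fst c. snd c p \<in> N}"
proof -
  have "continuous_map (subtopology M (fst c)) (top_of_set (snd c ` fst c)) (snd c)"
    using homeomorphic_imp_continuous_map[OF chart_properties(5)[OF c]] .
  then have "openin (subtopology M (fst c)) {p \<in> topspace (subtopology M (fst c)). snd c p \<in> snd c ` fst c \<inter> N}"
    by (rule openin_continuous_map_preimage) (use N in \<open>auto simp: openin_open\<close>)
  moreover have "{p \<in> topspace (subtopology M (fst c)). snd c p \<in> snd c ` fst c \<inter> N} = {p \<in> fst c. snd c p \<in> N}"
    using chart_properties(4)[OF c] by auto
  ultimately show ?thesis using openin_open_subtopology[OF chart_properties(1)[OF c]] by auto
qed

lemma charts_atD: "c \<in> charts_at A p \<Longrightarrow> c \<in> A" "c \<in> charts_at A p \<Longrightarrow> p \<in> fst c"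
  by (auto simp: charts_at_def)

lemma charts_atI: "c \<in> A \<Longrightarrow> x \<in> snd c ` fst c \<Longrightarrow> c \<in> charts_at A (chart_inv c x)"
  using chart_inv_in by (auto simp: charts_at_def)

lemma chart_exists: "p \<in> topspace M \<Longrightarrow> \<exists>c. c \<in> charts_at A p"
  using mfd by (auto simp: smooth_manifold_def charts_at_def)

lemma smooth_transition: "c \<in> A \<Longrightarrow> d \<in> A \<Longrightarrow> smooth_on (snd c ` (fst c \<inter> fst d)) (transition c d)"
  using mfd by (auto simp: smooth_manifold_def)

lemma transition_apply: "c \<in> A \<Longrightarrow> p \<in> fst c \<Longrightarrow> transition c d (snd c p) = snd d p"
  by (simp add: transition_def chart_inv)

lemma transition_diff:
  assumes "c \<in> charts_at A p" "d \<in> charts_at A p"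
  shows "transition c d differentiable at (snd c p)"
  using smooth_on_differentiable[OF smooth_transition] charts_atD assms by blast

lemma dtransition_self:
  assumes c: "c \<in> charts_at A p"
  shows "dd (transition c c) (snd c p) u = u"
proof -
  have "dd (transition c c) (snd c p) = dd (\<lambda>x. x) (snd c p)"
    by (rule dd_cong_open[OF chart_properties(2)[of c]])
      (use charts_atD[OF c] chart_inv_in in \<open>auto simp: transition_def\<close>)
  then show ?thesis by simp
qed

lemma dtransition_chain:
  assumes c: "c \<in> charts_at A p" and d: "d \<in> charts_at A p" and e: "e \<in> charts_at A p"
  shows "dd (transition d e) (snd d p) (dd (transition c d) (snd c p) u) = dd (transition c e) (snd c p) u"
proof -
  note cA = charts_atD[OF c] and dA = charts_atD[OF d] and eA = charts_atD[OF e]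
  have "dd (transition c e) (snd c p) = dd (\<lambda>x. transition d e (transition c d x)) (snd c p)"
  proof (rule dd_cong_open[OF open_overlap[OF cA(1) chart_properties(1)[OF dA(1)]]])
    show "snd c p \<in> snd c ` (fst c \<inter> fst d)" using cA dA by auto
    fix y assume "y \<in> snd c ` (fst c \<inter> fst d)"
    then show "transition c e y = transition d e (transition c d y)"
      using cA(1) dA(1) by (auto simp: transition_apply)
  qed
  also have "\<dots> = (\<lambda>w. dd (transition d e) (snd d p) (dd (transition c d) (snd c p) w))"
  proof (rule dd_eqI)
    have "transition d e differentiable at (transition c d (snd c p))"
      using transition_diff[OF d e] by (simp add: transition_apply[OF cA])
    from diff_chain_at[OF dd_works[OF transition_diff[OF c d]] dd_works[OF this]]
    show "((\<lambda>x. transition d e (transition c d x)) has_derivative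
      (\<lambda>w. dd (transition d e) (snd d p) (dd (transition c d) (snd c p) w))) (at (snd c p))"
      by (simp add: o_def transition_apply[OF cA])
  qed
  finally show ?thesis by simp
qed

lemma coord_vec_tangent:
  assumes c: "c \<in> charts_at A p"
  shows "coord_vec A c u p \<in> tangent_space A p"
  unfolding tangent_space_def coord_vec_def using dtransition_chain[OF c] by auto

lemma coord_vec_same: "c \<in> charts_at A p \<Longrightarrow> coord_vec A c u p c = u"
  by (simp add: coord_vec_def dtransition_self)

lemma tangentD: "X \<in> tangent_space A p \<Longrightarrow> c \<in> charts_at A p \<Longrightarrow> d \<in> charts_at A p \<Longrightarrow>
    X d = dd (transition c d) (snd c p) (X c)"
  and tangent_outside: "X \<in> tangent_space A p \<Longrightarrow> d \<notin> charts_at A p \<Longrightarrow> X d = 0"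
  unfolding tangent_space_def by blast+

lemma tangentI: "(\<And>c d. c \<in> charts_at A p \<Longrightarrow> d \<in> charts_at A p \<Longrightarrow>
    X d = dd (transition c d) (snd c p) (X c)) \<Longrightarrow> (\<And>d. d \<notin> charts_at A p \<Longrightarrow> X d = 0) \<Longrightarrow> X \<in> tangent_space A p"
  unfolding tangent_space_def by blast

lemma tangent_eqI:
  assumes "X \<in> tangent_space A p" "Y \<in> tangent_space A p" "c \<in> charts_at A p" "X c = Y c"
  shows "X = Y"
proof
  fix d show "X d = Y d"
    using tangentD[OF assms(1,3), of d] tangentD[OF assms(2,3), of d] tangent_outside[OF assms(1), of d]
      tangent_outside[OF assms(2), of d] assms(4) by (cases "d \<in> charts_at A p") auto
qed

lemma tangent_coord_vec: "X \<in> tangent_space A p \<Longrightarrow> c \<in> charts_at A p \<Longrightarrow> coord_vec A c (X c) p = X"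
  using tangent_eqI[OF coord_vec_tangent] coord_vec_same by metis

lemma lincomb_tangent:
  assumes "X \<in> tangent_space A p" "Y \<in> tangent_space A p"
  shows "lincomb a X b Y \<in> tangent_space A p"
proof (rule tangentI)
  fix c d assume c: "c \<in> charts_at A p" and d: "d \<in> charts_at A p"
  have "linear (dd (transition c d) (snd c p))" by (rule linear_dd[OF transition_diff[OF c d]])
  then show "lincomb a X b Y d = dd (transition c d) (snd c p) (lincomb a X b Y c)"
    using tangentD[OF assms(1) c d] tangentD[OF assms(2) c d] by (simp add: lincomb_def linear_add linear_cmul)
qed (simp add: lincomb_def tangent_outside[OF assms(1)] tangent_outside[OF assms(2)])

lemma zero_tangent: "(\<lambda>c. 0) \<in> tangent_space A p"
  by (rule tangentI) (use linear_0[OF linear_dd[OF transition_diff]] in auto)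

lemma coord_vec_lincomb:
  assumes c: "c \<in> charts_at A p"
  shows "coord_vec A c (a *\<^sub>R u + b *\<^sub>R v) p = lincomb a (coord_vec A c u p) b (coord_vec A c v p)"
  by (rule tangent_eqI[OF coord_vec_tangent[OF c] lincomb_tangent[OF coord_vec_tangent[OF c] coord_vec_tangent[OF c]] c])
    (simp add: coord_vec_same[OF c] lincomb_def)

section \<open>Vector fields and brackets\<close>

lemma vfield_diff:
  assumes W: "openin M W" "p \<in> W" and Y: "smooth_vfield_on A W Y" and c: "c \<in> charts_at A p"
  shows "(\<lambda>x. Y (chart_inv c x) c) differentiable at (snd c p)"
  using Y W charts_atD[OF c] by (intro smooth_on_differentiable[of "snd c ` (fst c \<inter> W)"]) (auto simp: smooth_vfield_on_def)

text \<open>The failure of the componentwise derivative to be a tangent vector is a second derivative of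
  the transition map.\<close>

lemma dcomp_transition:
  assumes W: "openin M W" "p \<in> W" and Y: "smooth_vfield_on A W Y"
    and c: "c \<in> charts_at A p" and d: "d \<in> charts_at A p"
  shows "dcomp d Y p (dd (transition c d) (snd c p) u) =
    dd (\<lambda>y. dd (transition c d) y (Y p c)) (snd c p) u + dd (transition c d) (snd c p) (dcomp c Y p u)"
proof -
  note cA = charts_atD[OF c] and dA = charts_atD[OF d]
  let ?t = "transition c d" and ?x = "snd c p"
  define V where "V = snd c ` (fst c \<inter> (fst d \<inter> W))"
  have V: "open V" unfolding V_def by (rule open_overlap[OF cA(1)]) (use chart_properties(1)[OF dA(1)] W in auto)
  have xV: "?x \<in> V" using cA dA W by (auto simp: V_def)
  have sm: "smooth_on V ?t"
    by (rule smooth_on_subset[OF smooth_transition[OF cA(1) dA(1)]]) (auto simp: V_def)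
  have e: "Y (chart_inv d (?t y)) d = dd ?t y (Y (chart_inv c y) c)" if yV: "y \<in> V" for y
  proof -
    obtain q where q: "y = snd c q" "q \<in> fst c" "q \<in> fst d" "q \<in> W" using yV unfolding V_def by blast
    have "Y q \<in> tangent_space A q" using Y q by (auto simp: smooth_vfield_on_def)
    moreover have "c \<in> charts_at A q" "d \<in> charts_at A q" using cA dA q by (auto simp: charts_at_def)
    ultimately show ?thesis using tangentD[of "Y q" q c d] q cA dA by (simp add: transition_apply chart_inv)
  qed
  have l: "linear (dd ?t y)" if "y \<in> V" for y by (rule linear_dd[OF smooth_on_differentiable[OF sm that]])
  have 1: "((\<lambda>y. dd ?t y (Y (chart_inv c y) c)) has_derivative
     (\<lambda>u. dd (\<lambda>y. dd ?t y (Y (chart_inv c ?x) c)) ?x u + dd ?t ?x (dcomp c Y p u))) (at ?x)"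
    unfolding dcomp_def
    by (rule has_derivative_apply_linear[OF V xV l smooth_on_differentiable[OF smooth_on_dd[OF sm] xV] vfield_diff[OF W Y c]])
  have "(\<lambda>x. Y (chart_inv d x) d) differentiable at (?t ?x)"
    using vfield_diff[OF W Y d] by (simp add: transition_apply[OF cA])
  from diff_chain_at[OF dd_works[OF transition_diff[OF c d]] dd_works[OF this]]
  have 2: "((\<lambda>y. Y (chart_inv d (?t y)) d) has_derivative (\<lambda>u. dcomp d Y p (dd ?t ?x u))) (at ?x)"
    by (simp add: o_def dcomp_def transition_apply[OF cA])
  have "dd (\<lambda>y. Y (chart_inv d (?t y)) d) ?x = dd (\<lambda>y. dd ?t y (Y (chart_inv c y) c)) ?x"
    by (rule dd_cong_open[OF V xV e])
  then show ?thesis unfolding dd_eqI[OF 1] dd_eqI[OF 2] by (metis chart_inv[OF cA])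
qed

lemma lie_bracket_tangent:
  assumes W: "openin M W" "p \<in> W" and X: "smooth_vfield_on A W X" and Y: "smooth_vfield_on A W Y"
  shows "lie_bracket A X Y p \<in> tangent_space A p"
proof (rule tangentI)
  fix c d assume c: "c \<in> charts_at A p" and d: "d \<in> charts_at A p"
  note cA = charts_atD[OF c] and dA = charts_atD[OF d]
  have T: "X p \<in> tangent_space A p" "Y p \<in> tangent_space A p" using X Y W by (auto simp: smooth_vfield_on_def)
  have "dd (\<lambda>y. dd (transition c d) y (Y p c)) (snd c p) (X p c) = dd (\<lambda>y. dd (transition c d) y (X p c)) (snd c p) (Y p c)"
    by (rule dd_symmetric[OF open_overlap[OF cA(1) chart_properties(1)[OF dA(1)]] _ smooth_transition[OF cA(1) dA(1)]])
      (use cA dA in auto)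
  then show "lie_bracket A X Y p d = dd (transition c d) (snd c p) (lie_bracket A X Y p c)"
    using c d dcomp_transition[OF W Y c d, of "X p c"] dcomp_transition[OF W X c d, of "Y p c"]
      tangentD[OF T(1) c d] tangentD[OF T(2) c d] linear_diff[OF linear_dd[OF transition_diff[OF c d]]]
    by (simp add: lie_bracket_def)
qed (simp add: lie_bracket_def)

lemma coord_vec_smooth:
  assumes c: "c \<in> A"
  shows "smooth_vfield_on A (fst c) (coord_vec A c u)"
  unfolding smooth_vfield_on_def
proof (intro conjI ballI)
  fix p assume "p \<in> fst c"
  then show "coord_vec A c u p \<in> tangent_space A p" using c by (intro coord_vec_tangent) (simp add: charts_at_def)
next
  fix d assume d: "d \<in> A"
  let ?V = "snd d ` (fst d \<inter> fst c)"
  have oV: "open ?V" by (rule open_overlap[OF d chart_properties(1)[OF c]])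
  have "smooth_on ?V (\<lambda>x. dd (transition c d) (transition d c x) u)"
  proof (rule smooth_on_compose[OF oV smooth_on_dd[OF smooth_transition[OF c d]] smooth_transition[OF d c]])
    show "transition d c ` ?V \<subseteq> snd c ` (fst c \<inter> fst d)" using d by (auto simp: transition_apply)
  qed
  moreover have "coord_vec A c u (chart_inv d x) d = dd (transition c d) (transition d c x) u" if "x \<in> ?V" for x
    using that c d by (auto simp: coord_vec_def charts_at_def chart_inv transition_apply)
  ultimately show "smooth_on ?V (\<lambda>x. coord_vec A c u (chart_inv d x) d)"
    by (subst smooth_on_cong[OF oV]) auto
qed

end

section \<open>Riemannian manifolds in charts\<close>

locale riem_mfd =
  fixes M :: "'m topology" and A :: "('m, 'e::euclidean_space) chart set" and g :: "('m, 'e) metric"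
  assumes riem: "riemannian_manifold M A g"

sublocale riem_mfd \<subseteq> mfd
  using riem by unfold_locales (simp add: riemannian_manifold_def)

context riem_mfd
begin

abbreviation coords :: "('m, 'e) chart \<Rightarrow> 'e set" where "coords c \<equiv> snd c ` fst c"
abbreviation G :: "('m, 'e) chart \<Rightarrow> 'e \<Rightarrow> 'e \<Rightarrow> 'e \<Rightarrow> real" where "G c \<equiv> metric_comp A g c"

lemma g_tangent:
  assumes "p \<in> topspace M"
  shows "X \<in> tangent_space A p \<Longrightarrow> Y \<in> tangent_space A p \<Longrightarrow> g p X Y = g p Y X"
    "X \<in> tangent_space A p \<Longrightarrow> Y \<in> tangent_space A p \<Longrightarrow> Z \<in> tangent_space A p \<Longrightarrow>
       g p (lincomb a X b Y) Z = a * g p X Z + b * g p Y Z"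
    "X \<in> tangent_space A p \<Longrightarrow> X \<noteq> (\<lambda>c. 0) \<Longrightarrow> g p X X > 0"
  using riem assms unfolding riemannian_manifold_def by blast+

lemma metric_comp_eq:
  assumes "c \<in> charts_at A p" "X \<in> tangent_space A p" "Y \<in> tangent_space A p"
  shows "G c (snd c p) (X c) (Y c) = g p X Y"
  unfolding metric_comp_def
  using assms by (simp add: chart_inv[OF charts_atD] tangent_coord_vec)

lemma chart_in_topspace: "c \<in> charts_at A p \<Longrightarrow> p \<in> topspace M"
  using chart_properties(4) charts_atD by blast

lemma chart_riem:
  assumes c: "c \<in> A"
  shows "riemannian_chart (coords c) (G c)"
proof
  show "open (coords c)" by (rule chart_properties(2)[OF c])
  show "smooth_on (coords c) (\<lambda>x. G c x u v)" for u v
    using riem c unfolding riemannian_manifold_def by blast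
  fix x assume x: "x \<in> coords c"
  define p where "p = chart_inv c x"
  have p: "c \<in> charts_at A p" "p \<in> topspace M"
    using charts_atI[OF c x] chart_in_topspace by (auto simp: p_def)
  note T = coord_vec_tangent[OF p(1)]
  have e: "G c x u v = g p (coord_vec A c u p) (coord_vec A c v p)" for u v
    by (simp add: metric_comp_def p_def)
  show s: "G c x u v = G c x v u" for u v unfolding e by (rule g_tangent(1)[OF p(2) T T])
  have l: "G c x (a *\<^sub>R u + b *\<^sub>R v) w = a * G c x u w + b * G c x v w" for a b u v w
    unfolding e coord_vec_lincomb[OF p(1)] by (rule g_tangent(2)[OF p(2) T T T])
  have lin: "linear (\<lambda>u. G c x u w)" for w
  proof (rule linearI)
    show "G c x (b1 + b2) w = G c x b1 w + G c x b2 w" for b1 b2 using l[of 1 b1 1 b2 w] by simp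
    show "G c x (r *\<^sub>R b) w = r *\<^sub>R G c x b w" for r b using l[of r b 0 0 w] by simp
  qed
  have "linear (G c x u)" for u
  proof -
    have "G c x u = (\<lambda>v. G c x v u)" by (rule ext) (rule s)
    then show ?thesis by (simp only: lin)
  qed
  then show "bilinear (G c x)" unfolding bilinear_def using lin by blast
  show "G c x u u > 0" if "u \<noteq> 0" for u
  proof -
    have "coord_vec A c u p \<noteq> (\<lambda>c. 0)" using coord_vec_same[OF p(1), of u] that by metis
    then show ?thesis unfolding e by (rule g_tangent(3)[OF p(2) T])
  qed
qed

lemma christoffel_chris: "christoffel A g c = chris (G c)"
  by (intro ext) (simp add: christoffel_def chris_def)

lemma chart_change_transition:
  assumes c: "c \<in> A" and d: "d \<in> A"
  shows "chart_change (coords c) (G c) (coords d) (G d) (snd c ` (fst c \<inter> fst d)) (transition c d)"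
proof (intro chart_change.intro chart_riem c d chart_change_axioms.intro)
  show "open (snd c ` (fst c \<inter> fst d))" by (rule open_overlap[OF c chart_properties(1)[OF d]])
  show "snd c ` (fst c \<inter> fst d) \<subseteq> coords c" by auto
  show "smooth_on (snd c ` (fst c \<inter> fst d)) (transition c d)" by (rule smooth_transition[OF c d])
  show "transition c d ` snd c ` (fst c \<inter> fst d) \<subseteq> coords d" using c by (auto simp: transition_apply)
  fix x u v assume "x \<in> snd c ` (fst c \<inter> fst d)"
  then obtain q where q: "x = snd c q" "q \<in> fst c" "q \<in> fst d" by blast
  then have cd: "c \<in> charts_at A q" "d \<in> charts_at A q" using c d by (auto simp: charts_at_def)
  note T = coord_vec_tangent[OF cd(1)]
  have e: "coord_vec A c u q d = dd (transition c d) x u" for u using cd by (simp add: coord_vec_def q(1))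
  have "G c x u v = g q (coord_vec A c u q) (coord_vec A c v q)"
    using metric_comp_eq[OF cd(1) T T, of u v] coord_vec_same[OF cd(1)] q(1) by simp
  also have "\<dots> = G d (transition c d x) (dd (transition c d) x u) (dd (transition c d) x v)"
    using metric_comp_eq[OF cd(2) T T, of u v] e by (simp add: q transition_apply[OF c])
  finally show "G c x u v = G d (transition c d x) (dd (transition c d) x u) (dd (transition c d) x v)" .
qed

abbreviation Gam where "Gam c \<equiv> riemannian_chart.Gam (G c)"
abbreviation Rm where "Rm c \<equiv> riemannian_chart.Rm (G c)"
abbreviation R4 where "R4 c \<equiv> riemannian_chart.R4 (G c)"

lemma christoffel_Gam: "c \<in> A \<Longrightarrow> x \<in> coords c \<Longrightarrow> christoffel A g c x = Gam c x"
  unfolding christoffel_chris by (rule riemannian_chart.chris_eq[OF chart_riem])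

lemma nabla_chart:
  "c \<in> charts_at A p \<Longrightarrow> nabla A g X Y p c = dcomp c Y p (X p c) + Gam c (snd c p) (X p c) (Y p c)"
  by (auto simp: nabla_def christoffel_Gam charts_at_def)

lemma dcomp_coord_vec: "c \<in> charts_at A p \<Longrightarrow> dcomp c (coord_vec A c u) p v = 0"
proof -
  assume c: "c \<in> charts_at A p"
  have "dd (\<lambda>x. coord_vec A c u (chart_inv c x) c) (snd c p) = dd (\<lambda>x. u) (snd c p)"
    by (rule dd_cong_open[OF chart_properties(2)[OF charts_atD(1)[OF c]]])
      (use c charts_atI charts_atD in \<open>auto simp: coord_vec_same\<close>)
  then show ?thesis by (simp add: dcomp_def)
qed

lemma nabla_tangent:
  assumes W: "openin M W" "p \<in> W" and X: "smooth_vfield_on A W X" and Y: "smooth_vfield_on A W Y"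
  shows "nabla A g X Y p \<in> tangent_space A p"
proof (rule tangentI)
  fix c d assume c: "c \<in> charts_at A p" and d: "d \<in> charts_at A p"
  note cA = charts_atD[OF c] and dA = charts_atD[OF d]
  interpret C: chart_change "coords c" "G c" "coords d" "G d" "snd c ` (fst c \<inter> fst d)" "transition c d"
    by (rule chart_change_transition[OF cA(1) dA(1)])
  have T: "X p \<in> tangent_space A p" "Y p \<in> tangent_space A p" using X Y W by (auto simp: smooth_vfield_on_def)
  have x: "snd c p \<in> snd c ` (fst c \<inter> fst d)" using cA dA by auto
  show "nabla A g X Y p d = dd (transition c d) (snd c p) (nabla A g X Y p c)"
    using C.Gam_change[OF x, of "X p c" "Y p c"] dcomp_transition[OF W Y c d, of "X p c"]
      tangentD[OF T(1) c d] tangentD[OF T(2) c d] linear_add[OF C.linear_dphi[OF x]]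
    by (simp add: nabla_chart[OF c] nabla_chart[OF d] transition_apply[OF cA])
qed (simp add: nabla_def)

lemma curvature_at_chart:
  assumes c: "c \<in> charts_at A p"
  shows "curvature_at A g p X Y Z c = Rm c (snd c p) (X c) (Y c) (Z c)"
proof -
  note cA = charts_atD[OF c]
  interpret C: riemannian_chart "coords c" "G c" by (rule chart_riem[OF cA(1)])
  have xS: "snd c p \<in> coords c" using cA by auto
  have n: "nabla A g (coord_vec A c v) (coord_vec A c w) q c = Gam c (snd c q) v w" if "q \<in> fst c" for q v w
  proof -
    have q: "c \<in> charts_at A q" using that cA by (simp add: charts_at_def)
    show ?thesis unfolding nabla_chart[OF q] by (simp add: dcomp_coord_vec[OF q] coord_vec_same[OF q])
  qed
  have nn: "nabla A g (coord_vec A c u) (nabla A g (coord_vec A c v) (coord_vec A c w)) p c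
     = C.DGam (snd c p) u v w + C.Gam (snd c p) u (C.Gam (snd c p) v w)" for u v w
  proof -
    have "dd (\<lambda>x. nabla A g (coord_vec A c v) (coord_vec A c w) (chart_inv c x) c) (snd c p) = dd (\<lambda>x. Gam c x v w) (snd c p)"
      by (rule dd_cong_open[OF C.open_S xS]) (use n chart_inv_in[OF cA(1)] in auto)
    then show ?thesis
      by (subst nabla_chart[OF c]) (simp add: dcomp_def n[OF cA(2)] coord_vec_same[OF c])
  qed
  have l: "lie_bracket A (coord_vec A c u) (coord_vec A c v) p c = 0" for u v
    by (simp add: lie_bracket_def dcomp_coord_vec[OF c])
  have nl: "nabla A g (lie_bracket A (coord_vec A c u) (coord_vec A c v)) (coord_vec A c w) p c = 0" for u v w
    unfolding nabla_chart[OF c] l by (simp add: dcomp_coord_vec[OF c] C.Gam_simps[OF xS])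
  show ?thesis
    using c by (simp add: curvature_at_def curvature_def nn nl C.Rm_def)
qed

lemma curvature_at_tangent:
  assumes T: "X \<in> tangent_space A p" "Y \<in> tangent_space A p" "Z \<in> tangent_space A p"
  shows "curvature_at A g p X Y Z \<in> tangent_space A p"
proof (rule tangentI)
  fix c d assume c: "c \<in> charts_at A p" and d: "d \<in> charts_at A p"
  note cA = charts_atD[OF c] and dA = charts_atD[OF d]
  interpret C: chart_change "coords c" "G c" "coords d" "G d" "snd c ` (fst c \<inter> fst d)" "transition c d"
    by (rule chart_change_transition[OF cA(1) dA(1)])
  have x: "snd c p \<in> snd c ` (fst c \<inter> fst d)" using cA dA by auto
  show "curvature_at A g p X Y Z d = dd (transition c d) (snd c p) (curvature_at A g p X Y Z c)"
    using C.Rm_change[OF x, of "X c" "Y c" "Z c"] tangentD[OF T(1) c d] tangentD[OF T(2) c d] tangentD[OF T(3) c d]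
    by (simp add: curvature_at_chart[OF c] curvature_at_chart[OF d] transition_apply[OF cA])
qed (simp add: curvature_at_def)

lemma g_curvature_at:
  assumes c: "c \<in> charts_at A p" and T: "X \<in> tangent_space A p" "Y \<in> tangent_space A p"
  shows "g p (curvature_at A g p X Y Y) X = R4 c (snd c p) (X c) (Y c) (Y c) (X c)"
  unfolding riemannian_chart.R4_def[OF chart_riem[OF charts_atD(1)[OF c]]]
  by (simp add: metric_comp_eq[OF c curvature_at_tangent[OF T T(2)] T(1), symmetric] curvature_at_chart[OF c])

text \<open>
  The vector \<open>- g(X, Y) X + g(X, X) Y\<close> has squared length \<open>g(X, X)\<close> times the Gram determinant.
\<close>

lemma gram_positive:
  assumes p: "p \<in> topspace M" and b: "plane_basis A p E X Y"
  shows "g p X X * g p Y Y - (g p X Y)\<^sup>2 > 0"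
proof -
  obtain c where c: "c \<in> charts_at A p" using chart_exists[OF p] by blast
  have T: "X \<in> tangent_space A p" "Y \<in> tangent_space A p" using b by (auto simp: plane_basis_def)
  interpret C: riemannian_chart "coords c" "G c" by (rule chart_riem[OF charts_atD(1)[OF c]])
  let ?x = "snd c p"
  have x: "?x \<in> coords c" using charts_atD[OF c] by auto
  note e = metric_comp_eq[OF c T(1) T(1)] metric_comp_eq[OF c T(2) T(2)] metric_comp_eq[OF c T]
  have nz: "a *\<^sub>R X c + b' *\<^sub>R Y c \<noteq> 0" if "a \<noteq> 0 \<or> b' \<noteq> 0" for a b'
  proof
    assume "a *\<^sub>R X c + b' *\<^sub>R Y c = 0"
    then have "lincomb a X b' Y = (\<lambda>c. 0)"
      by (intro tangent_eqI[OF lincomb_tangent[OF T] zero_tangent c]) (simp add: lincomb_def)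
    then show False using b that by (auto simp: plane_basis_def)
  qed
  have X0: "G c ?x (X c) (X c) > 0" using C.pos[OF x, of "X c"] nz[of 1 0] by simp
  let ?a = "G c ?x (X c) (Y c)" and ?n = "G c ?x (X c) (X c)"
  have "0 < G c ?x (- ?a *\<^sub>R X c + ?n *\<^sub>R Y c) (- ?a *\<^sub>R X c + ?n *\<^sub>R Y c)"
    by (rule C.pos[OF x nz]) (use X0 in auto)
  also have "\<dots> = ?n * (?n * G c ?x (Y c) (Y c) - ?a\<^sup>2)"
    using C.sym[OF x, of "Y c" "X c"] unfolding C.gx_simps[OF x] by (simp add: power2_eq_square algebra_simps)
  finally show ?thesis using X0 by (simp add: e zero_less_mult_iff)
qed

text \<open>
  For two bases of the same plane, numerator and denominator both change by the square of the determinant.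
\<close>

lemma sectional_curvature_basis:
  assumes p: "p \<in> topspace M" and b: "plane_basis A p E X Y"
  shows "sectional_curvature A g p E = g p (curvature_at A g p X Y Y) X / (g p X X * g p Y Y - (g p X Y)\<^sup>2)"
  unfolding sectional_curvature_def
proof (rule the_equality)
  obtain c where c: "c \<in> charts_at A p" using chart_exists[OF p] by blast
  interpret C: riemannian_chart "coords c" "G c" by (rule chart_riem[OF charts_atD(1)[OF c]])
  let ?x = "snd c p"
  have x: "?x \<in> coords c" using charts_atD[OF c] by auto
  have cl: "curv_like (C.R4 ?x)" by (rule C.curv_like_R4[OF x])
  show "\<forall>X' Y'. plane_basis A p E X' Y' \<longrightarrow>
    g p (curvature_at A g p X Y Y) X / (g p X X * g p Y Y - (g p X Y)\<^sup>2)
     = g p (curvature_at A g p X' Y' Y') X' / (g p X' X' * g p Y' Y' - (g p X' Y')\<^sup>2)"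
  proof (intro allI impI)
    fix X' Y' assume b': "plane_basis A p E X' Y'"
    have T: "X \<in> tangent_space A p" "Y \<in> tangent_space A p" "X' \<in> tangent_space A p" "Y' \<in> tangent_space A p"
      using b b' by (auto simp: plane_basis_def)
    have "lincomb 1 X' 0 Y' \<in> E" "lincomb 0 X' 1 Y' \<in> E" using b' by (auto simp: plane_basis_def)
    then have "X' \<in> E" "Y' \<in> E" by (simp_all add: lincomb_def)
    then obtain \<alpha> \<beta> \<gamma> \<delta> where ab: "X' = lincomb \<alpha> X \<beta> Y" "Y' = lincomb \<gamma> X \<delta> Y"
      using b by (auto simp: plane_basis_def)
    define D where "D = \<alpha> * \<delta> - \<beta> * \<gamma>"
    define u where "u = X c"
    define v where "v = Y c"
    have e: "X' c = \<alpha> *\<^sub>R u + \<beta> *\<^sub>R v" "Y' c = \<gamma> *\<^sub>R u + \<delta> *\<^sub>R v" by (simp_all add: ab lincomb_def u_def v_def)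
    have z: "C.R4 ?x a a b c = 0" "C.R4 ?x a b c c = 0" for a b c
      using curv_like_skew(1)[OF cl, of a a b c] curv_like_skew(2)[OF cl, of a b c c] by auto
    have R: "C.R4 ?x (X' c) (Y' c) (Y' c) (X' c) = D\<^sup>2 * C.R4 ?x u v v u"
      using curv_like_skew(1)[OF cl, of v u] curv_like_skew(2)[OF cl, of u v u v]
      unfolding e by (simp add: curv_like_simps[OF cl] z D_def power2_eq_square algebra_simps)
    have gr: "G c ?x (X' c) (X' c) * G c ?x (Y' c) (Y' c) - (G c ?x (X' c) (Y' c))\<^sup>2
        = D\<^sup>2 * (G c ?x u u * G c ?x v v - (G c ?x u v)\<^sup>2)"
      using C.sym[OF x, of v u] unfolding e C.gx_simps[OF x]
      by (simp add: D_def power2_eq_square algebra_simps)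
    have gr': "g p X' X' * g p Y' Y' - (g p X' Y')\<^sup>2 = D\<^sup>2 * (g p X X * g p Y Y - (g p X Y)\<^sup>2)"
      using gr unfolding u_def v_def by (simp add: metric_comp_eq[OF c] T)
    then have "D \<noteq> 0" using gram_positive[OF p b'] by auto
    moreover have "g p (curvature_at A g p X' Y' Y') X' = D\<^sup>2 * g p (curvature_at A g p X Y Y) X"
      unfolding g_curvature_at[OF c T(3,4)] g_curvature_at[OF c T(1,2)] R by (simp add: u_def v_def)
    ultimately show "g p (curvature_at A g p X Y Y) X / (g p X X * g p Y Y - (g p X Y)\<^sup>2)
     = g p (curvature_at A g p X' Y' Y') X' / (g p X' X' * g p Y' Y' - (g p X' Y')\<^sup>2)"
      unfolding gr' by simp
  qed
  then show "\<And>k. \<forall>X Y. plane_basis A p E X Y \<longrightarrow> k = g p (curvature_at A g p X Y Y) X / (g p X X * g p Y Y - (g p X Y)\<^sup>2) \<Longrightarrow>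
    k = g p (curvature_at A g p X Y Y) X / (g p X X * g p Y Y - (g p X Y)\<^sup>2)"
    using b by blast
qed

end

section \<open>Hermitian manifolds in charts\<close>

locale herm_mfd =
  fixes M :: "'m topology" and A :: "('m, 'e::euclidean_space) chart set" and g :: "('m, 'e) metric"
    and J :: "('m, 'e) endo"
  assumes herm_M: "hermitian_manifold M A g J"

sublocale herm_mfd \<subseteq> riem_mfd
  using herm_M by unfold_locales (simp add: hermitian_manifold_def almost_hermitian_manifold_def)

context herm_mfd
begin

lemma J_tangent:
  assumes "p \<in> topspace M"
  shows "X \<in> tangent_space A p \<Longrightarrow> J p X \<in> tangent_space A p"
    "X \<in> tangent_space A p \<Longrightarrow> Y \<in> tangent_space A p \<Longrightarrow> J p (lincomb a X b Y) = lincomb a (J p X) b (J p Y)"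
    "X \<in> tangent_space A p \<Longrightarrow> J p (J p X) = (\<lambda>c. - X c)"
    "X \<in> tangent_space A p \<Longrightarrow> Y \<in> tangent_space A p \<Longrightarrow> g p (J p X) (J p Y) = g p X Y"
  using herm_M assms
  unfolding hermitian_manifold_def almost_hermitian_manifold_def almost_complex_structure_def by blast+

definition Jc :: "('m, 'e) chart \<Rightarrow> 'e \<Rightarrow> 'e \<Rightarrow> 'e" where
  "Jc c x u = J (chart_inv c x) (coord_vec A c u (chart_inv c x)) c"

lemma J_chart: "c \<in> charts_at A p \<Longrightarrow> X \<in> tangent_space A p \<Longrightarrow> J p X c = Jc c (snd c p) (X c)"
  by (simp add: Jc_def chart_inv[OF charts_atD] tangent_coord_vec)

lemma smooth_Jc: "c \<in> A \<Longrightarrow> smooth_on (coords c) (\<lambda>x. Jc c x u)"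
  using herm_M
  unfolding hermitian_manifold_def almost_hermitian_manifold_def almost_complex_structure_def Jc_def by blast

lemma chart_point:
  assumes "c \<in> A" "x \<in> coords c"
  shows "c \<in> charts_at A (chart_inv c x)" "chart_inv c x \<in> topspace M" "snd c (chart_inv c x) = x"
  using charts_atI[OF assms] chart_in_topspace chart_inv_in[OF assms] by auto

lemma hermitian_form_chart:
  assumes c: "c \<in> A" and x: "x \<in> coords c"
  shows "hermitian_form (G c x) (Jc c x)"
proof -
  interpret C: riemannian_chart "coords c" "G c" by (rule chart_riem[OF c])
  let ?p = "chart_inv c x"
  note p = chart_point[OF c x]
  note T = coord_vec_tangent[OF p(1)] and same = coord_vec_same[OF p(1)]
  have Jcoord: "J ?p (coord_vec A c u ?p) = coord_vec A c (Jc c x u) ?p" for u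
    by (rule tangent_eqI[OF J_tangent(1)[OF p(2) T] T p(1)]) (simp add: same Jc_def)
  have lin: "Jc c x (a *\<^sub>R u + b *\<^sub>R v) = a *\<^sub>R Jc c x u + b *\<^sub>R Jc c x v" for a b u v
    unfolding Jc_def coord_vec_lincomb[OF p(1)] J_tangent(2)[OF p(2) T T] by (simp add: lincomb_def)
  show ?thesis
  proof (intro hermitian_form.intro C.bil[OF x] C.sym[OF x] C.pos[OF x])
    show "linear (Jc c x)"
    proof (rule linearI)
      show "Jc c x (u + v) = Jc c x u + Jc c x v" for u v using lin[of 1 u 1 v] by simp
      show "Jc c x (r *\<^sub>R u) = r *\<^sub>R Jc c x u" for r u using lin[of r u 0 0] by simp
    qed
    fix u v
    have "Jc c x (Jc c x u) = J ?p (J ?p (coord_vec A c u ?p)) c"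
      by (simp add: Jcoord same)
    then show "Jc c x (Jc c x u) = - u" by (simp add: J_tangent(3)[OF p(2) T] same)
    have "G c x (Jc c x u) (Jc c x v) = g ?p (J ?p (coord_vec A c u ?p)) (J ?p (coord_vec A c v ?p))"
      by (simp add: metric_comp_def Jcoord)
    then show "G c x (Jc c x u) (Jc c x v) = G c x u v"
      by (simp add: J_tangent(4)[OF p(2) T T] metric_comp_def)
  qed
qed

lemma apply_endo_chart:
  assumes W: "openin M W" and Y: "smooth_vfield_on A W Y" and c: "c \<in> A" and x: "x \<in> snd c ` (fst c \<inter> W)"
  shows "apply_endo J Y (chart_inv c x) c = Jc c x (Y (chart_inv c x) c)"
proof -
  have xd: "x \<in> coords c" using x by auto
  have "chart_inv c x \<in> W" using x chart_inv[OF c] by auto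
  then have "Y (chart_inv c x) \<in> tangent_space A (chart_inv c x)" using Y by (auto simp: smooth_vfield_on_def)
  from J_chart[OF chart_point(1)[OF c xd] this] show ?thesis
    by (simp add: apply_endo_def chart_point(3)[OF c xd])
qed

lemma apply_endo_smooth:
  assumes W: "openin M W" and X: "smooth_vfield_on A W X"
  shows "smooth_vfield_on A W (apply_endo J X)"
  unfolding smooth_vfield_on_def
proof (intro conjI ballI)
  fix p assume p: "p \<in> W"
  then show "apply_endo J X p \<in> tangent_space A p"
    using X openin_subset[OF W] J_tangent(1)[of p "X p"] by (auto simp: apply_endo_def smooth_vfield_on_def)
next
  fix c assume c: "c \<in> A"
  let ?V = "snd c ` (fst c \<inter> W)"
  have oV: "open ?V" by (rule open_overlap[OF c W])
  have sub: "?V \<subseteq> coords c" by auto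
  have l: "linear (Jc c y)" if "y \<in> ?V" for y
    using hermitian_form.lin_J[OF hermitian_form_chart[OF c]] that by auto
  have "smooth_on ?V (\<lambda>x. Jc c x (X (chart_inv c x) c))"
    by (rule smooth_on_apply_linear[OF oV l smooth_on_subset[OF smooth_Jc[OF c] sub]])
      (use X c in \<open>auto simp: smooth_vfield_on_def\<close>)
  then show "smooth_on ?V (\<lambda>x. apply_endo J X (chart_inv c x) c)"
    by (subst smooth_on_cong[OF oV apply_endo_chart[OF W X c]])
qed

lemma dcomp_apply_endo:
  assumes W: "openin M W" "p \<in> W" and Y: "smooth_vfield_on A W Y" and c: "c \<in> charts_at A p"
  shows "dcomp c (apply_endo J Y) p u = dd (\<lambda>x. Jc c x (Y p c)) (snd c p) u + Jc c (snd c p) (dcomp c Y p u)"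
proof -
  note cA = charts_atD[OF c]
  let ?V = "snd c ` (fst c \<inter> W)" and ?x = "snd c p"
  have oV: "open ?V" by (rule open_overlap[OF cA(1) W(1)])
  have xV: "?x \<in> ?V" using cA W by auto
  have l: "linear (Jc c y)" if "y \<in> ?V" for y
    using hermitian_form.lin_J[OF hermitian_form_chart[OF cA(1)]] that by auto
  have d: "(\<lambda>y. Jc c y v) differentiable at ?x" for v
    by (rule smooth_on_differentiable[OF smooth_Jc[OF cA(1)]]) (use cA in auto)
  have 1: "((\<lambda>x. Jc c x (Y (chart_inv c x) c)) has_derivative
     (\<lambda>u. dd (\<lambda>x. Jc c x (Y (chart_inv c ?x) c)) ?x u + Jc c ?x (dcomp c Y p u))) (at ?x)"
    unfolding dcomp_def by (rule has_derivative_apply_linear[OF oV xV l d vfield_diff[OF W Y c]])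
  have "dd (\<lambda>x. apply_endo J Y (chart_inv c x) c) ?x = dd (\<lambda>x. Jc c x (Y (chart_inv c x) c)) ?x"
    by (rule dd_cong_open[OF oV xV apply_endo_chart[OF W(1) Y cA(1)]])
  then show ?thesis unfolding dcomp_def[of c "apply_endo J Y"] dd_eqI[OF 1] by (simp add: chart_inv[OF cA])
qed

lemma integrable_chart:
  assumes c: "c \<in> A" and x: "x \<in> coords c"
  shows "dd (\<lambda>y. Jc c y v) x (Jc c x u) - dd (\<lambda>y. Jc c y u) x (Jc c x v)
       + Jc c x (dd (\<lambda>y. Jc c y u) x v) - Jc c x (dd (\<lambda>y. Jc c y v) x u) = 0"
proof -
  let ?p = "chart_inv c x" and ?X = "coord_vec A c u" and ?Y = "coord_vec A c v"
  note p = chart_point[OF c x]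
  interpret H: hermitian_form "G c x" "Jc c x" by (rule hermitian_form_chart[OF c x])
  have W: "openin M (fst c)" "?p \<in> fst c" using chart_properties(1)[OF c] charts_atD[OF p(1)] by auto
  note XY = coord_vec_smooth[OF c, of u] coord_vec_smooth[OF c, of v]
  note JX = apply_endo_smooth[OF W(1) XY(1)] and JY = apply_endo_smooth[OF W(1) XY(2)]
  have J0: "Jc c x 0 = 0" by (rule H.J_simps)
  have dX: "dcomp c (coord_vec A c w) ?p a = 0" for w a by (rule dcomp_coord_vec[OF p(1)])
  have dJ: "dcomp c (apply_endo J (coord_vec A c w)) ?p a = dd (\<lambda>y. Jc c y w) x a" for w a
    using dcomp_apply_endo[OF W coord_vec_smooth[OF c] p(1), of w a] by (simp add: dX J0 p(3) coord_vec_same[OF p(1)])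
  have Jp: "apply_endo J (coord_vec A c w) ?p c = Jc c x w" for w
    using J_chart[OF p(1) coord_vec_tangent[OF p(1)], of w] by (simp add: apply_endo_def p(3) coord_vec_same[OF p(1)])
  have Jl: "apply_endo J (lie_bracket A P Q) ?p c = Jc c x (lie_bracket A P Q ?p c)"
    if "smooth_vfield_on A (fst c) P" "smooth_vfield_on A (fst c) Q" for P Q
    using J_chart[OF p(1) lie_bracket_tangent[OF W that]] by (simp add: apply_endo_def p(3))
  have lb: "lie_bracket A P Q ?p c = dcomp c Q ?p (P ?p c) - dcomp c P ?p (Q ?p c)" for P Q
    using p(1) by (simp add: lie_bracket_def)
  have "nijenhuis A J ?X ?Y ?p = (\<lambda>c. 0)"
    using herm_M W XY unfolding hermitian_manifold_def integrable_structure_def by blast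
  then have "nijenhuis A J ?X ?Y ?p c = 0" by simp
  then show ?thesis
    unfolding nijenhuis_def Jl[OF JX XY(2)] Jl[OF XY(1) JY] lb
    by (simp add: dX dJ Jp coord_vec_same[OF p(1)] H.J_simps)
qed

text \<open>
  If the vectors are independent they span an antiholomorphic plane; otherwise both sides are zero.
\<close>

lemma antiholomorphic_chart:
  assumes c: "c \<in> A" and x: "x \<in> coords c" and o: "G c x (Jc c x u) v = 0"
    and \<nu>: "\<And>p E. p \<in> topspace M \<Longrightarrow> antiholomorphic_plane A g J p E \<Longrightarrow> sectional_curvature A g p E = \<nu> p"
  shows "R4 c x u v v u = \<nu> (chart_inv c x) * (G c x u u * G c x v v - (G c x u v)\<^sup>2)"
proof -
  let ?p = "chart_inv c x"
  note p = chart_point[OF c x]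
  note T = coord_vec_tangent[OF p(1)] and same = coord_vec_same[OF p(1)]
  interpret H: hermitian_form "G c x" "Jc c x" by (rule hermitian_form_chart[OF c x])
  interpret C: riemannian_chart "coords c" "G c" by (rule chart_riem[OF c])
  have cl: "curv_like (C.R4 x)" by (rule C.curv_like_R4[OF x])
  have z: "C.R4 x a a b d = 0" for a b d using curv_like_skew(1)[OF cl, of a a b d] by simp
  define X where "X = coord_vec A c u ?p"
  define Y where "Y = coord_vec A c v ?p"
  have XY: "X \<in> tangent_space A ?p" "Y \<in> tangent_space A ?p" "X c = u" "Y c = v"
    using T same by (auto simp: X_def Y_def)
  show ?thesis
  proof (cases "\<exists>a b. (a \<noteq> 0 \<or> b \<noteq> 0) \<and> a *\<^sub>R u + b *\<^sub>R v = 0")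
    case True
    then obtain a b where ab: "a \<noteq> 0 \<or> b \<noteq> 0" "a *\<^sub>R u + b *\<^sub>R v = 0" by blast
    have "(\<exists>k. u = k *\<^sub>R v) \<or> (\<exists>k. v = k *\<^sub>R u)"
    proof (cases "a = 0")
      case True
      then show ?thesis using ab by (intro disjI2 exI[of _ 0]) auto
    next
      case False
      have "a *\<^sub>R u = - (b *\<^sub>R v)" using ab(2) by (simp add: eq_neg_iff_add_eq_0)
      then have "(1 / a) *\<^sub>R (a *\<^sub>R u) = (- b / a) *\<^sub>R v" by simp
      then have "u = (- b / a) *\<^sub>R v" using False by simp
      then show ?thesis by blast
    qed
    then show ?thesis
      by (auto simp: z curv_like_simps[OF cl] C.gx_simps[OF x] power2_eq_square)
  next
    case False
    define E where "E = {lincomb a X b Y | a b. True}"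
    have pb: "plane_basis A ?p E X Y"
      unfolding plane_basis_def
    proof (intro conjI XY(1,2) allI impI E_def)
      fix a b assume "lincomb a X b Y = (\<lambda>c. 0)"
      then have "lincomb a X b Y c = 0" by simp
      then have "a *\<^sub>R u + b *\<^sub>R v = 0" by (simp add: lincomb_def XY)
      then show "a = 0" "b = 0" using False by blast+
    qed
    have "antiholomorphic_plane A g J ?p E"
      unfolding antiholomorphic_plane_def two_plane_def
    proof (intro conjI ballI)
      show "\<exists>X Y. plane_basis A ?p E X Y" using pb by blast
      fix P Q assume PQ: "P \<in> E" "Q \<in> E"
      then have TT: "P \<in> tangent_space A ?p" "Q \<in> tangent_space A ?p"
        using lincomb_tangent[OF XY(1,2)] by (auto simp: E_def)
      obtain a b a' b' where e: "P c = a *\<^sub>R u + b *\<^sub>R v" "Q c = a' *\<^sub>R u + b' *\<^sub>R v"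
        using PQ XY(3,4) by (auto simp: E_def lincomb_def)
      have "g ?p P (J ?p Q) = G c x (P c) (Jc c x (Q c))"
        using metric_comp_eq[OF p(1) TT(1) J_tangent(1)[OF p(2) TT(2)]] J_chart[OF p(1) TT(2)] by (simp add: p(3))
      also have "\<dots> = 0"
        unfolding e using o H.sym_g[of v "Jc c x u"] H.g_J_right[of u v]
        by (simp add: H.J_simps H.g_simps)
      finally show "g ?p P (J ?p Q) = 0" .
    qed
    from \<nu>[OF p(2) this] have "g ?p (curvature_at A g ?p X Y Y) X
        = \<nu> ?p * (g ?p X X * g ?p Y Y - (g ?p X Y)\<^sup>2)"
      unfolding sectional_curvature_basis[OF p(2) pb] using gram_positive[OF p(2) pb] by (simp add: field_simps)
    then show ?thesis
      unfolding g_curvature_at[OF p(1) XY(1,2)] metric_comp_eq[OF p(1) XY(1,1), symmetric]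
        metric_comp_eq[OF p(1) XY(2,2), symmetric] metric_comp_eq[OF p(1) XY(1,2), symmetric]
      by (simp add: p(3) XY)
  qed
qed

lemma hermitian_chart:
  assumes c: "c \<in> A" and dim: "DIM('e) \<ge> 6"
    and \<nu>: "\<And>p E. p \<in> topspace M \<Longrightarrow> antiholomorphic_plane A g J p E \<Longrightarrow> sectional_curvature A g p E = \<nu> p"
  shows "hermitian_chart (coords c) (G c) (Jc c) (\<lambda>x. \<nu> (chart_inv c x))"
proof (intro hermitian_chart.intro chart_riem[OF c] hermitian_chart_axioms.intro dim)
  fix x u v assume x: "x \<in> coords c"
  interpret H: hermitian_form "G c x" "Jc c x" by (rule hermitian_form_chart[OF c x])
  show "linear (Jc c x)" by (rule H.lin_J)
  show "Jc c x (Jc c x u) = - u" by (rule H.JJ)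
  show "G c x (Jc c x u) (Jc c x v) = G c x u v" by (rule H.g_JJ)
  show "dd (\<lambda>y. Jc c y v) x (Jc c x u) - dd (\<lambda>y. Jc c y u) x (Jc c x v)
       + Jc c x (dd (\<lambda>y. Jc c y u) x v) - Jc c x (dd (\<lambda>y. Jc c y v) x u) = 0"
    by (rule integrable_chart[OF c x])
  show "R4 c x u v v u = \<nu> (chart_inv c x) * (G c x u u * G c x v v - (G c x u v)\<^sup>2)" if "G c x (Jc c x u) v = 0"
    by (rule antiholomorphic_chart[OF c x that \<nu>])
next
  show "smooth_on (coords c) (\<lambda>x. Jc c x u)" for u by (rule smooth_Jc[OF c])
qed

lemma nabla_endo_chart:
  assumes W: "openin M W" "p \<in> W" and X: "smooth_vfield_on A W X" and Y: "smooth_vfield_on A W Y"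
    and c: "c \<in> charts_at A p"
  shows "nabla_endo A g J X Y p c = dd (\<lambda>x. Jc c x (Y p c)) (snd c p) (X p c)
     + Gam c (snd c p) (X p c) (Jc c (snd c p) (Y p c)) - Jc c (snd c p) (Gam c (snd c p) (X p c) (Y p c))"
proof -
  note cA = charts_atD[OF c]
  have x: "snd c p \<in> coords c" using cA by auto
  interpret H: hermitian_form "G c (snd c p)" "Jc c (snd c p)" by (rule hermitian_form_chart[OF cA(1) x])
  have T: "Y p \<in> tangent_space A p" using Y W by (auto simp: smooth_vfield_on_def)
  have 1: "apply_endo J Y p c = Jc c (snd c p) (Y p c)"
    using J_chart[OF c T] by (simp add: apply_endo_def)
  have 2: "apply_endo J (nabla A g X Y) p c = Jc c (snd c p) (dcomp c Y p (X p c) + Gam c (snd c p) (X p c) (Y p c))"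
    using J_chart[OF c nabla_tangent[OF W X Y]] by (simp add: apply_endo_def nabla_chart[OF c])
  show ?thesis
    unfolding nabla_endo_def 2 nabla_chart[OF c] 1 by (simp add: dcomp_apply_endo[OF W Y c] H.J_simps)
qed

end

text \<open>
  A predicate that is expressed in every chart by the vanishing of smooth functions is a closed condition.
\<close>

lemma (in mfd) open_nonvanishing:
  fixes F :: "('m, 'e) chart \<Rightarrow> 'u \<Rightarrow> 'v \<Rightarrow> 'e \<Rightarrow> real"
  assumes smooth: "\<And>c u v. c \<in> A \<Longrightarrow> smooth_on (snd c ` fst c) (F c u v)"
    and P: "\<And>p c. c \<in> charts_at A p \<Longrightarrow> P p \<longleftrightarrow> (\<forall>u v. F c u v (snd c p) = 0)"
  shows "openin M {p \<in> topspace M. \<not> P p}"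
proof (subst openin_subopen, intro ballI)
  fix p assume p: "p \<in> {p \<in> topspace M. \<not> P p}"
  then obtain c where c: "c \<in> charts_at A p" using chart_exists by blast
  note cA = charts_atD[OF c]
  obtain u v where uv: "F c u v (snd c p) \<noteq> 0" using p P[OF c] by blast
  define N where "N = {q \<in> fst c. snd c q \<in> {x \<in> snd c ` fst c. F c u v x \<noteq> 0}}"
  have "openin M N" unfolding N_def
    by (rule open_preimage[OF cA(1) open_nonzero_set[OF chart_properties(2)[OF cA(1)] smooth[OF cA(1)]]])
  moreover have "p \<in> N" using cA uv by (simp add: N_def)
  moreover have "N \<subseteq> {p \<in> topspace M. \<not> P p}"
  proof
    fix q assume q: "q \<in> N"
    have cq: "c \<in> charts_at A q" using q cA by (simp add: N_def charts_at_def)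
    have "F c u v (snd c q) \<noteq> 0" using q by (simp add: N_def)
    then have "\<not> P q" using P[OF cq] by blast
    moreover have "q \<in> topspace M" using q chart_properties(4)[OF cA(1)] by (auto simp: N_def)
    ultimately show "q \<in> {p \<in> topspace M. \<not> P p}" by simp
  qed
  ultimately show "\<exists>T. openin M T \<and> p \<in> T \<and> T \<subseteq> {p \<in> topspace M. \<not> P p}" by blast
qed

section \<open>Locally constant functions on a connected space\<close>

lemma connected_space_locally_constant:
  assumes "connected_space M" and "p \<in> topspace M" "q \<in> topspace M"
    and loc: "\<And>p. p \<in> topspace M \<Longrightarrow> \<exists>N. openin M N \<and> p \<in> N \<and> (\<forall>q\<in>N. f q = f p)"
  shows "f q = f p"
proof -
  have op: "openin M {q \<in> topspace M. P (f q)}" for P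
  proof (subst openin_subopen, intro ballI)
    fix x assume x: "x \<in> {q \<in> topspace M. P (f q)}"
    then obtain N where N: "openin M N" "x \<in> N" "\<forall>q\<in>N. f q = f x" using loc by blast
    have "N \<subseteq> {q \<in> topspace M. P (f q)}"
    proof
      fix q assume q: "q \<in> N"
      then have "P (f q)" using N(3) x by simp
      moreover have "q \<in> topspace M" using q openin_subset[OF N(1)] by blast
      ultimately show "q \<in> {q \<in> topspace M. P (f q)}" by simp
    qed
    then show "\<exists>T. openin M T \<and> x \<in> T \<and> T \<subseteq> {q \<in> topspace M. P (f q)}" using N by blast
  qed
  have "closedin M {r \<in> topspace M. f r = f p}"
  proof -
    have "topspace M - {r \<in> topspace M. f r = f p} = {r \<in> topspace M. f r \<noteq> f p}" by auto
    then show ?thesis using op[of "\<lambda>y. y \<noteq> f p"] by (simp add: closedin_def)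
  qed
  then have "{r \<in> topspace M. f r = f p} = {} \<or> {r \<in> topspace M. f r = f p} = topspace M"
    using assms(1) op[of "\<lambda>y. y = f p"] unfolding connected_space_clopen_in by blast
  then show ?thesis using assms(2,3) by auto
qed

section \<open>Constancy of the sectional curvature\<close>

theorem theoremA:
  fixes M :: "'m topology"
    and A :: "('m, 'e::euclidean_space) chart set"
    and g :: "('m, 'e) metric"
    and J :: "('m, 'e) endo"
    and n :: nat
  assumes "hermitian_manifold M A g J"
    and "connected_space M"
    and "DIM('e) = 2 * n"
    and "2 * n > 4"
    and "\<not> kaehler_manifold M A g J"
    and "pointwise_constant_antiholomorphic_curvature M A g J"
  shows "constant_sectional_curvature M A g"
proof -
  interpret herm_mfd M A g J by unfold_locales (rule assms(1))
  have dim: "DIM('e) \<ge> 6" using assms(3,4) by simp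
  obtain \<nu> where \<nu>: "\<And>p E. p \<in> topspace M \<Longrightarrow> antiholomorphic_plane A g J p E \<Longrightarrow> sectional_curvature A g p E = \<nu> p"
    using assms(6) unfolding pointwise_constant_antiholomorphic_curvature_def by blast
  note hc = hermitian_chart[OF _ dim \<nu>]
  have const: "\<nu> q = \<nu> p" if "p \<in> topspace M" "q \<in> topspace M" for p q
  proof (rule connected_space_locally_constant[OF assms(2) that])
    fix p assume "p \<in> topspace M"
    then obtain c where c: "c \<in> charts_at A p" using chart_exists by blast
    note cA = charts_atD[OF c]
    interpret C: hermitian_chart "coords c" "G c" "Jc c" "\<lambda>x. \<nu> (chart_inv c x)" by (rule hc[OF cA(1)])
    have x: "snd c p \<in> coords c" using cA by auto
    then obtain e where e: "e > 0" "ball (snd c p) e \<subseteq> coords c" using C.open_S open_contains_ball by blast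
    have "((\<lambda>x. \<nu> (chart_inv c x)) has_derivative (\<lambda>w. 0)) (at y within ball (snd c p) e)"
      if "y \<in> ball (snd c p) e" for y
    proof -
      have y: "y \<in> coords c" using e that by auto
      have "dd (\<lambda>x. \<nu> (chart_inv c x)) y = (\<lambda>w. 0)" using C.dnu_zero_everywhere[OF y] by auto
      then show ?thesis using dd_works[OF C.nu_diff[OF y]] has_derivative_at_withinI by metis
    qed
    then obtain k where k: "\<And>y. y \<in> ball (snd c p) e \<Longrightarrow> \<nu> (chart_inv c y) = k"
      using has_derivative_zero_constant[OF convex_ball, of "snd c p" e "\<lambda>x. \<nu> (chart_inv c x)"] by blast
    have "\<nu> q = k" if "q \<in> fst c" "snd c q \<in> ball (snd c p) e" for q
      using k[OF that(2)] by (simp add: chart_inv[OF cA(1) that(1)])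
    moreover have "snd c p \<in> ball (snd c p) e" using e by simp
    ultimately show "\<exists>N. openin M N \<and> p \<in> N \<and> (\<forall>q\<in>N. \<nu> q = \<nu> p)"
      using open_preimage[OF cA(1) open_ball, of "snd c p" e] cA
      by (intro exI[of _ "{q \<in> fst c. snd c q \<in> ball (snd c p) e}"]) auto
  qed
  \<comment> \<open>a point where \<open>J\<close> is not parallel\<close>
  obtain W X Y p0 where W: "openin M W" "p0 \<in> W" "smooth_vfield_on A W X" "smooth_vfield_on A W Y"
    and ne: "nabla_endo A g J X Y p0 \<noteq> (\<lambda>c. 0)"
    using assms(1,5) unfolding kaehler_manifold_def by blast
  have p0: "p0 \<in> topspace M" using W openin_subset by blast
  define \<kappa> where "\<kappa> = \<nu> p0"
  \<comment> \<open>\<open>f1\<close> and \<open>f2\<close> vanish where the curvature is that of a space of constant sectional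
    curvature \<open>\<kappa>\<close>, respectively of constant holomorphic sectional curvature \<open>4 \<kappa>\<close>\<close>
  define f1 where "f1 c u v x = R4 c x u v v u - \<kappa> * (G c x u u * G c x v v - G c x u v * G c x u v)" for c u v x
  define f2 where "f2 c u v x = f1 c u v x - 3 * \<kappa> * (G c x (Jc c x u) v * G c x (Jc c x u) v)" for c u v x
  have smooth_f: "smooth_on (coords c) (f1 c u v)" "smooth_on (coords c) (f2 c u v)" if c: "c \<in> A" for c u v
  proof -
    interpret C: hermitian_chart "coords c" "G c" "Jc c" "\<lambda>x. \<nu> (chart_inv c x)" by (rule hc[OF c])
    show 1: "smooth_on (coords c) (f1 c u v)"
      unfolding f1_def by (intro smooth_on_diff smooth_on_mult C.smooth_R4 C.smooth smooth_on_const C.open_S)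
    have "smooth_on (coords c) (\<lambda>x. G c x (Jc c x u) v)"
      by (rule smooth_on_apply_linear[OF C.open_S C.g_lin(2) C.smooth C.J_smooth])
    then show "smooth_on (coords c) (f2 c u v)"
      unfolding f2_def by (intro smooth_on_diff smooth_on_mult 1 smooth_on_const C.open_S)
  qed
  define P1 where "P1 p \<longleftrightarrow> (\<forall>X\<in>tangent_space A p. \<forall>Y\<in>tangent_space A p.
    g p (curvature_at A g p X Y Y) X = \<kappa> * (g p X X * g p Y Y - (g p X Y)\<^sup>2))" for p
  define P2 where "P2 p \<longleftrightarrow> (\<forall>X\<in>tangent_space A p. \<forall>Y\<in>tangent_space A p.
    g p (curvature_at A g p X Y Y) X = \<kappa> * (g p X X * g p Y Y - (g p X Y)\<^sup>2 + 3 * (g p (J p X) Y)\<^sup>2))" for p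
  have P1: "P1 p \<longleftrightarrow> (\<forall>u v. f1 c u v (snd c p) = 0)" and P2: "P2 p \<longleftrightarrow> (\<forall>u v. f2 c u v (snd c p) = 0)"
    if c: "c \<in> charts_at A p" for c p
  proof -
    have p: "p \<in> topspace M" by (rule chart_in_topspace[OF c])
    have e1: "f1 c (X c) (Y c) (snd c p) = g p (curvature_at A g p X Y Y) X - \<kappa> * (g p X X * g p Y Y - (g p X Y)\<^sup>2)"
      and e2: "f2 c (X c) (Y c) (snd c p) = g p (curvature_at A g p X Y Y) X - \<kappa> * (g p X X * g p Y Y - (g p X Y)\<^sup>2 + 3 * (g p (J p X) Y)\<^sup>2)"
      if T: "X \<in> tangent_space A p" "Y \<in> tangent_space A p" for X Y
    proof -
      have "G c (snd c p) (Jc c (snd c p) (X c)) (Y c) = g p (J p X) Y"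
        using metric_comp_eq[OF c J_tangent(1)[OF p T(1)] T(2)] J_chart[OF c T(1)] by simp
      then show "f1 c (X c) (Y c) (snd c p) = g p (curvature_at A g p X Y Y) X - \<kappa> * (g p X X * g p Y Y - (g p X Y)\<^sup>2)"
       "f2 c (X c) (Y c) (snd c p) = g p (curvature_at A g p X Y Y) X - \<kappa> * (g p X X * g p Y Y - (g p X Y)\<^sup>2 + 3 * (g p (J p X) Y)\<^sup>2)"
        unfolding f2_def f1_def g_curvature_at[OF c T] metric_comp_eq[OF c T(1,1)] metric_comp_eq[OF c T(2,2)] metric_comp_eq[OF c T]
        by (simp_all add: power2_eq_square algebra_simps)
    qed
    have cv: "\<exists>X\<in>tangent_space A p. X c = u" for u
      using coord_vec_tangent[OF c] coord_vec_same[OF c] by blast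
    have allT: "(\<forall>u v. f u v = (0::real)) \<longleftrightarrow> (\<forall>X\<in>tangent_space A p. \<forall>Y\<in>tangent_space A p. f (X c) (Y c) = 0)" for f
      using cv by metis
    show "P1 p \<longleftrightarrow> (\<forall>u v. f1 c u v (snd c p) = 0)"
      unfolding P1_def allT[of "\<lambda>u v. f1 c u v (snd c p)"] by (simp add: e1 cong: ball_cong)
    show "P2 p \<longleftrightarrow> (\<forall>u v. f2 c u v (snd c p) = 0)"
      unfolding P2_def allT[of "\<lambda>u v. f2 c u v (snd c p)"] by (simp add: e2 cong: ball_cong)
  qed
  have dich: "P1 p \<or> P2 p" if p: "p \<in> topspace M" for p
  proof -
    obtain c where c: "c \<in> charts_at A p" using chart_exists[OF p] by blast
    note cA = charts_atD[OF c]
    interpret C: hermitian_chart "coords c" "G c" "Jc c" "\<lambda>x. \<nu> (chart_inv c x)" by (rule hc[OF cA(1)])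
    have x: "snd c p \<in> coords c" using cA by auto
    have "\<nu> (chart_inv c (snd c p)) = \<kappa>" using const[OF p0 p] by (simp add: chart_inv[OF cA] \<kappa>_def)
    then show ?thesis
      using C.sectional_dichotomy[OF x] unfolding P1[OF c] P2[OF c] f1_def f2_def
      by (auto simp: power2_eq_square algebra_simps)
  qed
  have open1: "openin M {p \<in> topspace M. \<not> P1 p}" by (rule open_nonvanishing[OF smooth_f(1) P1])
  have open2: "openin M {p \<in> topspace M. \<not> P2 p}" by (rule open_nonvanishing[OF smooth_f(2) P2])
  have P1_p0: "P1 p0"
  proof -
    have XY: "X p0 \<in> tangent_space A p0" "Y p0 \<in> tangent_space A p0" using W by (auto simp: smooth_vfield_on_def)
    obtain c where c: "nabla_endo A g J X Y p0 c \<noteq> 0" using ne by (meson ext)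
    have cc: "c \<in> charts_at A p0"
    proof (rule ccontr)
      assume n: "c \<notin> charts_at A p0"
      have "apply_endo J (nabla A g X Y) p0 \<in> tangent_space A p0"
        unfolding apply_endo_def by (rule J_tangent(1)[OF p0 nabla_tangent[OF W]])
      then have "apply_endo J (nabla A g X Y) p0 c = 0" by (rule tangent_outside) (rule n)
      then show False using c n by (simp add: nabla_endo_def nabla_def[of A g X "apply_endo J Y"])
    qed
    note cA = charts_atD[OF cc]
    interpret C: hermitian_chart "coords c" "G c" "Jc c" "\<lambda>x. \<nu> (chart_inv c x)" by (rule hc[OF cA(1)])
    have x: "snd c p0 \<in> coords c" using cA by auto
    have "nabla_endo A g J X Y p0 c = C.nabla_J (snd c p0) (X p0 c) (Y p0 c)"
      unfolding nabla_endo_chart[OF W cc] C.nabla_J_def ..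
    then have "C.nabla_J (snd c p0) (X p0 c) (Y p0 c) \<noteq> 0" using c by simp
    then have "C.nabla_om (snd c p0) (X p0 c) (Y p0 c) (C.nabla_J (snd c p0) (X p0 c) (Y p0 c)) \<noteq> 0"
      unfolding C.nabla_om_def using C.pos[OF x] by fastforce
    then have "snd c p0 \<in> C.non_kaehler" unfolding C.non_kaehler_def using x by blast
    note sec = C.non_kaehler_sectional[OF this]
    show ?thesis
      unfolding P1[OF cc] f1_def sec chart_inv[OF cA] \<kappa>_def by (simp add: power2_eq_square)
  qed
  have all: "P1 p" if p: "p \<in> topspace M" for p
  proof (cases "\<kappa> = 0")
    case True
    then show ?thesis using dich[OF p] by (simp add: P1_def P2_def)
  next
    case False
    \<comment> \<open>the two curvature forms differ on the plane of \<open>X\<close> and \<open>J X\<close>\<close>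
    have not_both: "\<not> (P1 q \<and> P2 q)" if q: "q \<in> topspace M" for q
    proof
      assume PP: "P1 q \<and> P2 q"
      obtain c where c: "c \<in> charts_at A q" using chart_exists[OF q] by blast
      obtain u :: 'e where "u \<in> Basis" using nonempty_Basis by blast
      then have u: "u \<noteq> 0" by auto
      define X where "X = coord_vec A c u q"
      have X: "X \<in> tangent_space A q" unfolding X_def by (rule coord_vec_tangent[OF c])
      have "X \<noteq> (\<lambda>c. 0)" using coord_vec_same[OF c, of u] u unfolding X_def by metis
      then have "g q X X > 0" by (rule g_tangent(3)[OF q X])
      moreover have JX: "J q X \<in> tangent_space A q" by (rule J_tangent(1)[OF q X])
      have "\<kappa> * (g q X X * g q (J q X) (J q X) - (g q X (J q X))\<^sup>2)
        = \<kappa> * (g q X X * g q (J q X) (J q X) - (g q X (J q X))\<^sup>2 + 3 * (g q (J q X) (J q X))\<^sup>2)"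
        using PP X JX unfolding P1_def P2_def by metis
      then have "g q (J q X) (J q X) = 0" using False by simp
      ultimately show False using J_tangent(4)[OF q X X] by simp
    qed
    have "{q \<in> topspace M. P1 q} = {q \<in> topspace M. \<not> P2 q}" using dich not_both by blast
    then have o: "openin M {q \<in> topspace M. P1 q}" using open2 by simp
    have "topspace M - {q \<in> topspace M. P1 q} = {q \<in> topspace M. \<not> P1 q}" by blast
    then have "closedin M {q \<in> topspace M. P1 q}" using open1 by (simp add: closedin_def)
    then have "{q \<in> topspace M. P1 q} = {} \<or> {q \<in> topspace M. P1 q} = topspace M"
      using assms(2) o unfolding connected_space_clopen_in by blast
    then show ?thesis using P1_p0 p0 p by blast
  qed
  show ?thesis
    unfolding constant_sectional_curvature_def two_plane_def
  proof (intro exI[of _ \<kappa>] ballI allI impI)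
    fix p E assume p: "p \<in> topspace M" and "\<exists>X Y. plane_basis A p E X Y"
    then obtain X Y where b: "plane_basis A p E X Y" by blast
    have "g p (curvature_at A g p X Y Y) X = \<kappa> * (g p X X * g p Y Y - (g p X Y)\<^sup>2)"
      using all[OF p] b unfolding P1_def plane_basis_def by blast
    then show "sectional_curvature A g p E = \<kappa>"
      unfolding sectional_curvature_basis[OF p b] using gram_positive[OF p b] by simp
  qed
qed

end
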